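(* Let $\mathscr{A}$ be a finitely generated and germ determined $C^\infty$-ring and let $(X_{\mathscr{A}},\mathscr{O}_{\mathscr{A}})=\mathrm{Spec}(\mathscr{A})$ be the corresponding affine $C^\infty$-scheme. Then any vector field $v$ on $\mathrm{Spec}(\mathscr{A})$ has a flow. In particular, for any point $p\in X_{\mathscr{A}}$ there exists a unique maximal integral curve $\underline{\mu}_p=(\mu_p,(\mu_p)_\#)$ of the vector field $v$ with initial condition $\mu_p(0)=p$.
   Context: **$C^\infty$-rings.** A $C^\infty$-ring is a nonempty set $\mathscr{A}$ with operations $g_{\mathscr{A}}:\mathscr{A}^m\to\mathscr{A}$ for all $m\ge 0$ and all $g\in C^\infty(\mathbb{R}^m)$ such that $(g\circ(f_1,\dots,f_m))_{\mathscr{A}}(c)=g_{\mathscr{A}}((f_1)_{\mathscr{A}}(c),\dots,(f_m)_{\mathscr{A}}(c))$ for all $f_i\in C^\infty(\mathbb{R}^n)$, $c\in\mathscr{A}^n$, and $(x_j)_{\mathscr{A}}(c_1,\dots,c_m)=c_j$ for the coordinate functions $x_j$. Maps of $C^\infty$-rings preserve all operations. A $C^\infty$-ring has an underlying commutative $\mathbb{R}$-algebra; ideals, units and modules refer to it. The ring $C^\infty(M)$ of smooth functions on a manifold $M$ (possibly with boundary) is a $C^\infty$-ring via composition. $\mathscr{A}$ is finitely generated if there is a surjective map of $C^\infty$-rings $C^\infty(\mathbb{R}^n)\to\mathscr{A}$ for some $n\ge 0$. An $\mathbb{R}$-point of $\mathscr{A}$ is a map of $C^\infty$-rings $\mathscr{A}\to\mathbb{R}$.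 $\mathscr{A}$ is local if it has a unique maximal ideal $\mathfrak{m}$ and $\mathscr{A}/\mathfrak{m}\cong\mathbb{R}$. $\mathscr{A}$ is germ determined if there is an injective map of $C^\infty$-rings from $\mathscr{A}$ into a product of local $C^\infty$-rings. A $C^\infty$-derivation of $\mathscr{A}$ is a map $X:\mathscr{A}\to\mathscr{A}$ with $X(f_{\mathscr{A}}(a_1,\dots,a_n))=\sum_i(\partial_i f)_{\mathscr{A}}(a_1,\dots,a_n)\,X(a_i)$ for all $n>0$, $f\in C^\infty(\mathbb{R}^n)$, $a_i\in\mathscr{A}$. **Local $C^\infty$-ringed spaces.** A local $C^\infty$-ringed space is a pair $(X,\mathscr{O}_X)$ of a topological space and a sheaf of $C^\infty$-rings all of whose stalks are local. A map $(X,\mathscr{O}_X)\to(Y,\mathscr{O}_Y)$ is a pair $\underline{f}=(f,f_\#)$ with $f:X\to Y$ continuous and $f_\#:\mathscr{O}_Y\to f_*\mathscr{O}_X$ a map of sheaves of $C^\infty$-rings. For a manifold $M$ (possibly with boundary), $C^\infty_M$ is its sheaf of smooth functions. **$\mathrm{Spec}$.** $X_{\mathscr{A}}$ is the set of $\mathbb{R}$-points of $\mathscr{A}$ with the topology with basis $U_a=\{x\in X_{\mathscr{A}}\mid x(a)\ne 0\}$, $a\in\mathscr{A}$. For $x\in X_{\mathscr{A}}$ let $\pi_x:\mathscr{A}\to\mathscr{A}_x$ be the localization of $\mathscr{A}$, in $C^\infty$-rings, at $\{a\mid x(a)\neq 0\}$; it is surjective with kernel $I_x=\{a\in\mathscr{A}\mid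 \exists d\in\mathscr{A},\ x(d)\neq 0,\ ad=0\}$. For $a\in\mathscr{A}$ put $\mathfrak{s}_a(x)=\pi_x(a)$. For open $U\subseteq X_{\mathscr{A}}$, $\mathscr{O}_{\mathscr{A}}(U)$ is the $C^\infty$-ring (pointwise operations) of maps $s:U\to\bigsqcup_{x\in U}\mathscr{A}_x$ which locally on $U$ agree with sections $\mathfrak{s}_a$, $a\in\mathscr{A}$. Then $\mathrm{Spec}(\mathscr{A})=(X_{\mathscr{A}},\mathscr{O}_{\mathscr{A}})$, a local $C^\infty$-ringed space. **Vector fields.** A vector field on $(X,\mathscr{O}_X)$ is a map of sheaves of real vector spaces $v=\{v_U\}:\mathscr{O}_X\to\mathscr{O}_X$ such that each $v_U:\mathscr{O}_X(U)\to\mathscr{O}_X(U)$ is a $C^\infty$-derivation. Given $\underline{f}:(X,\mathscr{O}_X)\to(Y,\mathscr{O}_Y)$, vector fields $v$ on $X$ and $w$ on $Y$ are $\underline{f}$-related if $f_\#\circ w=(f_*v)\circ f_\#$. **Integral curves.** An interval containing $0$ is a connected subset $I\subseteq\mathbb{R}$ containing $0$ (open, closed, half-open, unbounded, or a single point), regarded as a manifold of dimension 1 (possibly with boundary) or 0. An integral curve of $v$ with initial condition $p\in X$ is either a map $\underline{\sigma}_p:(\{0\},C^\infty_{\{0\}})\to(X,\mathscr{O}_X)$ with $\sigma_p(0)=p$, or a map $\underline{\sigma}_p:(I,C^\infty_I)\to(X,\mathscr{O}_X)$ from a 1-dimensional interval $I$ containing $0$ such that $\frac{d}{dt}$ and $v$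 are $\underline{\sigma}_p$-related and $\sigma_p(0)=p$. An integral curve $\underline{\mu}_p:(K_p,C^\infty_{K_p})\to(X,\mathscr{O}_X)$ with initial condition $p$ is maximal if for every integral curve $\underline{\nu}:(L,C^\infty_L)\to(X,\mathscr{O}_X)$ of $v$ with $\nu(0)=p$ one has $L\subseteq K_p$ and $\underline{\nu}$ is the composite of the inclusion $(L,C^\infty_L)\to(K_p,C^\infty_{K_p})$ with $\underline{\mu}_p$. The domain of the maximal integral curve with initial condition $p$ (if it exists) is denoted $K_p$. **Flows.** A flow of a vector field $v$ on $(X,\mathscr{O}_X)$ is a map of local $C^\infty$-ringed spaces $\underline{\Phi}:(\mathcal{W},\mathscr{O}_{\mathcal{W}})\to(X,\mathscr{O}_X)$ such that (1) $\mathcal{W}=\bigcup_{p\in X}\{p\}\times K_p\subseteq X\times\mathbb{R}$ as sets; (2) for every $p\in X$ there is a map $\underline{\zeta}_p=(\zeta_p,(\zeta_p)_\#):(K_p,C^\infty_{K_p})\to(\mathcal{W},\mathscr{O}_{\mathcal{W}})$ with $\zeta_p(t)=(p,t)$ for all $t\in K_p$; (3) for all $p\in X$ the composite $\underline{\Phi}\circ\underline{\zeta}_p$ is the maximal integral curve $\underline{\mu}_p$ of $v$. *)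

theory Defs
  imports "HOL-Analysis.Analysis" "HOL-Algebra.Ideal"
begin

section \<open>Smooth functions on $R^m$\<close>

text \<open>Powers \<open>S\<^sup>m\<close>, with \<open>m\<close> a variable, are sets of extensional functions on \<open>{..<m}\<close>; in particular
  \<open>R\<^sup>m\<close> is the underlying set of the library's \<open>powertop_real {..<m}\<close>. Coordinates are numbered from 0.
  Functions on \<open>R\<^sup>m\<close> are extensional as well, so that equality of elements of \<open>C\<^sup>\<infinity>(R\<^sup>m)\<close> is equality in
  HOL.\<close>

abbreviation tuples :: "nat \<Rightarrow> 'a set \<Rightarrow> (nat \<Rightarrow> 'a) set"
  where "tuples m S \<equiv> {..<m} \<rightarrow>\<^sub>E S"

abbreviation RR :: "nat \<Rightarrow> (nat \<Rightarrow> real) set"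
  where "RR m \<equiv> tuples m UNIV"

definition partial :: "nat \<Rightarrow> nat \<Rightarrow> ((nat \<Rightarrow> real) \<Rightarrow> real) \<Rightarrow> (nat \<Rightarrow> real) \<Rightarrow> real"
  where "partial m i g = (\<lambda>x\<in>RR m. deriv (\<lambda>t. g (x(i := t))) (x i))"

primrec Ck :: "nat \<Rightarrow> nat \<Rightarrow> ((nat \<Rightarrow> real) \<Rightarrow> real) set"
  where
    "Ck 0 m = {g \<in> extensional (RR m). continuous_map (powertop_real {..<m}) euclideanreal g}"
  | "Ck (Suc k) m = {g \<in> extensional (RR m). continuous_map (powertop_real {..<m}) euclideanreal g \<and>
       (\<forall>i<m. (\<forall>x\<in>RR m. (\<lambda>t. g (x(i := t))) field_differentiable at (x i)) \<and> partial m i g \<in> Ck k m)}"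

definition Cinf :: "nat \<Rightarrow> ((nat \<Rightarrow> real) \<Rightarrow> real) set"
  where "Cinf m = (\<Inter>k. Ck k m)"

definition coord :: "nat \<Rightarrow> nat \<Rightarrow> (nat \<Rightarrow> real) \<Rightarrow> real"
  where "coord m j = (\<lambda>x\<in>RR m. x j)"

definition fcomp :: "nat \<Rightarrow> nat \<Rightarrow> ((nat \<Rightarrow> real) \<Rightarrow> real) \<Rightarrow> (nat \<Rightarrow> (nat \<Rightarrow> real) \<Rightarrow> real) \<Rightarrow> (nat \<Rightarrow> real) \<Rightarrow> real"
  where "fcomp n m g f = (\<lambda>x\<in>RR n. g (\<lambda>i\<in>{..<m}. f i x))"


section \<open>$C^\infty$-rings\<close>

record 'a cinf_ring = "'a partial_object" +
  cop :: "nat \<Rightarrow> ((nat \<Rightarrow> real) \<Rightarrow> real) \<Rightarrow> (nat \<Rightarrow> 'a) \<Rightarrow> 'a"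

locale cinf_ring =
  fixes A :: "'a cinf_ring"
  assumes nonempty: "carrier A \<noteq> {}"
    and cop_closed: "\<lbrakk>g \<in> Cinf m; c \<in> tuples m (carrier A)\<rbrakk> \<Longrightarrow> cop A m g c \<in> carrier A"
    and cop_comp: "\<lbrakk>g \<in> Cinf m; \<And>i. i < m \<Longrightarrow> f i \<in> Cinf n; c \<in> tuples n (carrier A)\<rbrakk>
      \<Longrightarrow> cop A n (fcomp n m g f) c = cop A m g (\<lambda>i\<in>{..<m}. cop A n (f i) c)"
    and cop_coord: "\<lbrakk>j < m; c \<in> tuples m (carrier A)\<rbrakk> \<Longrightarrow> cop A m (coord m j) c = c j"

definition cinf_hom :: "'a cinf_ring \<Rightarrow> 'b cinf_ring \<Rightarrow> ('a \<Rightarrow> 'b) set"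
  where "cinf_hom A B = {h \<in> carrier A \<rightarrow>\<^sub>E carrier B.
    \<forall>m. \<forall>g\<in>Cinf m. \<forall>c\<in>tuples m (carrier A). h (cop A m g c) = cop B m g (\<lambda>i\<in>{..<m}. h (c i))}"

definition cinf_real :: "real cinf_ring"
  where "cinf_real = \<lparr>carrier = UNIV, cop = (\<lambda>m g c. g c)\<rparr>"

definition cinf_free :: "nat \<Rightarrow> ((nat \<Rightarrow> real) \<Rightarrow> real) cinf_ring"
  where "cinf_free n = \<lparr>carrier = Cinf n, cop = (\<lambda>m g f. fcomp n m g f)\<rparr>"

definition cinf_prod :: "'i set \<Rightarrow> ('i \<Rightarrow> 'b cinf_ring) \<Rightarrow> ('i \<Rightarrow> 'b) cinf_ring"
  where "cinf_prod J B = \<lparr>carrier = (\<Pi>\<^sub>E j\<in>J. carrier (B j)),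
    cop = (\<lambda>m g c. \<lambda>j\<in>J. cop (B j) m g (\<lambda>i\<in>{..<m}. c i j))\<rparr>"

definition finitely_generated :: "'a cinf_ring \<Rightarrow> bool"
  where "finitely_generated A \<longleftrightarrow>
    (\<exists>n. \<exists>\<phi>\<in>cinf_hom (cinf_free n) A. \<phi> ` carrier (cinf_free n) = carrier A)"

text \<open>The unit map \<open>R \<rightarrow> A\<close> of the underlying algebra: the operations of arity 0.\<close>

definition scalar :: "'a cinf_ring \<Rightarrow> real \<Rightarrow> 'a"
  where "scalar A r = cop A 0 (\<lambda>x\<in>RR 0. r) (\<lambda>_. undefined)"

definition pair :: "'a \<Rightarrow> 'a \<Rightarrow> nat \<Rightarrow> 'a"
  where "pair a b = (\<lambda>i\<in>{..<2}. if i = 0 then a else b)"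

definition underlying :: "'a cinf_ring \<Rightarrow> 'a ring"
  where "underlying A = \<lparr>carrier = carrier A,
    mult = (\<lambda>a b. cop A 2 (\<lambda>x\<in>RR 2. x 0 * x 1) (pair a b)),
    one = scalar A 1,
    zero = scalar A 0,
    add = (\<lambda>a b. cop A 2 (\<lambda>x\<in>RR 2. x 0 + x 1) (pair a b))\<rparr>"

text \<open>Every ideal of the underlying ring is a congruence for all the operations (Hadamard's lemma), so the
  representatives chosen below do not matter when \<open>J\<close> is an ideal.\<close>

definition cinf_quot :: "'a cinf_ring \<Rightarrow> 'a set \<Rightarrow> 'a set cinf_ring"
  where "cinf_quot A J = \<lparr>carrier = a_rcosets\<^bsub>underlying A\<^esub> J,
    cop = (\<lambda>m g c. J +>\<^bsub>underlying A\<^esub> cop A m g (\<lambda>i\<in>{..<m}. SOME a. a \<in> c i))\<rparr>"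

definition cinf_local :: "'a cinf_ring \<Rightarrow> bool"
  where "cinf_local A \<longleftrightarrow> (\<exists>\<mm>. maximalideal \<mm> (underlying A) \<and>
    (\<forall>J. maximalideal J (underlying A) \<longrightarrow> J = \<mm>) \<and>
    (\<exists>\<phi>\<in>cinf_hom (cinf_quot A \<mm>) cinf_real. bij_betw \<phi> (carrier (cinf_quot A \<mm>)) UNIV))"

text \<open>HOL cannot quantify over types inside a formula, so the types of the index set and of the factors are
  parameters. In a hypothesis of a theorem that is polymorphic in \<open>'i\<close> and \<open>'b\<close> they are in effect
  existentially quantified, which gives the unrestricted notion.\<close>

definition germ_determined :: "('i \<times> 'b) itself \<Rightarrow> 'a cinf_ring \<Rightarrow> bool"
  where "germ_determined T A \<longleftrightarrow> (\<exists>(J :: 'i set) (B :: 'i \<Rightarrow> 'b cinf_ring).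
    (\<forall>j\<in>J. cinf_ring (B j) \<and> cinf_local (B j)) \<and>
    (\<exists>h\<in>cinf_hom A (cinf_prod J B). inj_on h (carrier A)))"

definition cinf_derivation :: "'a cinf_ring \<Rightarrow> ('a \<Rightarrow> 'a) \<Rightarrow> bool"
  where "cinf_derivation A D \<longleftrightarrow> D \<in> carrier A \<rightarrow> carrier A \<and>
    (\<forall>n>0. \<forall>f\<in>Cinf n. \<forall>a\<in>tuples n (carrier A).
       D (cop A n f a) =
         (\<Oplus>\<^bsub>underlying A\<^esub>i\<in>{..<n}. cop A n (partial n i f) a \<otimes>\<^bsub>underlying A\<^esub> D (a i)))"


section \<open>Local $C^\infty$-ringed spaces\<close>

record ('x, 's) cinf_space =
  base :: "'x topology"
  sections :: "'x set \<Rightarrow> 's cinf_ring"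
  restr :: "'x set \<Rightarrow> 'x set \<Rightarrow> 's \<Rightarrow> 's"

definition germ :: "('x, 's) cinf_space \<Rightarrow> 'x \<Rightarrow> 'x set \<Rightarrow> 's \<Rightarrow> ('x set \<times> 's) set"
  where "germ X x U s = {(V, t). openin (base X) V \<and> x \<in> V \<and> t \<in> carrier (sections X V) \<and>
    (\<exists>W. openin (base X) W \<and> x \<in> W \<and> W \<subseteq> U \<inter> V \<and> restr X U W s = restr X V W t)}"

text \<open>The operations on germs are computed on a common neighbourhood of definition.\<close>

definition stalk :: "('x, 's) cinf_space \<Rightarrow> 'x \<Rightarrow> ('x set \<times> 's) set cinf_ring"
  where "stalk X x = \<lparr>
    carrier = {germ X x U s |U s. openin (base X) U \<and> x \<in> U \<and> s \<in> carrier (sections X U)},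
    cop = (\<lambda>m g c. THE \<gamma>. \<exists>U. \<exists>s\<in>tuples m (carrier (sections X U)). openin (base X) U \<and> x \<in> U \<and>
      (\<forall>i<m. c i = germ X x U (s i)) \<and> \<gamma> = germ X x U (cop (sections X U) m g s))\<rparr>"

locale local_cinf_ringed_space =
  fixes X :: "('x, 's) cinf_space"
  assumes sections_ring: "openin (base X) U \<Longrightarrow> cinf_ring (sections X U)"
    and restr_hom: "\<lbrakk>openin (base X) U; openin (base X) V; V \<subseteq> U\<rbrakk>
      \<Longrightarrow> restr X U V \<in> cinf_hom (sections X U) (sections X V)"
    and restr_id: "\<lbrakk>openin (base X) U; s \<in> carrier (sections X U)\<rbrakk> \<Longrightarrow> restr X U U s = s"
    and restr_restr: "\<lbrakk>openin (base X) U; openin (base X) V; openin (base X) W; W \<subseteq> V; V \<subseteq> U;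
      s \<in> carrier (sections X U)\<rbrakk> \<Longrightarrow> restr X V W (restr X U V s) = restr X U W s"
    and gluing: "\<lbrakk>\<And>V. V \<in> \<U> \<Longrightarrow> openin (base X) V; \<And>V. V \<in> \<U> \<Longrightarrow> \<sigma> V \<in> carrier (sections X V);
      \<And>V W. \<lbrakk>V \<in> \<U>; W \<in> \<U>\<rbrakk> \<Longrightarrow> restr X V (V \<inter> W) (\<sigma> V) = restr X W (V \<inter> W) (\<sigma> W)\<rbrakk>
      \<Longrightarrow> \<exists>!t. t \<in> carrier (sections X (\<Union>\<U>)) \<and> (\<forall>V\<in>\<U>. restr X (\<Union>\<U>) V t = \<sigma> V)"
    and stalk_local: "x \<in> topspace (base X) \<Longrightarrow> cinf_local (stalk X x)"

text \<open>A map consists of a map of points \<open>f\<close> and, for each open \<open>U\<close> of the target, a map from the sections on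
  \<open>U\<close> to the sections on the preimage of \<open>U\<close>. All components are extensional, so that equality of maps is
  equality in HOL.\<close>

type_synonym ('x, 's, 'y, 't) cinf_space_map = "('x \<Rightarrow> 'y) \<times> ('y set \<Rightarrow> 't \<Rightarrow> 's)"

definition preim :: "('x, 's) cinf_space \<Rightarrow> ('x, 's, 'y, 't) cinf_space_map \<Rightarrow> 'y set \<Rightarrow> 'x set"
  where "preim X f U = {x \<in> topspace (base X). fst f x \<in> U}"

definition space_map ::
    "('x, 's) cinf_space \<Rightarrow> ('y, 't) cinf_space \<Rightarrow> ('x, 's, 'y, 't) cinf_space_map \<Rightarrow> bool"
  where "space_map X Y f \<longleftrightarrow>
    continuous_map (base X) (base Y) (fst f) \<and> fst f \<in> extensional (topspace (base X)) \<and>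
    snd f \<in> extensional {U. openin (base Y) U} \<and>
    (\<forall>U. openin (base Y) U \<longrightarrow> snd f U \<in> cinf_hom (sections Y U) (sections X (preim X f U))) \<and>
    (\<forall>U V. openin (base Y) U \<and> openin (base Y) V \<and> V \<subseteq> U \<longrightarrow> (\<forall>s\<in>carrier (sections Y U).
       restr X (preim X f U) (preim X f V) (snd f U s) = snd f V (restr Y U V s)))"

text \<open>\<open>space_map_comp X Y Z g f\<close> is the composite of \<open>f\<close> from \<open>X\<close> to \<open>Y\<close> with \<open>g\<close> from \<open>Y\<close> to \<open>Z\<close>.\<close>

definition space_map_comp ::
    "('x, 's) cinf_space \<Rightarrow> ('y, 't) cinf_space \<Rightarrow> ('z, 'u) cinf_space \<Rightarrow>
     ('y, 't, 'z, 'u) cinf_space_map \<Rightarrow> ('x, 's, 'y, 't) cinf_space_map \<Rightarrow> ('x, 's, 'z, 'u) cinf_space_map"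
  where "space_map_comp X Y Z g f =
    ((\<lambda>x\<in>topspace (base X). fst g (fst f x)),
     (\<lambda>U\<in>{U. openin (base Z) U}. \<lambda>s\<in>carrier (sections Z U). snd f (preim Y g U) (snd g U s)))"


section \<open>Spec\<close>

definition points :: "'a cinf_ring \<Rightarrow> ('a \<Rightarrow> real) set"
  where "points A = cinf_hom A cinf_real"

definition spec_top :: "'a cinf_ring \<Rightarrow> ('a \<Rightarrow> real) topology"
  where "spec_top A = topology_generated_by {{x \<in> points A. x a \<noteq> 0} |a. a \<in> carrier A}"

definition germ_ideal :: "'a cinf_ring \<Rightarrow> ('a \<Rightarrow> real) \<Rightarrow> 'a set"
  where "germ_ideal A x = {a \<in> carrier A. \<exists>d\<in>carrier A. x d \<noteq> 0 \<and>
    a \<otimes>\<^bsub>underlying A\<^esub> d = \<zero>\<^bsub>underlying A\<^esub>}"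

text \<open>The localization of \<open>A\<close> at \<open>{a. x a \<noteq> 0}\<close>: the map from \<open>A\<close> to it is surjective with kernel
  \<open>germ_ideal A x\<close>, so it is modelled as the quotient.\<close>

definition loc :: "'a cinf_ring \<Rightarrow> ('a \<Rightarrow> real) \<Rightarrow> 'a set cinf_ring"
  where "loc A x = cinf_quot A (germ_ideal A x)"

definition loc_proj :: "'a cinf_ring \<Rightarrow> ('a \<Rightarrow> real) \<Rightarrow> 'a \<Rightarrow> 'a set"
  where "loc_proj A x a = germ_ideal A x +>\<^bsub>underlying A\<^esub> a"

definition spec_sections :: "'a cinf_ring \<Rightarrow> ('a \<Rightarrow> real) set \<Rightarrow> (('a \<Rightarrow> real) \<Rightarrow> 'a set) cinf_ring"
  where "spec_sections A U = \<lparr>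
    carrier = {s \<in> \<Pi>\<^sub>E x\<in>U. carrier (loc A x). \<forall>x\<in>U. \<exists>V. openin (spec_top A) V \<and> x \<in> V \<and> V \<subseteq> U \<and>
      (\<exists>a\<in>carrier A. \<forall>y\<in>V. s y = loc_proj A y a)},
    cop = (\<lambda>m g c. \<lambda>x\<in>U. cop (loc A x) m g (\<lambda>i\<in>{..<m}. c i x))\<rparr>"

definition Spec :: "'a cinf_ring \<Rightarrow> ('a \<Rightarrow> real, ('a \<Rightarrow> real) \<Rightarrow> 'a set) cinf_space"
  where "Spec A = \<lparr>base = spec_top A, sections = spec_sections A,
    restr = (\<lambda>U V. \<lambda>s\<in>carrier (spec_sections A U). restrict s V)\<rparr>"


section \<open>Intervals\<close>

text \<open>For a subset of the line, smooth means: locally extendable to a smooth function on an open set. This is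
  the usual notion for one-dimensional intervals with or without boundary, and it makes every function on a
  single point smooth.\<close>

definition smooth_on_set :: "real set \<Rightarrow> (real \<Rightarrow> real) \<Rightarrow> bool"
  where "smooth_on_set U h \<longleftrightarrow> (\<forall>t\<in>U. \<exists>V g. open V \<and> t \<in> V \<and>
    (\<forall>k. \<forall>s\<in>V. (deriv ^^ k) g field_differentiable at s) \<and> (\<forall>s\<in>U \<inter> V. h s = g s))"

definition interval_sections :: "real set \<Rightarrow> (real \<Rightarrow> real) cinf_ring"
  where "interval_sections U = \<lparr>carrier = {h \<in> extensional U. smooth_on_set U h},
    cop = (\<lambda>m g c. \<lambda>t\<in>U. g (\<lambda>i\<in>{..<m}. c i t))\<rparr>"

definition interval_space :: "real set \<Rightarrow> (real, real \<Rightarrow> real) cinf_space"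
  where "interval_space L = \<lparr>base = top_of_set L, sections = interval_sections,
    restr = (\<lambda>U V. \<lambda>h\<in>carrier (interval_sections U). restrict h V)\<rparr>"

definition interval_incl :: "real set \<Rightarrow> real set \<Rightarrow> (real, real \<Rightarrow> real, real, real \<Rightarrow> real) cinf_space_map"
  where "interval_incl L K = ((\<lambda>t\<in>L. t),
    (\<lambda>U\<in>{U. openin (top_of_set K) U}. \<lambda>h\<in>carrier (interval_sections U). restrict h (L \<inter> U)))"

definition ddt :: "real set \<Rightarrow> (real \<Rightarrow> real) \<Rightarrow> real \<Rightarrow> real"
  where "ddt U h = (\<lambda>t\<in>U. vector_derivative h (at t within U))"


section \<open>Vector fields, integral curves, flows\<close>

definition vector_field :: "('x, 's) cinf_space \<Rightarrow> ('x set \<Rightarrow> 's \<Rightarrow> 's) \<Rightarrow> bool"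
  where "vector_field X v \<longleftrightarrow>
    (\<forall>U. openin (base X) U \<longrightarrow>
       cinf_derivation (sections X U) (v U) \<and>
       (\<forall>a\<in>carrier (sections X U). \<forall>b\<in>carrier (sections X U).
          v U (a \<oplus>\<^bsub>underlying (sections X U)\<^esub> b) = v U a \<oplus>\<^bsub>underlying (sections X U)\<^esub> v U b) \<and>
       (\<forall>r. \<forall>a\<in>carrier (sections X U).
          v U (scalar (sections X U) r \<otimes>\<^bsub>underlying (sections X U)\<^esub> a) =
          scalar (sections X U) r \<otimes>\<^bsub>underlying (sections X U)\<^esub> v U a)) \<and>
    (\<forall>U V. openin (base X) U \<and> openin (base X) V \<and> V \<subseteq> U \<longrightarrow>
       (\<forall>s\<in>carrier (sections X U). restr X U V (v U s) = v V (restr X U V s)))"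

definition related :: "('x, 's) cinf_space \<Rightarrow> ('y, 't) cinf_space \<Rightarrow> ('x, 's, 'y, 't) cinf_space_map \<Rightarrow>
    ('x set \<Rightarrow> 's \<Rightarrow> 's) \<Rightarrow> ('y set \<Rightarrow> 't \<Rightarrow> 't) \<Rightarrow> bool"
  where "related X Y f v w \<longleftrightarrow> (\<forall>U. openin (base Y) U \<longrightarrow> (\<forall>s\<in>carrier (sections Y U).
    snd f U (w U s) = v (preim X f U) (snd f U s)))"

definition integral_curve :: "('x, 's) cinf_space \<Rightarrow> ('x set \<Rightarrow> 's \<Rightarrow> 's) \<Rightarrow> 'x \<Rightarrow>
    real set \<Rightarrow> (real, real \<Rightarrow> real, 'x, 's) cinf_space_map \<Rightarrow> bool"
  where "integral_curve X v p L \<sigma> \<longleftrightarrow>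
    connected L \<and> 0 \<in> L \<and> space_map (interval_space L) X \<sigma> \<and> fst \<sigma> 0 = p \<and>
    (L \<noteq> {0} \<longrightarrow> related (interval_space L) X \<sigma> ddt v)"

definition maximal_integral_curve :: "('x, 's) cinf_space \<Rightarrow> ('x set \<Rightarrow> 's \<Rightarrow> 's) \<Rightarrow> 'x \<Rightarrow>
    real set \<Rightarrow> (real, real \<Rightarrow> real, 'x, 's) cinf_space_map \<Rightarrow> bool"
  where "maximal_integral_curve X v p K \<mu> \<longleftrightarrow> integral_curve X v p K \<mu> \<and>
    (\<forall>L \<nu>. integral_curve X v p L \<nu> \<longrightarrow> L \<subseteq> K \<and>
       \<nu> = space_map_comp (interval_space L) (interval_space K) X \<mu> (interval_incl L K))"

text \<open>Only the underlying set of \<open>W\<close> is prescribed, not its topology.\<close>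

definition is_flow :: "('x, 's) cinf_space \<Rightarrow> ('x set \<Rightarrow> 's \<Rightarrow> 's) \<Rightarrow>
    ('x \<times> real, 'w) cinf_space \<Rightarrow> ('x \<times> real, 'w, 'x, 's) cinf_space_map \<Rightarrow> bool"
  where "is_flow X v W \<Phi> \<longleftrightarrow> local_cinf_ringed_space W \<and> space_map W X \<Phi> \<and>
    (\<exists>K. topspace (base W) = (\<Union>p\<in>topspace (base X). {p} \<times> K p) \<and>
      (\<forall>p\<in>topspace (base X). \<exists>\<zeta>. space_map (interval_space (K p)) W \<zeta> \<and>
        (\<forall>t\<in>K p. fst \<zeta> t = (p, t)) \<and>
        maximal_integral_curve X v p (K p) (space_map_comp (interval_space (K p)) W X \<Phi> \<zeta>)))"

end

theory Submission
  imports Defs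
begin

text \<open>The maximal integral curve through \<open>p\<close> is the union of all integral curves through \<open>p\<close>, so no existence
  theorem for differential equations is needed. A map from an interval to \<open>Spec A\<close> is determined by its map of
  points, since the value of the image of a section at \<open>t\<close> is the value of the section at the image of \<open>t\<close>.
  Hence an integral curve is a family of points along which every element \<open>a\<close> of \<open>A\<close> is smooth with derivative
  given by \<open>v a\<close>. Near a given point \<open>v a\<close> is again given by an element of \<open>A\<close>, hence by a smooth function of
  the finitely many generators; so two integral curves with the same initial condition satisfy the same
  ordinary differential equation with smooth right-hand side and agree by Gronwall's inequality. The same local
  description shows that all one-sided derivatives at \<open>0\<close> depend only on \<open>p\<close>, so a curve on \<open>[c, 0]\<close> and one
  on \<open>[0, b]\<close> fit together smoothly, and the union is an integral curve. The flow domain is the coproduct of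
  the intervals \<open>K\<^sub>p\<close>, with the functions that are smooth on every slice.\<close>


section \<open>Smooth functions of several variables\<close>

text \<open>The points of Spec A sit in R^n as the common zeros of the relations between the
  generators, possibly an arbitrary closed set, so a solution of the differential equation in R^n
  may leave it at once: an interval of definition can be the single point 0 or be closed at an end.
  A forward curve and a backward curve can exist although neither extends past 0, so the union of
  all curves has to be checked for smoothness at 0; at every other time uniqueness reduces the claim
  to a single curve. The domains also vary with p without control, hence a flow domain whose slices
  are independent of each other. The operations of a smooth ring accept only functions defined on
  all of R^m, so an inverse that exists near one value is replaced by a global function together
  with a cut-off. This device gives local stalks, makes the operations on localizations well
  defined, and shows that maps into Spec A preserve values of sections. Intervals and the flow
  domain are treated by one notion of a sheaf of real functions.\<close>

declare Ck.simps(2) [simp del]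

lemma Ck_Suc_iff: "g \<in> Ck (Suc k) m \<longleftrightarrow> g \<in> extensional (RR m) \<and>
    continuous_map (powertop_real {..<m}) euclideanreal g \<and>
    (\<forall>i<m. (\<forall>x\<in>RR m. (\<lambda>t. g (x(i := t))) field_differentiable at (x i)) \<and> partial m i g \<in> Ck k m)"
  by (simp add: Ck.simps(2))

lemma fun_upd_RR [simp]: "x \<in> RR m \<Longrightarrow> i < m \<Longrightarrow> x(i := t) \<in> RR m"
  by (auto simp: PiE_iff extensional_def)

lemma Ck_extensional: "g \<in> Ck k m \<Longrightarrow> g \<in> extensional (RR m)"
  by (cases k) (simp_all add: Ck_Suc_iff)

lemma Ck_continuous: "g \<in> Ck k m \<Longrightarrow> continuous_map (powertop_real {..<m}) euclideanreal g"
  by (cases k) (simp_all add: Ck_Suc_iff)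

lemma Ck_deriv:
  assumes "g \<in> Ck (Suc k) m" "i < m" "x \<in> RR m"
  shows "((\<lambda>t. g (x(i := t))) has_field_derivative partial m i g x) (at (x i))"
  using assms(1)[unfolded Ck_Suc_iff] assms(2,3)
  by (simp add: partial_def DERIV_deriv_iff_field_differentiable)

lemma Ck_partial: "g \<in> Ck (Suc k) m \<Longrightarrow> i < m \<Longrightarrow> partial m i g \<in> Ck k m"
  by (simp add: Ck_Suc_iff)

lemma Ck_0I:
  "g \<in> extensional (RR m) \<Longrightarrow> continuous_map (powertop_real {..<m}) euclideanreal g \<Longrightarrow> g \<in> Ck 0 m"
  by simp

lemma Ck_SucI:
  assumes "g \<in> extensional (RR m)" "continuous_map (powertop_real {..<m}) euclideanreal g"
    and d: "\<And>i x. i < m \<Longrightarrow> x \<in> RR m \<Longrightarrow>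
      ((\<lambda>t. g (x(i := t))) has_field_derivative d i x) (at (x i))"
    and "\<And>i. i < m \<Longrightarrow> (\<lambda>x\<in>RR m. d i x) \<in> Ck k m"
  shows "g \<in> Ck (Suc k) m"
proof -
  have "partial m i g = (\<lambda>x\<in>RR m. d i x)" if "i < m" for i
    unfolding partial_def using DERIV_imp_deriv[OF d[OF that]] by (auto intro!: restrict_ext)
  then have "partial m i g \<in> Ck k m" if "i < m" for i using assms(4) that by simp
  then show ?thesis using assms(1,2) d unfolding Ck_Suc_iff field_differentiable_def by blast
qed

text \<open>Elements of \<open>Ck\<close> are extensional, so every closure rule produces a
  restricted function. Varying a coordinate stays inside \<open>RR m\<close>, so the restriction is
  invisible to partial derivatives and the rules can be proved for the bare expression
  \<open>G\<close>.\<close>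

lemma Ck_Suc_restrictI:
  assumes "continuous_map (powertop_real {..<m}) euclideanreal (\<lambda>x\<in>RR m. G x)"
    and d: "\<And>i x. i < m \<Longrightarrow> x \<in> RR m \<Longrightarrow>
      ((\<lambda>t. G (x(i := t))) has_field_derivative d i x) (at (x i))"
    and "\<And>i. i < m \<Longrightarrow> (\<lambda>x\<in>RR m. d i x) \<in> Ck k m"
  shows "(\<lambda>x\<in>RR m. G x) \<in> Ck (Suc k) m"
proof (rule Ck_SucI[OF _ assms(1) _ assms(3)])
  fix i x assume i: "i < m" and x: "x \<in> RR m"
  have "(\<lambda>t. (\<lambda>x\<in>RR m. G x) (x(i := t))) = (\<lambda>t. G (x(i := t)))"
    by (rule ext) (use i x in simp)
  with d[OF i x] show "((\<lambda>t. (\<lambda>x\<in>RR m. G x) (x(i := t))) has_field_derivative d i x) (at (x i))"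
    by (simp only:)
qed simp_all

lemma Ck_Suc_subset: "Ck (Suc k) m \<subseteq> Ck k m"
proof (induction k)
  case (Suc k)
  show ?case
  proof
    fix g assume "g \<in> Ck (Suc (Suc k)) m"
    with subsetD[OF Suc] show "g \<in> Ck (Suc k) m"
      unfolding Ck_Suc_iff[of _ "Suc k"] Ck_Suc_iff[of g k] by blast
  qed
qed (simp add: subset_iff Ck_Suc_iff)

lemma Ck_SucD: "g \<in> Ck (Suc k) m \<Longrightarrow> g \<in> Ck k m"
  using Ck_Suc_subset by blast

section \<open>Continuity in boxes and the chain rule\<close>

lemma continuous_map_restrict_RR:
  assumes "continuous_map (powertop_real {..<m}) X f"
  shows "continuous_map (powertop_real {..<m}) X (\<lambda>x\<in>RR m. f x)"
  by (rule continuous_map_eq[OF assms]) auto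

text \<open>A basic open set of the product topology constrains finitely many coordinates by open
  sets, and the least of the radii works for all of them. Inserting 1 keeps \<open>Min\<close>
  meaningful when m = 0.\<close>

lemma continuous_map_box:
  assumes g: "continuous_map (powertop_real {..<m}) euclideanreal g" and z: "z \<in> RR m" and e: "e > 0"
  shows "\<exists>d>0. \<forall>y\<in>RR m. (\<forall>i<m. \<bar>y i - z i\<bar> < d) \<longrightarrow> \<bar>g y - g z\<bar> < e"
proof -
  let ?S = "{y \<in> topspace (powertop_real {..<m}). g y \<in> ball (g z) e}"
  have "openin (powertop_real {..<m}) ?S"
    using g by (rule openin_continuous_map_preimage) auto
  moreover have "z \<in> ?S" using z e by auto
  ultimately obtain U where U: "finite {i \<in> {..<m}. U i \<noteq> topspace euclideanreal}"
      "\<And>i. i \<in> {..<m} \<Longrightarrow> openin euclideanreal (U i)" "z \<in> PiE {..<m} U" "PiE {..<m} U \<subseteq> ?S"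
    unfolding openin_product_topology_alt by meson
  have "\<exists>d>0. ball (z i) d \<subseteq> U i" if "i < m" for i
    using U(2)[of i] U(3) that by (auto simp: open_contains_ball)
  then obtain d where d: "\<And>i. i < m \<Longrightarrow> d i > 0" "\<And>i. i < m \<Longrightarrow> ball (z i) (d i) \<subseteq> U i" by metis
  show ?thesis
  proof (intro exI[of _ "Min (insert 1 (d ` {..<m}))"] conjI ballI impI)
    show "0 < Min (insert 1 (d ` {..<m}))" using d(1) by (subst Min_gr_iff) auto
    fix y assume y: "y \<in> RR m" "\<forall>i<m. \<bar>y i - z i\<bar> < Min (insert 1 (d ` {..<m}))"
    have "y i \<in> U i" if "i < m" for i
    proof -
      have "Min (insert 1 (d ` {..<m})) \<le> d i" using that by (intro Min_le) auto
      then show ?thesis using y(2) that d(2)[OF that] by (force simp: dist_real_def)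
    qed
    then have "y \<in> PiE {..<m} U" using y(1) by (auto simp: PiE_iff)
    then show "\<bar>g y - g z\<bar> < e" using U(4) by (auto simp: dist_real_def abs_minus_commute)
  qed
qed

text \<open>Covers either order of a and b, and a = b, so that an intermediate point can be chosen
  at every time without knowing the sign of the increment. The bound forces \<xi> to a when b tends
  to a.\<close>

lemma mvt_symmetric:
  fixes \<phi> :: "real \<Rightarrow> real"
  assumes "\<And>x. (\<phi> has_field_derivative \<phi>' x) (at x)"
  shows "\<exists>\<xi>. \<bar>\<xi> - a\<bar> \<le> \<bar>b - a\<bar> \<and> \<phi> b - \<phi> a = \<phi>' \<xi> * (b - a)"
proof (cases a b rule: linorder_cases)
  case less
  obtain \<xi> where "a < \<xi>" "\<xi> < b" "\<phi> b - \<phi> a = (b - a) * \<phi>' \<xi>"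
    using MVT2[OF less, of \<phi> \<phi>'] assms by blast
  then show ?thesis by (intro exI[of _ \<xi>]) auto
next
  case greater
  obtain \<xi> where "b < \<xi>" "\<xi> < a" "\<phi> a - \<phi> b = (a - b) * \<phi>' \<xi>"
    using MVT2[OF greater, of \<phi> \<phi>'] assms by blast
  then show ?thesis by (intro exI[of _ \<xi>]) (auto simp: algebra_simps)
qed auto

text \<open>The mean value theorem writes an increment as P s times the increment of h, with P s a
  partial derivative at an unspecified intermediate point. Only the limit of P matters: at s = t the
  factor h s - h t vanishes whatever P t is.\<close>

lemma has_field_derivative_product_increment:
  fixes h :: "real \<Rightarrow> real"
  assumes B: "\<And>s. B s = P s * (h s - h t)" and P: "(P \<longlongrightarrow> p) (at t)"
    and h: "(h has_field_derivative h') (at t)"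
  shows "(B has_field_derivative p * h') (at t)"
proof -
  have "((\<lambda>s. P s * ((h s - h t) / (s - t))) \<longlongrightarrow> p * h') (at t)"
    using h by (intro tendsto_mult P) (simp add: has_field_derivative_iff)
  then show ?thesis by (simp add: has_field_derivative_iff B)
qed

text \<open>The coordinates are moved one at a time; each increment is handled by the mean value theorem.\<close>

lemma chain_rule_Ck:
  assumes g: "g \<in> Ck (Suc k) m"
    and h: "\<And>i. i < m \<Longrightarrow> (h i has_field_derivative h' i) (at t)"
  shows "((\<lambda>s. g (\<lambda>i\<in>{..<m}. h i s)) has_field_derivative
    (\<Sum>i<m. partial m i g (\<lambda>i\<in>{..<m}. h i t) * h' i)) (at t)"
proof -
  \<comment> \<open>\<open>z j s\<close> has its first j coordinates at time s and the others still
    at t: \<open>z 0\<close> is constant and \<open>z m\<close> is the full curve, so the increments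
    telescope.\<close>
  define z where "z j s = (\<lambda>i\<in>{..<m}. if i < j then h i s else h i t)" for j s
  define zt where "zt = (\<lambda>i\<in>{..<m}. h i t)"
  have zR: "z j s \<in> RR m" for j s by (auto simp: z_def)
  have "((\<lambda>s. g (z j s)) has_field_derivative (\<Sum>i<j. partial m i g zt * h' i)) (at t)" if "j \<le> m" for j
    using that
  proof (induction j)
    case 0
    have "z 0 s = zt" for s by (auto simp: z_def zt_def)
    then show ?case by simp
  next
    case (Suc j)
    then have j: "j < m" by simp
    have upd: "z (Suc j) s = (z j s)(j := h j s)" for s using j by (auto simp: z_def fun_eq_iff less_Suc_eq)
    have upd0: "z j s = (z j s)(j := h j t)" for s using j by (auto simp: z_def fun_eq_iff)
    have "\<exists>\<xi>. \<bar>\<xi> - h j t\<bar> \<le> \<bar>h j s - h j t\<bar> \<and>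
        g (z (Suc j) s) - g (z j s) = partial m j g ((z j s)(j := \<xi>)) * (h j s - h j t)" for s
    proof -
      have d: "((\<lambda>t. g ((z j s)(j := t))) has_field_derivative partial m j g ((z j s)(j := x))) (at x)" for x
        using Ck_deriv[OF g j fun_upd_RR[OF zR j], of j s x] by simp
      show ?thesis
        using mvt_symmetric[of "\<lambda>t. g ((z j s)(j := t))" "\<lambda>x. partial m j g ((z j s)(j := x))", OF d, of "h j t" "h j s"]
        unfolding upd using upd0 by metis
    qed
    then obtain \<xi> where \<xi>: "\<And>s. \<bar>\<xi> s - h j t\<bar> \<le> \<bar>h j s - h j t\<bar>"
      "\<And>s. g (z (Suc j) s) - g (z j s) = partial m j g ((z j s)(j := \<xi> s)) * (h j s - h j t)" by metis
    \<comment> \<open>No coordinate of the intermediate point is further from \<open>zt\<close> than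
      that of the curve at time s, so the point tends to \<open>zt\<close> and continuity of the
      partial derivative applies.\<close>
    have "((\<lambda>s. partial m j g ((z j s)(j := \<xi> s))) \<longlongrightarrow> partial m j g zt) (at t)"
    proof (rule tendstoI)
      fix e :: real assume "e > 0"
      then obtain d where d: "d > 0"
        "\<And>y. y \<in> RR m \<Longrightarrow> (\<And>i. i < m \<Longrightarrow> \<bar>y i - zt i\<bar> < d) \<Longrightarrow> \<bar>partial m j g y - partial m j g zt\<bar> < e"
        using continuous_map_box[OF Ck_continuous[OF Ck_partial[OF g j]], of zt e] by (auto simp: zt_def)
      have "\<forall>i\<in>{..<m}. \<forall>\<^sub>F s in at t. dist (h i s) (h i t) < d"
        using h DERIV_isCont d(1) by (auto simp: isCont_def intro!: tendstoD)
      then have "\<forall>\<^sub>F s in at t. \<forall>i\<in>{..<m}. dist (h i s) (h i t) < d"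
        by (intro eventually_ball_finite) auto
      then show "\<forall>\<^sub>F s in at t. dist (partial m j g ((z j s)(j := \<xi> s))) (partial m j g zt) < e"
      proof eventually_elim
        case (elim s)
        have "\<bar>((z j s)(j := \<xi> s)) i - zt i\<bar> < d" if "i < m" for i
          using elim that \<xi>(1)[of s] d(1) j by (auto simp: z_def zt_def dist_real_def intro: le_less_trans)
        then show ?case using d(2)[OF fun_upd_RR[OF zR j]] by (simp add: dist_real_def)
      qed
    qed
    then have "((\<lambda>s. g (z (Suc j) s) - g (z j s)) has_field_derivative partial m j g zt * h' j) (at t)"
      by (intro has_field_derivative_product_increment[where h = "h j" and P = "\<lambda>s. partial m j g ((z j s)(j := \<xi> s))"]
        \<xi>(2) h j)
    from DERIV_add[OF Suc.IH this] j show "((\<lambda>s. g (z (Suc j) s)) has_field_derivative (\<Sum>i<Suc j. partial m i g zt * h' i)) (at t)"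
      by simp
  qed
  then have "((\<lambda>s. g (z m s)) has_field_derivative (\<Sum>i<m. partial m i g zt * h' i)) (at t)" by blast
  moreover have "z m = (\<lambda>s. \<lambda>i\<in>{..<m}. h i s)" by (auto simp: z_def fun_eq_iff)
  ultimately show ?thesis by (simp only: zt_def)
qed

section \<open>Closure of smooth functions under algebra and composition\<close>

lemma Ck_const: "(\<lambda>x\<in>RR m. c) \<in> Ck k m"
proof (induction k arbitrary: c)
  case 0
  show "(\<lambda>x\<in>RR m. c) \<in> Ck 0 m" by (intro Ck_0I continuous_map_restrict_RR) auto
next
  case (Suc k)
  show "(\<lambda>x\<in>RR m. c) \<in> Ck (Suc k) m"
    by (rule Ck_Suc_restrictI[where d = "\<lambda>i x. 0"]) (intro continuous_map_restrict_RR Suc | simp)+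
qed

lemma Ck_coord: "j < m \<Longrightarrow> coord m j \<in> Ck k m"
proof (cases k)
  assume j: "j < m"
  then have c: "continuous_map (powertop_real {..<m}) euclideanreal (coord m j)"
    unfolding coord_def by (intro continuous_map_restrict_RR continuous_map_product_projection) auto
  {
    case 0
    with c show ?thesis by (simp add: coord_def)
  next
    case (Suc l)
    have "coord m j \<in> Ck (Suc l) m"
    proof (rule Ck_SucI[where d = "\<lambda>i x. if i = j then 1 else 0", OF _ c])
      fix i x assume "i < m" "x \<in> RR m"
      then show "((\<lambda>t. coord m j (x(i := t))) has_field_derivative (if i = j then 1 else 0)) (at (x i))"
        by (auto simp: coord_def)
    qed (auto simp: coord_def Ck_const)
    with Suc show ?thesis by simp
  }
qed

lemma Ck_add: "f \<in> Ck k m \<Longrightarrow> g \<in> Ck k m \<Longrightarrow> (\<lambda>x\<in>RR m. f x + g x) \<in> Ck k m"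
proof (induction k arbitrary: f g)
  case 0
  then have "continuous_map (powertop_real {..<m}) euclideanreal (\<lambda>x\<in>RR m. f x + g x)"
    by (intro continuous_map_restrict_RR continuous_map_add) auto
  then show "(\<lambda>x\<in>RR m. f x + g x) \<in> Ck 0 m" by (intro Ck_0I) auto
next
  case (Suc k)
  show "(\<lambda>x\<in>RR m. f x + g x) \<in> Ck (Suc k) m"
  proof (rule Ck_Suc_restrictI[where d = "\<lambda>i x. partial m i f x + partial m i g x"])
    show "continuous_map (powertop_real {..<m}) euclideanreal (\<lambda>x\<in>RR m. f x + g x)"
      using Suc.prems by (intro continuous_map_restrict_RR continuous_map_add Ck_continuous)
    fix i x assume i: "i < m" and x: "x \<in> RR m"
    show "((\<lambda>t. f (x(i := t)) + g (x(i := t))) has_field_derivative partial m i f x + partial m i g x) (at (x i))"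
      using DERIV_add[OF Ck_deriv[OF Suc.prems(1) i x] Ck_deriv[OF Suc.prems(2) i x]] i x
      by (simp only: fun_upd_triv)
  qed (intro Suc.IH Ck_partial Suc.prems)
qed

text \<open>The product rule multiplies a partial derivative by an undifferentiated factor, and the
  latter has to be regarded as merely of class k; this is where \<open>Ck_SucD\<close>
  enters.\<close>

lemma Ck_mult: "f \<in> Ck k m \<Longrightarrow> g \<in> Ck k m \<Longrightarrow> (\<lambda>x\<in>RR m. f x * g x) \<in> Ck k m"
proof (induction k arbitrary: f g)
  case 0
  then have "continuous_map (powertop_real {..<m}) euclideanreal (\<lambda>x\<in>RR m. f x * g x)"
    by (intro continuous_map_restrict_RR continuous_map_real_mult) auto
  then show "(\<lambda>x\<in>RR m. f x * g x) \<in> Ck 0 m" by (intro Ck_0I) auto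
next
  case (Suc k)
  show "(\<lambda>x\<in>RR m. f x * g x) \<in> Ck (Suc k) m"
  proof (rule Ck_Suc_restrictI[where d = "\<lambda>i x. partial m i f x * g x + partial m i g x * f x"])
    show "continuous_map (powertop_real {..<m}) euclideanreal (\<lambda>x\<in>RR m. f x * g x)"
      using Suc.prems by (intro continuous_map_restrict_RR continuous_map_real_mult Ck_continuous)
    fix i x assume i: "i < m" and x: "x \<in> RR m"
    show "((\<lambda>t. f (x(i := t)) * g (x(i := t))) has_field_derivative partial m i f x * g x + partial m i g x * f x) (at (x i))"
      using DERIV_mult[OF Ck_deriv[OF Suc.prems(1) i x] Ck_deriv[OF Suc.prems(2) i x]] i x
      by (simp only: fun_upd_triv)
  next
    fix i assume i: "i < m"
    have "(\<lambda>x\<in>RR m. partial m i f x * g x) \<in> Ck k m" "(\<lambda>x\<in>RR m. partial m i g x * f x) \<in> Ck k m"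
      by (intro Suc.IH Ck_SucD[OF Suc.prems(1)] Ck_SucD[OF Suc.prems(2)] Ck_partial[OF _ i] Suc.prems)+
    from Ck_add[OF this] show "(\<lambda>x\<in>RR m. partial m i f x * g x + partial m i g x * f x) \<in> Ck k m"
      by (simp cong: restrict_cong)
  qed
qed

lemma Ck_sum:
  fixes l :: nat
  shows "(\<And>i. i < l \<Longrightarrow> f i \<in> Ck k m) \<Longrightarrow> (\<lambda>x\<in>RR m. \<Sum>i<l. f i x) \<in> Ck k m"
proof (induction l)
  case (Suc l)
  have "(\<lambda>x\<in>RR m. (\<lambda>x\<in>RR m. \<Sum>i<l. f i x) x + f l x) \<in> Ck k m"
    by (intro Ck_add Suc) auto
  then show "(\<lambda>x\<in>RR m. \<Sum>i<Suc l. f i x) \<in> Ck k m" by (simp cong: restrict_cong)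
qed (simp add: Ck_const)

lemma continuous_map_fcomp:
  assumes "continuous_map (powertop_real {..<m}) euclideanreal g"
    and "\<And>i. i < m \<Longrightarrow> continuous_map (powertop_real {..<n}) euclideanreal (f i)"
  shows "continuous_map (powertop_real {..<n}) euclideanreal (fcomp n m g f)"
  unfolding fcomp_def
proof (rule continuous_map_restrict_RR, rule continuous_map_compose[OF _ assms(1), unfolded comp_def])
  show "continuous_map (powertop_real {..<n}) (powertop_real {..<m}) (\<lambda>x. \<lambda>i\<in>{..<m}. f i x)"
    using assms(2) by (simp add: continuous_map_componentwise image_subset_iff)
qed

lemma fcomp_extensional: "fcomp n m g f \<in> extensional (RR n)"
  by (simp add: fcomp_def)

text \<open>By the chain rule the partial derivatives of the composite are sums of products of
  \<open>partial m i g\<close>, composed with the same inner functions, and of partial derivatives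
  of these; hence only g varies in the induction.\<close>

lemma Ck_fcomp:
  "g \<in> Ck k m \<Longrightarrow> (\<And>i. i < m \<Longrightarrow> f i \<in> Ck k n) \<Longrightarrow> fcomp n m g f \<in> Ck k n"
proof (induction k arbitrary: g)
  case 0
  then have "continuous_map (powertop_real {..<n}) euclideanreal (fcomp n m g f)"
    by (intro continuous_map_fcomp) auto
  then show ?case by (rule Ck_0I[OF fcomp_extensional])
next
  case (Suc k)
  show ?case
  proof (rule Ck_SucI[where d = "\<lambda>j x. \<Sum>i<m. fcomp n m (partial m i g) f x * partial n j (f i) x"])
    show "continuous_map (powertop_real {..<n}) euclideanreal (fcomp n m g f)"
      using Suc.prems by (intro continuous_map_fcomp Ck_continuous)
    fix j x assume j: "j < n" and x: "x \<in> RR n"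
    have "((\<lambda>s. g (\<lambda>i\<in>{..<m}. f i (x(j := s)))) has_field_derivative
      (\<Sum>i<m. partial m i g (\<lambda>i\<in>{..<m}. f i (x(j := x j))) * partial n j (f i) x)) (at (x j))"
      by (rule chain_rule_Ck[OF Suc.prems(1)]) (rule Ck_deriv[OF Suc.prems(2) j x])
    then show "((\<lambda>t. fcomp n m g f (x(j := t))) has_field_derivative
        (\<Sum>i<m. fcomp n m (partial m i g) f x * partial n j (f i) x)) (at (x j))"
      using j x by (simp add: fcomp_def)
  next
    fix j assume j: "j < n"
    have "(\<lambda>x\<in>RR n. \<Sum>i<m. (\<lambda>x\<in>RR n. fcomp n m (partial m i g) f x * partial n j (f i) x) x) \<in> Ck k n"
    proof (rule Ck_sum)
      fix i assume i: "i < m"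
      have "fcomp n m (partial m i g) f \<in> Ck k n"
        by (rule Suc.IH[OF Ck_partial[OF Suc.prems(1) i] Ck_SucD[OF Suc.prems(2)]])
      then show "(\<lambda>x\<in>RR n. fcomp n m (partial m i g) f x * partial n j (f i) x) \<in> Ck k n"
        by (rule Ck_mult[OF _ Ck_partial[OF Suc.prems(2)[OF i] j]])
    qed
    then show "(\<lambda>x\<in>RR n. \<Sum>i<m. fcomp n m (partial m i g) f x * partial n j (f i) x) \<in> Ck k n"
      by (simp cong: restrict_cong)
  qed (rule fcomp_extensional)
qed

lemma Cinf_I: "(\<And>k. g \<in> Ck k m) \<Longrightarrow> g \<in> Cinf m" by (simp add: Cinf_def)
lemma Cinf_D: "g \<in> Cinf m \<Longrightarrow> g \<in> Ck k m" by (simp add: Cinf_def)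

lemma Cinf_const: "(\<lambda>x\<in>RR m. c) \<in> Cinf m" by (intro Cinf_I Ck_const)
lemma Cinf_coord: "j < m \<Longrightarrow> coord m j \<in> Cinf m" by (intro Cinf_I Ck_coord)
lemma Cinf_proj: "j < m \<Longrightarrow> (\<lambda>x\<in>RR m. x j) \<in> Cinf m" using Cinf_coord by (simp add: coord_def)
lemma Cinf_add: "f \<in> Cinf m \<Longrightarrow> g \<in> Cinf m \<Longrightarrow> (\<lambda>x\<in>RR m. f x + g x) \<in> Cinf m"
  by (simp add: Cinf_def Ck_add)
lemma Cinf_mult: "f \<in> Cinf m \<Longrightarrow> g \<in> Cinf m \<Longrightarrow> (\<lambda>x\<in>RR m. f x * g x) \<in> Cinf m"
  by (simp add: Cinf_def Ck_mult)
lemma Cinf_fcomp: "g \<in> Cinf m \<Longrightarrow> (\<And>i. i < m \<Longrightarrow> f i \<in> Cinf n) \<Longrightarrow> fcomp n m g f \<in> Cinf n"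
  by (simp add: Cinf_def Ck_fcomp)
lemma Cinf_partial: "g \<in> Cinf m \<Longrightarrow> i < m \<Longrightarrow> partial m i g \<in> Cinf m"
  by (meson Cinf_D Cinf_I Ck_partial)

section \<open>Reciprocals, flat functions and cut-offs\<close>

lemma Ck_inverse: "f \<in> Ck k m \<Longrightarrow> (\<And>x. x \<in> RR m \<Longrightarrow> f x \<noteq> 0) \<Longrightarrow> (\<lambda>x\<in>RR m. inverse (f x)) \<in> Ck k m"
proof (induction k)
  case 0
  then have "continuous_map (powertop_real {..<m}) euclideanreal (\<lambda>x\<in>RR m. inverse (f x))"
    by (intro continuous_map_restrict_RR continuous_map_real_inverse) auto
  then show "(\<lambda>x\<in>RR m. inverse (f x)) \<in> Ck 0 m" by (intro Ck_0I) auto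
next
  case (Suc k)
  have I: "(\<lambda>x\<in>RR m. inverse (f x)) \<in> Ck k m" by (rule Suc.IH[OF Ck_SucD[OF Suc.prems(1)] Suc.prems(2)])
  show "(\<lambda>x\<in>RR m. inverse (f x)) \<in> Ck (Suc k) m"
  proof (rule Ck_Suc_restrictI[where d = "\<lambda>i x. -1 * (partial m i f x * (inverse (f x) * inverse (f x)))"])
    show "continuous_map (powertop_real {..<m}) euclideanreal (\<lambda>x\<in>RR m. inverse (f x))"
      using Ck_continuous[OF I] .
    fix i x assume i: "i < m" and x: "x \<in> RR m"
    have "((\<lambda>t. inverse (f (x(i := t)))) has_field_derivative
        - (partial m i f x * inverse (f (x(i := x i)) ^ Suc (Suc 0)))) (at (x i))"
      by (rule DERIV_inverse_fun[OF Ck_deriv[OF Suc.prems(1) i x]]) (use Suc.prems(2)[OF x] in simp)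
    then show "((\<lambda>t. inverse (f (x(i := t)))) has_field_derivative
        -1 * (partial m i f x * (inverse (f x) * inverse (f x)))) (at (x i))"
      by simp
  next
    fix i assume i: "i < m"
    have p: "partial m i f \<in> Ck k m" using Ck_partial[OF Suc.prems(1) i] .
    from Ck_mult[OF Ck_const[where c = "-1"] Ck_mult[OF p Ck_mult[OF I I]]]
    show "(\<lambda>x\<in>RR m. -1 * (partial m i f x * (inverse (f x) * inverse (f x)))) \<in> Ck k m"
      by (simp cong: restrict_cong)
  qed
qed

text \<open>For n = 0 this is the classical flat function exp(-1/t), extended by 0. The factor
  t^(-n) makes the family closed under differentiation up to linear combinations, as an induction
  over the order of smoothness requires.\<close>

definition flat :: "nat \<Rightarrow> real \<Rightarrow> real"
  where "flat n t = (if t > 0 then inverse t ^ n * exp (- inverse t) else 0)"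

lemma flat_nonneg: "0 \<le> flat n t"
  by (simp add: flat_def)

text \<open>Substituting u = 1/t turns the right-hand limit into that of u^n / exp u at
  infinity.\<close>

lemma flat_tendsto_0: "(flat n \<longlongrightarrow> 0) (at 0)"
proof (rule filterlim_split_at)
  show "(flat n \<longlongrightarrow> 0) (at_left 0)"
    by (rule tendsto_eventually) (auto simp: flat_def eventually_at_filter)
  have "((\<lambda>t. inverse t ^ n / exp (inverse t)) \<longlongrightarrow> 0) (at_right (0::real))"
    by (rule filterlim_compose[OF tendsto_power_div_exp_0 filterlim_inverse_at_top_right])
  then show "(flat n \<longlongrightarrow> 0) (at_right 0)"
    by (rule Lim_transform_eventually) (auto simp: flat_def eventually_at_filter exp_minus field_simps)
qed

lemma flat_deriv: "(flat n has_field_derivative flat (n + 2) t - real n * flat (n + 1) t) (at t)"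
proof (cases t "0::real" rule: linorder_cases)
  case less
  have "((\<lambda>t. 0) has_field_derivative 0) (at t)" by simp
  then show ?thesis using less
    by (intro DERIV_cong_ev[THEN iffD1, OF refl _ _, of "\<lambda>_. 0" "flat n" _ 0])
      (auto simp: flat_def eventually_nhds intro!: exI[of _ "{..<0}"])
next
  case equal
  \<comment> \<open>The difference quotient of \<open>flat n\<close> at 0 is
    \<open>flat (Suc n)\<close>, which tends to 0.\<close>
  have "((\<lambda>s. (flat n s - flat n 0) / (s - 0)) \<longlongrightarrow> 0) (at 0)"
    by (rule Lim_transform_eventually[OF flat_tendsto_0[of "Suc n"]])
      (auto simp: flat_def eventually_at_filter field_simps)
  then show ?thesis using equal by (simp add: has_field_derivative_iff flat_def)
next
  case greater
  have "((\<lambda>t. inverse t ^ n * exp (- inverse t)) has_field_derivative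
      flat (n + 2) t - real n * flat (n + 1) t) (at t)"
  proof -
    have p: "((\<lambda>t. inverse t ^ n) has_field_derivative - (real n * inverse t ^ (n + 1))) (at t)"
    proof (induction n)
      case (Suc n)
      have "((\<lambda>t. inverse t * inverse t ^ n) has_field_derivative - (real (Suc n) * inverse t ^ (Suc n + 1))) (at t)"
        using DERIV_mult[OF DERIV_inverse Suc.IH] greater by (simp add: algebra_simps)
      then show ?case by simp
    qed simp
    have e: "((\<lambda>t. exp (- inverse t)) has_field_derivative exp (- inverse t) * (inverse t)\<^sup>2) (at t)"
      using greater by (auto intro!: derivative_eq_intros simp: power2_eq_square)
    show ?thesis using DERIV_mult[OF p e] greater
      by (simp add: flat_def power2_eq_square algebra_simps)
  qed
  then show ?thesis using greater
    by (intro DERIV_cong_ev[THEN iffD1, OF refl _ refl, of "\<lambda>t. inverse t ^ n * exp (- inverse t)" "flat n"])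
      (auto simp: flat_def eventually_nhds intro!: exI[of _ "{0<..}"])
qed

lemma Ck_flat: "f \<in> Ck k m \<Longrightarrow> (\<lambda>x\<in>RR m. flat n (f x)) \<in> Ck k m"
proof (induction k arbitrary: n)
  have c: "continuous_map (powertop_real {..<m}) euclideanreal (\<lambda>x\<in>RR m. flat n (f x))"
    if "continuous_map (powertop_real {..<m}) euclideanreal f" for n
  proof (rule continuous_map_restrict_RR, rule continuous_map_compose[OF that, unfolded comp_def])
    show "continuous_map euclidean euclideanreal (flat n)"
      by (auto intro!: continuous_at_imp_continuous_on DERIV_isCont[OF flat_deriv])
  qed
  {
    case 0
    then show "(\<lambda>x\<in>RR m. flat n (f x)) \<in> Ck 0 m" by (intro Ck_0I c) auto
  next
    case (Suc k)
    show "(\<lambda>x\<in>RR m. flat n (f x)) \<in> Ck (Suc k) m"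
    proof (rule Ck_Suc_restrictI[where d = "\<lambda>i x. (flat (n + 2) (f x) + - real n * flat (n + 1) (f x)) * partial m i f x"])
      fix i x assume i: "i < m" and x: "x \<in> RR m"
      have "((\<lambda>t. flat n (f (x(i := t)))) has_field_derivative
          (flat (n + 2) (f (x(i := x i))) - real n * flat (n + 1) (f (x(i := x i)))) * partial m i f x) (at (x i))"
        by (rule DERIV_chain2[OF flat_deriv Ck_deriv[OF Suc.prems i x]])
      then show "((\<lambda>t. flat n (f (x(i := t)))) has_field_derivative
          (flat (n + 2) (f x) + - real n * flat (n + 1) (f x)) * partial m i f x) (at (x i))"
        by simp
    next
      fix i assume i: "i < m"
      note I = Suc.IH[OF Ck_SucD[OF Suc.prems]]
      from Ck_mult[OF Ck_add[OF I[of "n+2"] Ck_mult[OF Ck_const[where c = "- real n"] I[of "n+1"]]] Ck_partial[OF Suc.prems i]]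
      show "(\<lambda>x\<in>RR m. (flat (n + 2) (f x) + - real n * flat (n + 1) (f x)) * partial m i f x) \<in> Ck k m"
        by (simp cong: restrict_cong)
    qed (use c Ck_continuous[OF Suc.prems] in blast)
  }
qed

text \<open>The inverse of x - q near r is not an operation of a smooth ring, because it is
  undefined at q. It is replaced by a function \<psi> smooth on the whole line and a cut-off e that
  is nonzero at r; identities that hold where e is nonzero become ring identities after
  multiplication by e.\<close>

lemma Cinf_local_inverse:
  fixes q r :: real
  assumes "q \<noteq> r"
  obtains \<psi> e where "\<psi> \<in> Cinf 1" "e \<in> Cinf 1" "\<And>x. x \<in> RR 1 \<Longrightarrow> x 0 = r \<Longrightarrow> e x \<noteq> 0"
    "\<And>x. x \<in> RR 1 \<Longrightarrow> e x \<noteq> 0 \<Longrightarrow> (x 0 - q) * \<psi> x = 1"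
proof -
  \<comment> \<open>Half of (r - q)^2 separates the two points: the square of x - q exceeds a at r
    and stays below it near q.\<close>
  define a where "a = (r - q)\<^sup>2 / 2"
  have a: "0 < a" "a < (r - q)\<^sup>2" using assms by (auto simp: a_def)
  define s where "s = (\<lambda>x\<in>RR 1. (x 0 + - q) * (x 0 + - q))"
  define l where "l = (\<lambda>x\<in>RR 1. x 0 + - q)"
  have l: "l \<in> Ck k 1" for k
    unfolding l_def using Ck_add[OF Ck_coord[of 0 1 k] Ck_const[where c = "- q"]] by (simp add: coord_def cong: restrict_cong)
  have s: "s \<in> Ck k 1" for k
    using Ck_mult[OF l l] by (simp add: s_def l_def cong: restrict_cong)
  define e where "e = (\<lambda>x\<in>RR 1. flat 0 (s x + - a))"
  have e: "e \<in> Ck k 1" for k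
    using Ck_flat[OF Ck_add[OF s Ck_const[where c = "- a"]], of 0] by (simp add: e_def cong: restrict_cong)
  define d where "d = (\<lambda>x\<in>RR 1. s x + flat 0 (a + - 1 * s x))"
  have d: "d \<in> Ck k 1" for k
    using Ck_add[OF s Ck_flat[OF Ck_add[OF Ck_const[where c = a] Ck_mult[OF Ck_const[where c = "-1"] s]], of 0]]
    by (simp add: d_def cong: restrict_cong)
  \<comment> \<open>\<open>s\<close> is nonnegative, and where it vanishes the flat term is positive
    because a > 0; so the denominator has no zero.\<close>
  have d0: "d x \<noteq> 0" if "x \<in> RR 1" for x
  proof -
    have d: "d x = s x + flat 0 (a - s x)" using that by (simp add: d_def)
    have "0 \<le> s x" using that by (simp add: s_def)
    then consider "s x = 0" | "0 < s x" by linarith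
    then show ?thesis
    proof cases
      case 1
      then show ?thesis using a(1) by (simp add: d flat_def)
    next
      case 2
      then show ?thesis using flat_nonneg[of 0 "a - s x"] by (simp add: d)
    qed
  qed
  \<comment> \<open>\<open>l\<close> divided by \<open>l\<^sup>2\<close>, with a correction of the denominator that vanishes for \<open>l\<^sup>2 \<ge> a\<close> and removes the zero\<close>
  define \<psi> where "\<psi> = (\<lambda>x\<in>RR 1. l x * inverse (d x))"
  have \<psi>: "\<psi> \<in> Ck k 1" for k
    using Ck_mult[OF l Ck_inverse[OF d d0]] by (simp add: \<psi>_def cong: restrict_cong)
  show thesis
  proof
    show "\<psi> \<in> Cinf 1" "e \<in> Cinf 1" using \<psi> e by (auto intro: Cinf_I)
    fix x :: "nat \<Rightarrow> real" assume x: "x \<in> RR 1"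
    show "e x \<noteq> 0" if "x 0 = r"
    proof -
      have "s x = (r - q)\<^sup>2" using x that by (simp add: s_def power2_eq_square)
      then show ?thesis using x a(2) by (simp add: e_def flat_def)
    qed
    show "(x 0 - q) * \<psi> x = 1" if "e x \<noteq> 0"
    proof -
      have sx: "a < s x" using that x by (simp add: e_def flat_def split: if_splits)
      then have "d x = s x" using x by (simp add: d_def flat_def)
      moreover have "(x 0 - q) * \<psi> x = s x * inverse (d x)"
        using x by (simp add: \<psi>_def l_def s_def)
      ultimately show ?thesis using sx a(1) by simp
    qed
  qed
qed


section \<open>Smooth functions of one variable\<close>

text \<open>The definition of smoothness speaks of \<open>(deriv ^^ k) h\<close>. Peeling off the
  innermost derivative instead gives induction hypotheses that apply to \<open>deriv h\<close>, the
  form in which sum, product and chain rule can be iterated.\<close>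

primrec differentiable_upto :: "nat \<Rightarrow> real set \<Rightarrow> (real \<Rightarrow> real) \<Rightarrow> bool"
  where
    "differentiable_upto 0 V h \<longleftrightarrow> (\<forall>s\<in>V. h field_differentiable at s)"
  | "differentiable_upto (Suc k) V h \<longleftrightarrow>
      (\<forall>s\<in>V. h field_differentiable at s) \<and> differentiable_upto k V (deriv h)"

definition smooth_on_open :: "real set \<Rightarrow> (real \<Rightarrow> real) \<Rightarrow> bool"
  where "smooth_on_open V h \<longleftrightarrow> (\<forall>k. \<forall>s\<in>V. (deriv ^^ k) h field_differentiable at s)"

lemma smooth_on_set_iff: "smooth_on_set U h \<longleftrightarrow>
    (\<forall>t\<in>U. \<exists>V g. open V \<and> t \<in> V \<and> smooth_on_open V g \<and> (\<forall>s\<in>U \<inter> V. h s = g s))"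
  by (simp add: smooth_on_set_def smooth_on_open_def)

lemma deriv_funpow_shift: "(deriv ^^ Suc j) h = (deriv ^^ j) (deriv h)"
  unfolding funpow_Suc_right by simp

lemma differentiable_upto_iff:
  "differentiable_upto k V h \<longleftrightarrow> (\<forall>j\<le>k. \<forall>s\<in>V. (deriv ^^ j) h field_differentiable at s)"
proof (induction k arbitrary: h)
  case (Suc k)
  have "(\<forall>j\<le>Suc k. P j) \<longleftrightarrow> P 0 \<and> (\<forall>j\<le>k. P (Suc j))" for P
    using All_less_Suc2[of "Suc k" P] by (simp add: less_Suc_eq_le)
  from this[of "\<lambda>j. \<forall>s\<in>V. (deriv ^^ j) h field_differentiable at s"] show ?case
    unfolding differentiable_upto.simps(2) Suc.IH[of "deriv h"] deriv_funpow_shift funpow_0 by blast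
qed simp

lemma smooth_on_open_iff: "smooth_on_open V h \<longleftrightarrow> (\<forall>k. differentiable_upto k V h)"
  unfolding smooth_on_open_def differentiable_upto_iff by blast

lemma smooth_on_open_deriv: "smooth_on_open V h \<Longrightarrow> smooth_on_open V (deriv h)"
  unfolding smooth_on_open_iff by (metis differentiable_upto.simps(2))

lemma smooth_on_open_has_deriv:
  "smooth_on_open V h \<Longrightarrow> s \<in> V \<Longrightarrow> (h has_field_derivative deriv h s) (at s)"
  using DERIV_deriv_iff_field_differentiable by (fastforce simp: smooth_on_open_def dest: spec[of _ 0])

lemma smooth_on_open_subset: "smooth_on_open V h \<Longrightarrow> W \<subseteq> V \<Longrightarrow> smooth_on_open W h"
  by (auto simp: smooth_on_open_def)

lemma eventually_nhds_open: "open V \<Longrightarrow> s \<in> V \<Longrightarrow> (\<And>u. u \<in> V \<Longrightarrow> P u) \<Longrightarrow> eventually P (nhds s)"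
  by (auto simp: eventually_nhds)

text \<open>\<open>deriv\<close> is a total operator, while formulas for a derivative hold only on
  V. Since V is open, agreement on V passes to the derivatives, so the induction changes both
  functions at each order.\<close>

lemma differentiable_upto_cong:
  assumes V: "open V" and "\<And>s. s \<in> V \<Longrightarrow> f s = g s" "differentiable_upto k V f"
  shows "differentiable_upto k V g"
proof -
  have d: "g field_differentiable at s \<and> deriv f s = deriv g s"
    if eq: "\<forall>s\<in>V. f s = g s" and f: "\<forall>s\<in>V. f field_differentiable at s" and s: "s \<in> V" for f g s
  proof -
    have ev: "eventually (\<lambda>u. f u = g u) (nhds s)" by (rule eventually_nhds_open[OF V s]) (use eq in blast)
    obtain D where "(f has_field_derivative D) (at s)" using f s unfolding field_differentiable_def by blast
    then have "(g has_field_derivative D) (at s)" by (rule DERIV_cong_ev[OF refl ev refl, THEN iffD1])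
    then show ?thesis
      using deriv_cong_ev[OF ev refl] unfolding field_differentiable_def by blast
  qed
  have "\<forall>f g. (\<forall>s\<in>V. f s = g s) \<longrightarrow> differentiable_upto k V f \<longrightarrow> differentiable_upto k V g"
  proof (induction k)
    case 0
    then show ?case using d unfolding differentiable_upto.simps(1) by blast
  next
    case (Suc k)
    show ?case
    proof (intro allI impI)
      fix f g assume eq: "\<forall>s\<in>V. f s = g s" and "differentiable_upto (Suc k) V f"
      then have f: "\<forall>s\<in>V. f field_differentiable at s" "differentiable_upto k V (deriv f)"
        by simp_all
      have "\<forall>s\<in>V. deriv f s = deriv g s" using d[OF eq f(1)] by blast
      with Suc f(2) have "differentiable_upto k V (deriv g)" by blast
      with d[OF eq f(1)] show "differentiable_upto (Suc k) V g"
        unfolding differentiable_upto.simps(2) by blast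
    qed
  qed
  with assms(2,3) show ?thesis by blast
qed

lemma differentiable_upto_SucI:
  assumes "open V" "\<And>s. s \<in> V \<Longrightarrow> (h has_field_derivative h' s) (at s)" "differentiable_upto k V h'"
  shows "differentiable_upto (Suc k) V h"
proof -
  have "differentiable_upto k V (deriv h)"
    by (rule differentiable_upto_cong[OF assms(1) _ assms(3)])
      (rule DERIV_imp_deriv[OF assms(2), symmetric])
  moreover have "\<forall>s\<in>V. h field_differentiable at s"
    using assms(2) unfolding field_differentiable_def by blast
  ultimately show ?thesis unfolding differentiable_upto.simps(2) by blast
qed

lemma differentiable_upto_D:
  "differentiable_upto k V h \<Longrightarrow> s \<in> V \<Longrightarrow> (h has_field_derivative deriv h s) (at s)"
proof -
  assume "differentiable_upto k V h" "s \<in> V"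
  then have "(deriv ^^ 0) h field_differentiable at s" unfolding differentiable_upto_iff by blast
  then show ?thesis unfolding funpow_0 by (rule field_differentiable_derivI)
qed

lemma differentiable_upto_Suc_D: "differentiable_upto (Suc k) V h \<Longrightarrow> differentiable_upto k V h"
  by (simp only: differentiable_upto_iff) simp

lemma differentiable_upto_const: "differentiable_upto k V (\<lambda>_. c)"
proof (induction k arbitrary: c)
  case (Suc k)
  have "deriv (\<lambda>_::real. c) = (\<lambda>_. 0)" by (rule ext) simp
  then show ?case unfolding differentiable_upto.simps(2) by (simp only:) (simp add: Suc)
qed simp

lemma differentiable_upto_add:
  assumes "open V"
  shows "differentiable_upto k V f \<Longrightarrow> differentiable_upto k V g \<Longrightarrow> differentiable_upto k V (\<lambda>t. f t + g t)"
proof (induction k arbitrary: f g)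
  case 0
  then show ?case by (auto intro!: field_differentiable_add)
next
  case (Suc k)
  have "differentiable_upto k V (\<lambda>t. deriv f t + deriv g t)" using Suc by simp
  moreover have "((\<lambda>t. f t + g t) has_field_derivative deriv f s + deriv g s) (at s)" if "s \<in> V" for s
    by (intro DERIV_add differentiable_upto_D[OF Suc.prems(1) that] differentiable_upto_D[OF Suc.prems(2) that])
  ultimately show "differentiable_upto (Suc k) V (\<lambda>t. f t + g t)"
    by (intro differentiable_upto_SucI[OF assms])
qed

lemma differentiable_upto_mult:
  assumes "open V"
  shows "differentiable_upto k V f \<Longrightarrow> differentiable_upto k V g \<Longrightarrow> differentiable_upto k V (\<lambda>t. f t * g t)"
proof (induction k arbitrary: f g)
  case 0
  then show ?case by (auto intro!: field_differentiable_mult)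
next
  case (Suc k)
  have "differentiable_upto k V (\<lambda>t. deriv f t * g t + deriv g t * f t)"
    using Suc.prems differentiable_upto_Suc_D[OF Suc.prems(1)] differentiable_upto_Suc_D[OF Suc.prems(2)]
    by (intro differentiable_upto_add[OF assms] Suc.IH) simp_all
  moreover have "((\<lambda>t. f t * g t) has_field_derivative deriv f s * g s + deriv g s * f s) (at s)" if "s \<in> V" for s
    by (intro DERIV_mult differentiable_upto_D[OF Suc.prems(1) that] differentiable_upto_D[OF Suc.prems(2) that])
  ultimately show "differentiable_upto (Suc k) V (\<lambda>t. f t * g t)"
    by (intro differentiable_upto_SucI[OF assms])
qed

lemma differentiable_upto_sum:
  fixes l :: nat
  assumes "open V"
  shows "(\<And>i. i < l \<Longrightarrow> differentiable_upto k V (f i)) \<Longrightarrow> differentiable_upto k V (\<lambda>t. \<Sum>i<l. f i t)"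
proof (induction l)
  case (Suc l)
  have "differentiable_upto k V (\<lambda>t. (\<Sum>i<l. f i t) + f l t)"
    by (intro differentiable_upto_add[OF assms] Suc) auto
  then show ?case by simp
qed (simp add: differentiable_upto_const)

lemma differentiable_upto_compose:
  assumes V: "open V"
  shows "g \<in> Cinf m \<Longrightarrow> (\<And>i. i < m \<Longrightarrow> differentiable_upto k V (h i)) \<Longrightarrow>
    differentiable_upto k V (\<lambda>t. g (\<lambda>i\<in>{..<m}. h i t))"
proof (induction k arbitrary: g)
  have d: "((\<lambda>t. g (\<lambda>i\<in>{..<m}. h i t)) has_field_derivative
      (\<Sum>i<m. partial m i g (\<lambda>i\<in>{..<m}. h i s) * deriv (h i) s)) (at s)"
    if "g \<in> Cinf m" "\<And>i. i < m \<Longrightarrow> differentiable_upto k V (h i)" "s \<in> V" for g k s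
    by (rule chain_rule_Ck[OF Cinf_D[OF that(1)]]) (rule differentiable_upto_D[OF that(2) that(3)])
  {
    case 0
    show "differentiable_upto 0 V (\<lambda>t. g (\<lambda>i\<in>{..<m}. h i t))"
      unfolding differentiable_upto.simps(1) field_differentiable_def using d[OF 0] by blast
  next
    case (Suc k)
    have "differentiable_upto k V (\<lambda>t. \<Sum>i<m. partial m i g (\<lambda>i\<in>{..<m}. h i t) * deriv (h i) t)"
    proof (intro differentiable_upto_sum[OF V] differentiable_upto_mult[OF V])
      fix i assume i: "i < m"
      show "differentiable_upto k V (\<lambda>t. partial m i g (\<lambda>i\<in>{..<m}. h i t))"
        by (rule Suc.IH[OF Cinf_partial[OF Suc.prems(1) i] differentiable_upto_Suc_D[OF Suc.prems(2)]])
      show "differentiable_upto k V (deriv (h i))" using Suc.prems(2)[OF i] by simp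
    qed
    from differentiable_upto_SucI[OF V d[OF Suc.prems] this]
    show "differentiable_upto (Suc k) V (\<lambda>t. g (\<lambda>i\<in>{..<m}. h i t))" .
  }
qed

lemma smooth_on_open_compose:
  assumes "open V" "g \<in> Cinf m" "\<And>i. i < m \<Longrightarrow> smooth_on_open V (h i)"
  shows "smooth_on_open V (\<lambda>t. g (\<lambda>i\<in>{..<m}. h i t))"
  using differentiable_upto_compose[OF assms(1,2)] assms(3) unfolding smooth_on_open_iff by blast

text \<open>The derivative of the glued function is glued from the derivatives; at 0 this uses that
  f and g agree in value and in first derivative. The hypothesis on all orders is inherited by
  \<open>deriv f\<close> and \<open>deriv g\<close>, so the argument repeats.\<close>

lemma smooth_on_open_glue:
  assumes V: "open V" and "smooth_on_open V f" "smooth_on_open V g"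
    and "\<And>k. (deriv ^^ k) f 0 = (deriv ^^ k) g 0"
  shows "smooth_on_open V (\<lambda>t. if 0 \<le> t then f t else g t)"
proof -
  have "differentiable_upto k V (\<lambda>t. if 0 \<le> t then f t else g t)"
    if "smooth_on_open V f" "smooth_on_open V g" "\<And>k. (deriv ^^ k) f 0 = (deriv ^^ k) g 0" for f g k
    using that
  proof (induction k arbitrary: f g)
    have d: "((\<lambda>t. if 0 \<le> t then f t else g t) has_field_derivative (if 0 \<le> s then deriv f s else deriv g s)) (at s)"
      if f: "smooth_on_open V f" and g: "smooth_on_open V g" and eq: "\<And>k. (deriv ^^ k) f 0 = (deriv ^^ k) g 0"
        and s: "s \<in> V" for f g s
    proof (cases s "0::real" rule: linorder_cases)
      case less
      then have "eventually (\<lambda>u. g u = (if 0 \<le> u then f u else g u)) (nhds s)"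
        by (intro eventually_nhds_open[of "{..<0}"]) auto
      from DERIV_cong_ev[OF refl this refl] smooth_on_open_has_deriv[OF g s] less show ?thesis by simp
    next
      case greater
      then have "eventually (\<lambda>u. f u = (if 0 \<le> u then f u else g u)) (nhds s)"
        by (intro eventually_nhds_open[of "{0<..}"]) auto
      from DERIV_cong_ev[OF refl this refl] smooth_on_open_has_deriv[OF f s] greater show ?thesis by simp
    next
      case equal
      let ?h = "\<lambda>t. if 0 \<le> t then f t else g t"
      have fg: "f 0 = g 0" "deriv f 0 = deriv g 0" using eq[of 0] eq[of 1] by auto
      have F: "((\<lambda>t. (f t - f 0) / (t - 0)) \<longlongrightarrow> deriv f 0) (at_right 0)"
        using smooth_on_open_has_deriv[OF f s] equal
        by (auto simp: has_field_derivative_iff intro: tendsto_mono[OF at_le])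
      have G: "((\<lambda>t. (g t - g 0) / (t - 0)) \<longlongrightarrow> deriv f 0) (at_left 0)"
        using smooth_on_open_has_deriv[OF g s] equal fg(2)
        by (auto simp: has_field_derivative_iff intro: tendsto_mono[OF at_le])
      have "((\<lambda>t. (?h t - ?h 0) / (t - 0)) \<longlongrightarrow> deriv f 0) (at 0)"
      proof (rule filterlim_split_at)
        show "((\<lambda>t. (?h t - ?h 0) / (t - 0)) \<longlongrightarrow> deriv f 0) (at_right 0)"
          by (rule Lim_transform_eventually[OF F]) (auto simp: eventually_at_filter)
        show "((\<lambda>t. (?h t - ?h 0) / (t - 0)) \<longlongrightarrow> deriv f 0) (at_left 0)"
          by (rule Lim_transform_eventually[OF G]) (auto simp: eventually_at_filter fg(1))
      qed
      then show ?thesis using equal unfolding has_field_derivative_iff by simp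
    qed
    {
      case 0
      show "differentiable_upto 0 V (\<lambda>t. if 0 \<le> t then f t else g t)"
        unfolding differentiable_upto.simps(1) field_differentiable_def using d[OF 0] by blast
    next
      case (Suc k)
      have "(deriv ^^ j) (deriv f) 0 = (deriv ^^ j) (deriv g) 0" for j
        using Suc.prems(3)[of "Suc j"] by (simp only: deriv_funpow_shift)
      then have "differentiable_upto k V (\<lambda>t. if 0 \<le> t then deriv f t else deriv g t)"
        by (rule Suc.IH[OF smooth_on_open_deriv[OF Suc.prems(1)] smooth_on_open_deriv[OF Suc.prems(2)]])
      from differentiable_upto_SucI[OF V d[OF Suc.prems] this]
      show "differentiable_upto (Suc k) V (\<lambda>t. if 0 \<le> t then f t else g t)" .
    }
  qed
  with assms(2-) show ?thesis unfolding smooth_on_open_iff by blast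
qed

section \<open>Smooth functions on subsets of the line\<close>

lemma smooth_on_set_cong:
  assumes "smooth_on_set U f" "\<And>t. t \<in> U \<Longrightarrow> f t = g t"
  shows "smooth_on_set U g"
  using assms unfolding smooth_on_set_iff by (metis IntD1)

lemma smooth_on_set_subset:
  assumes "smooth_on_set U f" "W \<subseteq> U"
  shows "smooth_on_set W f"
  unfolding smooth_on_set_iff
proof
  fix t assume "t \<in> W"
  then obtain V g where "open V" "t \<in> V" "smooth_on_open V g" "\<forall>s\<in>U \<inter> V. f s = g s"
    using assms unfolding smooth_on_set_iff by blast
  then show "\<exists>V g. open V \<and> t \<in> V \<and> smooth_on_open V g \<and> (\<forall>s\<in>W \<inter> V. f s = g s)"
    using assms(2) by (intro exI[of _ V] exI[of _ g]) auto
qed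

lemma smooth_on_set_local:
  assumes "\<And>t. t \<in> U \<Longrightarrow> \<exists>S. open S \<and> t \<in> S \<and> smooth_on_set (U \<inter> S) f"
  shows "smooth_on_set U f"
  unfolding smooth_on_set_iff
proof
  fix t assume t: "t \<in> U"
  obtain S where S: "open S" "t \<in> S" "smooth_on_set (U \<inter> S) f" using assms[OF t] by blast
  then obtain V g where V: "open V" "t \<in> V" "smooth_on_open V g" "\<forall>s\<in>(U \<inter> S) \<inter> V. f s = g s"
    using t unfolding smooth_on_set_iff by blast
  then show "\<exists>V g. open V \<and> t \<in> V \<and> smooth_on_open V g \<and> (\<forall>s\<in>U \<inter> V. f s = g s)"
    using S by (intro exI[of _ "S \<inter> V"] exI[of _ g]) (auto intro: smooth_on_open_subset)
qed

lemma smooth_on_set_compose: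
  assumes "g \<in> Cinf m" "\<And>i. i < m \<Longrightarrow> smooth_on_set U (c i)"
  shows "smooth_on_set U (\<lambda>t. g (\<lambda>i\<in>{..<m}. c i t))"
  unfolding smooth_on_set_iff
proof
  fix t assume t: "t \<in> U"
  have "\<forall>i. \<exists>V h. i < m \<longrightarrow> open V \<and> t \<in> V \<and> smooth_on_open V h \<and> (\<forall>s\<in>U \<inter> V. c i s = h s)"
    using assms(2) t unfolding smooth_on_set_iff by blast
  then obtain V h where V: "\<And>i. i < m \<Longrightarrow> open (V i)" "\<And>i. i < m \<Longrightarrow> t \<in> V i"
    "\<And>i. i < m \<Longrightarrow> smooth_on_open (V i) (h i)" "\<And>i s. i < m \<Longrightarrow> s \<in> U \<inter> V i \<Longrightarrow> c i s = h i s"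
    by metis
  let ?W = "\<Inter>i\<in>{..<m}. V i"
  have W: "open ?W" using V(1) by auto
  have "smooth_on_open ?W (h i)" if "i < m" for i
    using V(3)[OF that] by (rule smooth_on_open_subset) (use that in auto)
  note * = smooth_on_open_compose[OF W assms(1) this]
  have "g (\<lambda>i\<in>{..<m}. c i s) = g (\<lambda>i\<in>{..<m}. h i s)" if "s \<in> U \<inter> ?W" for s
    by (rule arg_cong[of _ _ g], rule restrict_ext) (use V(4) that in auto)
  then show "\<exists>V h. open V \<and> t \<in> V \<and> smooth_on_open V h \<and> (\<forall>s\<in>U \<inter> V. g (\<lambda>i\<in>{..<m}. c i s) = h s)"
    using W V(2) * by (intro exI[of _ ?W] exI[of _ "\<lambda>t. g (\<lambda>i\<in>{..<m}. h i t)"]) auto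
qed

text \<open>A local smooth extension supplies the derivative. No uniqueness is claimed: at an
  isolated point of U every D qualifies.\<close>

lemma smooth_on_set_has_derivative:
  assumes "smooth_on_set U h" "t \<in> U"
  obtains D where "(h has_field_derivative D) (at t within U)"
proof -
  obtain V g where V: "open V" "t \<in> V" "smooth_on_open V g" "\<forall>s\<in>U \<inter> V. h s = g s"
    using assms unfolding smooth_on_set_iff by blast
  have "(g has_field_derivative deriv g t) (at t within U)"
    using smooth_on_open_has_deriv[OF V(3,2)] by (rule has_field_derivative_at_within)
  moreover have "\<forall>\<^sub>F s in at t within U. h s = g s"
    using V by (auto simp: eventually_at_topological intro!: exI[of _ V])
  moreover have "h t = g t" using V assms(2) by blast
  ultimately have "(h has_field_derivative deriv g t) (at t within U)"
    using has_field_derivative_cong_eventually by blast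
  then show thesis by (rule that)
qed

lemma smooth_on_set_continuous_on: "smooth_on_set U h \<Longrightarrow> continuous_on U h"
  by (meson DERIV_continuous continuous_on_eq_continuous_within smooth_on_set_has_derivative)


section \<open>The ring underlying a smooth ring, and its points\<close>

lemma underlying_simps [simp]:
  "carrier (underlying A) = carrier A"
  "\<one>\<^bsub>underlying A\<^esub> = scalar A 1"
  "\<zero>\<^bsub>underlying A\<^esub> = scalar A 0"
  by (simp_all add: underlying_def)

lemma Cinf_plus: "(\<lambda>x\<in>RR 2. x 0 + x 1) \<in> Cinf 2"
  using Cinf_add[OF Cinf_proj[of 0 2] Cinf_proj[of 1 2]] by (simp cong: restrict_cong)

lemma Cinf_times: "(\<lambda>x\<in>RR 2. x 0 * x 1) \<in> Cinf 2"
  using Cinf_mult[OF Cinf_proj[of 0 2] Cinf_proj[of 1 2]] by (simp cong: restrict_cong)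

lemma pair_tuples: "a \<in> S \<Longrightarrow> b \<in> S \<Longrightarrow> pair a b \<in> tuples 2 S"
  by (auto simp: pair_def)

lemma restrict_pair: "(\<lambda>i\<in>{..<2}. h (pair a b i)) = pair (h a) (h b)"
  by (auto simp: pair_def fun_eq_iff)

context cinf_ring
begin

abbreviation "R \<equiv> underlying A"

text \<open>Together with the rules for products and constants, this translates ring identities
  among elements given by operations on one tuple into pointwise identities of real
  functions.\<close>

lemma cop_plus:
  assumes "f \<in> Cinf n" "g \<in> Cinf n" "c \<in> tuples n (carrier A)"
  shows "cop A n f c \<oplus>\<^bsub>R\<^esub> cop A n g c = cop A n (\<lambda>x\<in>RR n. f x + g x) c"
proof -
  have "cop A n (fcomp n 2 (\<lambda>x\<in>RR 2. x 0 + x 1) (\<lambda>i. if i = 0 then f else g)) c =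
      cop A 2 (\<lambda>x\<in>RR 2. x 0 + x 1) (\<lambda>i\<in>{..<2}. cop A n (if i = 0 then f else g) c)"
    using assms by (intro cop_comp[OF Cinf_plus]) auto
  moreover have "fcomp n 2 (\<lambda>x\<in>RR 2. x 0 + x 1) (\<lambda>i. if i = 0 then f else g) = (\<lambda>x\<in>RR n. f x + g x)"
    unfolding fcomp_def by (rule restrict_ext) simp
  moreover have "(\<lambda>i\<in>{..<2}. cop A n (if i = 0 then f else g) c) = pair (cop A n f c) (cop A n g c)"
    unfolding pair_def by (rule restrict_ext) simp
  ultimately show ?thesis by (simp add: underlying_def)
qed

lemma cop_times:
  assumes "f \<in> Cinf n" "g \<in> Cinf n" "c \<in> tuples n (carrier A)"
  shows "cop A n f c \<otimes>\<^bsub>R\<^esub> cop A n g c = cop A n (\<lambda>x\<in>RR n. f x * g x) c"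
proof -
  have "cop A n (fcomp n 2 (\<lambda>x\<in>RR 2. x 0 * x 1) (\<lambda>i. if i = 0 then f else g)) c =
      cop A 2 (\<lambda>x\<in>RR 2. x 0 * x 1) (\<lambda>i\<in>{..<2}. cop A n (if i = 0 then f else g) c)"
    using assms by (intro cop_comp[OF Cinf_times]) auto
  moreover have "fcomp n 2 (\<lambda>x\<in>RR 2. x 0 * x 1) (\<lambda>i. if i = 0 then f else g) = (\<lambda>x\<in>RR n. f x * g x)"
    unfolding fcomp_def by (rule restrict_ext) simp
  moreover have "(\<lambda>i\<in>{..<2}. cop A n (if i = 0 then f else g) c) = pair (cop A n f c) (cop A n g c)"
    unfolding pair_def by (rule restrict_ext) simp
  ultimately show ?thesis by (simp add: underlying_def)
qed

lemma cop_const: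
  assumes "c \<in> tuples n (carrier A)"
  shows "cop A n (\<lambda>x\<in>RR n. r) c = scalar A r"
proof -
  \<comment> \<open>A constant on R^n is the nullary constant composed with an empty family; the
    empty tuple is represented by \<open>\<lambda>_. undefined\<close>, as in
    \<open>scalar\<close>.\<close>
  have "cop A n (fcomp n 0 (\<lambda>x\<in>RR 0. r) (\<lambda>_. undefined)) c =
      cop A 0 (\<lambda>x\<in>RR 0. r) (\<lambda>i\<in>{..<0}. cop A n undefined c)"
    by (rule cop_comp[OF Cinf_const _ assms]) simp
  moreover have "fcomp n 0 (\<lambda>x\<in>RR 0. r) (\<lambda>_. undefined) = (\<lambda>x\<in>RR n. r)"
    unfolding fcomp_def
  proof (rule restrict_ext)
    fix x :: "nat \<Rightarrow> real"
    have "(\<lambda>i\<in>{..<0}. undefined x) \<in> RR 0" unfolding restrict_PiE_iff by simp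
    then show "(\<lambda>x\<in>RR 0. r) (\<lambda>i\<in>{..<0}. undefined x) = r" by (rule restrict_apply')
  qed
  moreover have "(\<lambda>i\<in>{..<0::nat}. cop A n undefined c) = (\<lambda>_. undefined)" by (simp add: fun_eq_iff)
  ultimately show ?thesis by (simp add: scalar_def)
qed

lemma scalar_closed: "scalar A r \<in> carrier A"
  unfolding scalar_def by (rule cop_closed[OF Cinf_const]) simp

lemma add_closed: "a \<in> carrier A \<Longrightarrow> b \<in> carrier A \<Longrightarrow> a \<oplus>\<^bsub>R\<^esub> b \<in> carrier A"
  using cop_closed[OF Cinf_plus pair_tuples] by (simp add: underlying_def)

lemma mult_closed: "a \<in> carrier A \<Longrightarrow> b \<in> carrier A \<Longrightarrow> a \<otimes>\<^bsub>R\<^esub> b \<in> carrier A"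
  using cop_closed[OF Cinf_times pair_tuples] by (simp add: underlying_def)

text \<open>Any three elements are the values of the coordinate functions at the tuple they form.
  Ring axioms involve at most three elements, so all of them reduce to identities between functions
  on R^3.\<close>

lemma three_elements:
  assumes "a \<in> carrier A" "b \<in> carrier A" "d \<in> carrier A"
  obtains t f g h where "t \<in> tuples 3 (carrier A)" "f \<in> Cinf 3" "g \<in> Cinf 3" "h \<in> Cinf 3"
    "a = cop A 3 f t" "b = cop A 3 g t" "d = cop A 3 h t"
proof
  let ?t = "\<lambda>i\<in>{..<3}. if i = 0 then a else if i = 1 then b else d"
  show t: "?t \<in> tuples 3 (carrier A)" using assms by auto
  show "coord 3 0 \<in> Cinf 3" "coord 3 1 \<in> Cinf 3" "coord 3 2 \<in> Cinf 3" by (simp_all add: Cinf_coord)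
  show "a = cop A 3 (coord 3 0) ?t" "b = cop A 3 (coord 3 1) ?t" "d = cop A 3 (coord 3 2) ?t"
    using t by (simp_all add: cop_coord)
qed

lemmas cop_ring_simps = cop_plus cop_times cop_const[symmetric] Cinf_add Cinf_mult Cinf_const

lemma cring_underlying: "cring R"
proof (rule cringI)
  show "abelian_group R"
  proof (rule abelian_groupI)
    fix a b assume ab: "a \<in> carrier R" "b \<in> carrier R"
    then show "a \<oplus>\<^bsub>R\<^esub> b \<in> carrier R" by (simp add: add_closed)
    from ab have "a \<in> carrier A" "b \<in> carrier A" "b \<in> carrier A" by simp_all
    then obtain t f g h where t: "t \<in> tuples 3 (carrier A)" "f \<in> Cinf 3" "g \<in> Cinf 3" "h \<in> Cinf 3"
      and e: "a = cop A 3 f t" "b = cop A 3 g t" "b = cop A 3 h t"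
      by (rule three_elements[of a b b])
    show "a \<oplus>\<^bsub>R\<^esub> b = b \<oplus>\<^bsub>R\<^esub> a"
      unfolding e(1,2) cop_plus[OF t(2,3,1)] cop_plus[OF t(3,2,1)] by (simp add: add.commute)
    fix d assume "d \<in> carrier R"
    with ab have "a \<in> carrier A" "b \<in> carrier A" "d \<in> carrier A" by simp_all
    then obtain t f g h where t: "t \<in> tuples 3 (carrier A)" "f \<in> Cinf 3" "g \<in> Cinf 3" "h \<in> Cinf 3"
      and e: "a = cop A 3 f t" "b = cop A 3 g t" "d = cop A 3 h t"
      by (rule three_elements)
    show "a \<oplus>\<^bsub>R\<^esub> b \<oplus>\<^bsub>R\<^esub> d = a \<oplus>\<^bsub>R\<^esub> (b \<oplus>\<^bsub>R\<^esub> d)"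
      unfolding e using t by (simp add: cop_ring_simps add.assoc cong: restrict_cong)
  next
    fix a assume a: "a \<in> carrier R"
    then have "a \<in> carrier A" "a \<in> carrier A" "a \<in> carrier A" by simp_all
    then obtain t f g h where t: "t \<in> tuples 3 (carrier A)" "f \<in> Cinf 3" "g \<in> Cinf 3" "h \<in> Cinf 3"
      and e: "a = cop A 3 f t" "a = cop A 3 g t" "a = cop A 3 h t"
      by (rule three_elements[of a a a])
    have f: "(\<lambda>x\<in>RR 3. f x) = f" using Cinf_D[OF t(2), THEN Ck_extensional] by (rule extensional_restrict)
    have z: "scalar A 0 = cop A 3 (\<lambda>x\<in>RR 3. 0) t" using cop_const[OF t(1)] by simp
    show "\<zero>\<^bsub>R\<^esub> \<oplus>\<^bsub>R\<^esub> a = a"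
      unfolding underlying_simps z e(1) cop_plus[OF Cinf_const t(2,1)] by (simp add: f cong: restrict_cong)
    \<comment> \<open>The additive inverse is the operation of the function -f, written as a product
      with the constant -1 so that closure of \<open>Cinf\<close> under products applies.\<close>
    let ?n = "cop A 3 (\<lambda>x\<in>RR 3. (\<lambda>x\<in>RR 3. -1) x * f x) t"
    have m: "(\<lambda>x\<in>RR 3. (\<lambda>x\<in>RR 3. -1) x * f x) \<in> Cinf 3" by (intro Cinf_mult Cinf_const t)
    show "\<exists>b\<in>carrier R. b \<oplus>\<^bsub>R\<^esub> a = \<zero>\<^bsub>R\<^esub>"
    proof
      show "?n \<in> carrier R" using cop_closed[OF m t(1)] by simp
      show "?n \<oplus>\<^bsub>R\<^esub> a = \<zero>\<^bsub>R\<^esub>"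
        unfolding underlying_simps z e(1) cop_plus[OF m t(2,1)] by (simp cong: restrict_cong)
    qed
  qed (simp add: scalar_closed)
  show "comm_monoid R"
  proof (rule comm_monoidI)
    fix a b assume ab: "a \<in> carrier R" "b \<in> carrier R"
    then show "a \<otimes>\<^bsub>R\<^esub> b \<in> carrier R" by (simp add: mult_closed)
    from ab have "a \<in> carrier A" "b \<in> carrier A" "b \<in> carrier A" by simp_all
    then obtain t f g h where t: "t \<in> tuples 3 (carrier A)" "f \<in> Cinf 3" "g \<in> Cinf 3" "h \<in> Cinf 3"
      and e: "a = cop A 3 f t" "b = cop A 3 g t" "b = cop A 3 h t"
      by (rule three_elements[of a b b])
    show "a \<otimes>\<^bsub>R\<^esub> b = b \<otimes>\<^bsub>R\<^esub> a"
      unfolding e(1,2) cop_times[OF t(2,3,1)] cop_times[OF t(3,2,1)] by (simp add: mult.commute)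
    fix d assume "d \<in> carrier R"
    with ab have "a \<in> carrier A" "b \<in> carrier A" "d \<in> carrier A" by simp_all
    then obtain t f g h where t: "t \<in> tuples 3 (carrier A)" "f \<in> Cinf 3" "g \<in> Cinf 3" "h \<in> Cinf 3"
      and e: "a = cop A 3 f t" "b = cop A 3 g t" "d = cop A 3 h t"
      by (rule three_elements)
    show "a \<otimes>\<^bsub>R\<^esub> b \<otimes>\<^bsub>R\<^esub> d = a \<otimes>\<^bsub>R\<^esub> (b \<otimes>\<^bsub>R\<^esub> d)"
      unfolding e using t by (simp add: cop_ring_simps mult.assoc cong: restrict_cong)
  next
    fix a assume a: "a \<in> carrier R"
    then have "a \<in> carrier A" "a \<in> carrier A" "a \<in> carrier A" by simp_all
    then obtain t f g h where t: "t \<in> tuples 3 (carrier A)" "f \<in> Cinf 3" "g \<in> Cinf 3" "h \<in> Cinf 3"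
      and e: "a = cop A 3 f t" "a = cop A 3 g t" "a = cop A 3 h t"
      by (rule three_elements[of a a a])
    have f: "(\<lambda>x\<in>RR 3. f x) = f" using Cinf_D[OF t(2), THEN Ck_extensional] by (rule extensional_restrict)
    have z: "scalar A 1 = cop A 3 (\<lambda>x\<in>RR 3. 1) t" using cop_const[OF t(1)] by simp
    show "\<one>\<^bsub>R\<^esub> \<otimes>\<^bsub>R\<^esub> a = a"
      unfolding underlying_simps z e(1) cop_times[OF Cinf_const t(2,1)] by (simp add: f cong: restrict_cong)
  qed (simp add: scalar_closed)
  fix a b d assume "a \<in> carrier R" "b \<in> carrier R" "d \<in> carrier R"
  then have "a \<in> carrier A" "b \<in> carrier A" "d \<in> carrier A" by simp_all
  then obtain t f g h where t: "t \<in> tuples 3 (carrier A)" "f \<in> Cinf 3" "g \<in> Cinf 3" "h \<in> Cinf 3"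
    and e: "a = cop A 3 f t" "b = cop A 3 g t" "d = cop A 3 h t"
    by (rule three_elements)
  show "(a \<oplus>\<^bsub>R\<^esub> b) \<otimes>\<^bsub>R\<^esub> d = a \<otimes>\<^bsub>R\<^esub> d \<oplus>\<^bsub>R\<^esub> b \<otimes>\<^bsub>R\<^esub> d"
    unfolding e using t by (simp add: cop_ring_simps distrib_right cong: restrict_cong)
qed

lemma idealI_absorbing:
  assumes "I \<subseteq> carrier A" "scalar A 0 \<in> I" "\<And>a b. a \<in> I \<Longrightarrow> b \<in> I \<Longrightarrow> a \<oplus>\<^bsub>R\<^esub> b \<in> I"
    and r: "\<And>a b. a \<in> I \<Longrightarrow> b \<in> carrier A \<Longrightarrow> b \<otimes>\<^bsub>R\<^esub> a \<in> I"
  shows "ideal I R"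
proof -
  interpret cring R by (rule cring_underlying)
  show ?thesis
  proof (rule idealI[OF ring_axioms])
    show "subgroup I (add_monoid R)"
    proof (rule add.subgroupI)
      show "I \<subseteq> carrier R" "I \<noteq> {}" using assms by auto
      fix a assume a: "a \<in> I"
      then have "(\<ominus>\<^bsub>R\<^esub> \<one>\<^bsub>R\<^esub>) \<otimes>\<^bsub>R\<^esub> a \<in> I" using r[OF a, of "\<ominus>\<^bsub>R\<^esub> \<one>\<^bsub>R\<^esub>"] a_inv_closed[OF one_closed] by simp
      then show "\<ominus>\<^bsub>R\<^esub> a \<in> I" using a assms(1) l_minus[OF one_closed, of a] by (auto simp del: underlying_simps(2))
    qed (use assms in auto)
    fix a x assume "a \<in> I" "x \<in> carrier R"
    then show "x \<otimes>\<^bsub>R\<^esub> a \<in> I" "a \<otimes>\<^bsub>R\<^esub> x \<in> I" using r[of a x] m_comm[of a x] assms(1) by auto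
  qed
qed

lemma coset_add_left:
  assumes I: "ideal I R" and z: "z \<in> I" and w: "w \<in> carrier A"
  shows "I +>\<^bsub>R\<^esub> (z \<oplus>\<^bsub>R\<^esub> w) = I +>\<^bsub>R\<^esub> w"
proof -
  interpret ideal I R by (rule I)
  have "z \<oplus>\<^bsub>R\<^esub> w \<in> I +>\<^bsub>R\<^esub> w" using z by (auto simp: a_r_coset_def')
  then show ?thesis using w a_subgroup by (intro a_repr_independence[symmetric]) simp_all
qed

end

text \<open>The choice does not matter: a point that annihilates an ideal is constant on its cosets.\<close>

definition coset_value :: "('a \<Rightarrow> real) \<Rightarrow> 'a set \<Rightarrow> real"
  where "coset_value e c = e (SOME a. a \<in> c)"

section \<open>Points, their kernels and local rings\<close>

locale cinf_point = cinf_ring A for A :: "'a cinf_ring" +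
  fixes e :: "'a \<Rightarrow> real"
  assumes point: "e \<in> cinf_hom A cinf_real"
begin

lemma point_cop:
  "g \<in> Cinf m \<Longrightarrow> c \<in> tuples m (carrier A) \<Longrightarrow> e (cop A m g c) = g (\<lambda>i\<in>{..<m}. e (c i))"
  using point by (auto simp: cinf_hom_def cinf_real_def)

lemma point_scalar: "e (scalar A r) = r"
  unfolding scalar_def by (subst point_cop[OF Cinf_const]) auto

lemma point_add: "a \<in> carrier A \<Longrightarrow> b \<in> carrier A \<Longrightarrow> e (a \<oplus>\<^bsub>R\<^esub> b) = e a + e b"
  using point_cop[OF Cinf_plus pair_tuples, of a b] by (simp add: underlying_def restrict_pair) (simp add: pair_def)

lemma point_mult: "a \<in> carrier A \<Longrightarrow> b \<in> carrier A \<Longrightarrow> e (a \<otimes>\<^bsub>R\<^esub> b) = e a * e b"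
  using point_cop[OF Cinf_times pair_tuples, of a b] by (simp add: underlying_def restrict_pair) (simp add: pair_def)

lemma point_minus:
  assumes a: "a \<in> carrier A"
  shows "e (\<ominus>\<^bsub>R\<^esub> a) = - e a"
proof -
  interpret cring R by (rule cring_underlying)
  have "e (a \<oplus>\<^bsub>R\<^esub> \<ominus>\<^bsub>R\<^esub> a) = 0" using a r_neg[of a] point_scalar by simp
  moreover have "\<ominus>\<^bsub>R\<^esub> a \<in> carrier A" using a a_inv_closed[of a] by simp
  ultimately show ?thesis using a point_add[of a "\<ominus>\<^bsub>R\<^esub> a"] by simp
qed

lemma coset_value_coset:
  assumes I: "ideal I R" "\<And>h. h \<in> I \<Longrightarrow> e h = 0" and a: "a \<in> carrier A"
  shows "coset_value e (I +>\<^bsub>R\<^esub> a) = e a" "(SOME a'. a' \<in> I +>\<^bsub>R\<^esub> a) \<in> carrier A"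
proof -
  interpret ideal I R by (rule I)
  have c: "I +>\<^bsub>R\<^esub> a = (\<Union>h\<in>I. {h \<oplus>\<^bsub>R\<^esub> a})" by (simp add: a_r_coset_def')
  have "\<zero>\<^bsub>R\<^esub> \<oplus>\<^bsub>R\<^esub> a \<in> I +>\<^bsub>R\<^esub> a" unfolding c
    using additive_subgroup.zero_closed[OF ideal.axioms(1)[OF I(1)]] by (rule UN_I) simp
  then have "(SOME a'. a' \<in> I +>\<^bsub>R\<^esub> a) \<in> I +>\<^bsub>R\<^esub> a" by (rule someI)
  then obtain h where h: "h \<in> I" "(SOME a'. a' \<in> I +>\<^bsub>R\<^esub> a) = h \<oplus>\<^bsub>R\<^esub> a" unfolding c by blast
  then have "h \<in> carrier A" using Icarr by simp
  with h a I(2)[OF h(1)] show "coset_value e (I +>\<^bsub>R\<^esub> a) = e a" "(SOME a'. a' \<in> I +>\<^bsub>R\<^esub> a) \<in> carrier A"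
    by (simp_all add: coset_value_def point_add add_closed)
qed

text \<open>Whichever representatives the quotient operation picks, a point that annihilates the
  ideal takes the same values on them, so its value on the result is determined.\<close>

lemma coset_value_cop:
  assumes I: "ideal I R" "\<And>h. h \<in> I \<Longrightarrow> e h = 0"
    and g: "g \<in> Cinf m" and c: "\<And>i. i < m \<Longrightarrow> c i \<in> carrier (cinf_quot A I)"
  shows "coset_value e (cop (cinf_quot A I) m g c) = g (\<lambda>i\<in>{..<m}. coset_value e (c i))"
    and "cop (cinf_quot A I) m g c \<in> carrier (cinf_quot A I)"
proof -
  have s: "(SOME a. a \<in> c i) \<in> carrier A" if i: "i < m" for i
  proof -
    obtain a where "a \<in> carrier A" "c i = I +>\<^bsub>R\<^esub> a"
      using c[OF i] by (auto simp: cinf_quot_def A_RCOSETS_def')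
    then show ?thesis using coset_value_coset(2)[OF I] by simp
  qed
  then have t: "(\<lambda>i\<in>{..<m}. SOME a. a \<in> c i) \<in> tuples m (carrier A)" by auto
  then have "e (cop A m g (\<lambda>i\<in>{..<m}. SOME a. a \<in> c i)) = g (\<lambda>i\<in>{..<m}. coset_value e (c i))"
    by (simp add: point_cop[OF g] coset_value_def cong: restrict_cong)
  then show "coset_value e (cop (cinf_quot A I) m g c) = g (\<lambda>i\<in>{..<m}. coset_value e (c i))"
    using coset_value_coset(1)[OF I cop_closed[OF g t]] by (simp add: cinf_quot_def)
  show "cop (cinf_quot A I) m g c \<in> carrier (cinf_quot A I)"
    using cop_closed[OF g t] by (auto simp: cinf_quot_def A_RCOSETS_def')
qed

lemma kernel_ideal: "ideal {a \<in> carrier A. e a = 0} R"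
  by (rule idealI_absorbing) (auto simp: scalar_closed point_scalar add_closed mult_closed point_add point_mult)

text \<open>If J contains the kernel and an element a with nonzero value, then 1 - a / e a lies in
  the kernel, hence in J, and so does 1.\<close>

lemma kernel_maximalideal: "maximalideal {a \<in> carrier A. e a = 0} R"
proof (rule maximalidealI[OF kernel_ideal])
  interpret cring R by (rule cring_underlying)
  have "scalar A 1 \<notin> {a \<in> carrier A. e a = 0}" by (simp add: point_scalar)
  then show "carrier R \<noteq> {a \<in> carrier A. e a = 0}" using scalar_closed[of 1] by auto
  fix J assume J: "ideal J R" "{a \<in> carrier A. e a = 0} \<subseteq> J" "J \<subseteq> carrier R"
  interpret J: ideal J R by (rule J)
  show "J = {a \<in> carrier A. e a = 0} \<or> J = carrier R"
  proof (rule disjCI)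
    assume "J \<noteq> carrier R"
    show "J = {a \<in> carrier A. e a = 0}"
    proof (rule ccontr)
      assume "J \<noteq> {a \<in> carrier A. e a = 0}"
      then obtain a where a: "a \<in> J" "a \<in> carrier A" "e a \<noteq> 0" using J by auto
      let ?b = "scalar A (inverse (e a))"
      have ab: "?b \<otimes>\<^bsub>R\<^esub> a \<in> J" using J.I_l_closed[OF a(1), of ?b] scalar_closed by simp
      let ?c = "scalar A 1 \<oplus>\<^bsub>R\<^esub> \<ominus>\<^bsub>R\<^esub> (?b \<otimes>\<^bsub>R\<^esub> a)"
      have m: "?b \<otimes>\<^bsub>R\<^esub> a \<in> carrier A" by (intro mult_closed scalar_closed a)
      then have n: "\<ominus>\<^bsub>R\<^esub> (?b \<otimes>\<^bsub>R\<^esub> a) \<in> carrier A" using a_inv_closed[of "?b \<otimes>\<^bsub>R\<^esub> a"] by simp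
      have "?c \<in> carrier A" by (intro add_closed scalar_closed n)
      moreover have "e ?c = 0"
        using a by (simp add: point_add scalar_closed n point_minus m point_mult point_scalar)
      ultimately have "?c \<in> J" using J(2) by blast
      then have "?c \<oplus>\<^bsub>R\<^esub> (?b \<otimes>\<^bsub>R\<^esub> a) \<in> J" using ab by (rule J.a_closed)
      moreover have "?c \<oplus>\<^bsub>R\<^esub> (?b \<otimes>\<^bsub>R\<^esub> a) = scalar A 1"
        using a_assoc[of "scalar A 1" "\<ominus>\<^bsub>R\<^esub> (?b \<otimes>\<^bsub>R\<^esub> a)" "?b \<otimes>\<^bsub>R\<^esub> a"] m n scalar_closed[of 1]
          l_neg[of "?b \<otimes>\<^bsub>R\<^esub> a"] r_zero[of "scalar A 1"] by simp
      ultimately have "\<one>\<^bsub>R\<^esub> \<in> J" by simp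
      then show False using J.one_imp_carrier \<open>J \<noteq> carrier R\<close> by simp
    qed
  qed
qed

text \<open>Every element outside the kernel of e is a unit, so a proper ideal lies in the kernel,
  which is therefore the only maximal ideal. The residue ring is identified with R by evaluating
  representatives.\<close>

lemma cinf_local_if_units:
  assumes units: "\<And>a. a \<in> carrier A \<Longrightarrow> e a \<noteq> 0 \<Longrightarrow> \<exists>b\<in>carrier A. a \<otimes>\<^bsub>R\<^esub> b = \<one>\<^bsub>R\<^esub>"
  shows "cinf_local A"
proof -
  interpret cring R by (rule cring_underlying)
  let ?m = "{a \<in> carrier A. e a = 0}"
  interpret m: ideal ?m R by (rule kernel_ideal)
  have ker: "e h = 0" if "h \<in> ?m" for h using that by simp
  have "J = ?m" if J: "maximalideal J R" for J
  proof -
    interpret J: maximalideal J R by (rule J)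
    have "J \<subseteq> ?m"
    proof
      fix a assume a: "a \<in> J"
      then have aA: "a \<in> carrier A" using J.Icarr by simp
      have "e a = 0"
      proof (rule ccontr)
        assume "e a \<noteq> 0"
        then obtain b where b: "b \<in> carrier A" "a \<otimes>\<^bsub>R\<^esub> b = \<one>\<^bsub>R\<^esub>" using units aA by blast
        then have "\<one>\<^bsub>R\<^esub> \<in> J" using J.I_r_closed[OF a, of b] by simp
        then show False using J.one_imp_carrier J.I_notcarr by simp
      qed
      with aA show "a \<in> ?m" by simp
    qed
    then show ?thesis using J.I_maximal[OF kernel_ideal] m.a_subset
        maximalideal.I_notcarr[OF kernel_maximalideal] by auto
  qed
  moreover
  let ?\<phi> = "\<lambda>c\<in>carrier (cinf_quot A ?m). coset_value e c"
  have "?\<phi> \<in> cinf_hom (cinf_quot A ?m) cinf_real"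
    unfolding cinf_hom_def
  proof (intro CollectI conjI allI ballI)
    show "?\<phi> \<in> carrier (cinf_quot A ?m) \<rightarrow>\<^sub>E carrier cinf_real" by (auto simp: cinf_real_def)
    fix m g c assume g: "g \<in> Cinf m" and c: "c \<in> tuples m (carrier (cinf_quot A ?m))"
    then have "c i \<in> carrier (cinf_quot A ?m)" if "i < m" for i using that by auto
    note * = this coset_value_cop[OF kernel_ideal ker g this]
    show "?\<phi> (cop (cinf_quot A ?m) m g c) = cop cinf_real m g (\<lambda>i\<in>{..<m}. ?\<phi> (c i))"
      using * by (simp add: cinf_real_def cong: restrict_cong)
  qed
  moreover have "bij_betw ?\<phi> (carrier (cinf_quot A ?m)) UNIV"
    unfolding bij_betw_def
  proof
    have c: "\<exists>a\<in>carrier A. c = ?m +>\<^bsub>R\<^esub> a \<and> coset_value e c = e a" if "c \<in> carrier (cinf_quot A ?m)" for c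
      using that coset_value_coset(1)[OF kernel_ideal ker] by (auto simp: cinf_quot_def A_RCOSETS_def')
    show "inj_on ?\<phi> (carrier (cinf_quot A ?m))"
    proof (rule inj_onI)
      fix c d assume cd: "c \<in> carrier (cinf_quot A ?m)" "d \<in> carrier (cinf_quot A ?m)" "?\<phi> c = ?\<phi> d"
      obtain a where a: "a \<in> carrier A" "c = ?m +>\<^bsub>R\<^esub> a" "coset_value e c = e a" using c[OF cd(1)] by blast
      obtain b where b: "b \<in> carrier A" "d = ?m +>\<^bsub>R\<^esub> b" "coset_value e d = e b" using c[OF cd(2)] by blast
      have n: "\<ominus>\<^bsub>R\<^esub> b \<in> carrier A" using a_inv_closed[of b] b by simp
      have "a \<oplus>\<^bsub>R\<^esub> \<ominus>\<^bsub>R\<^esub> b \<in> ?m"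
        using a b cd n by (simp add: add_closed point_add point_minus)
      from coset_add_left[OF kernel_ideal this b(1)]
      have "?m +>\<^bsub>R\<^esub> ((a \<oplus>\<^bsub>R\<^esub> \<ominus>\<^bsub>R\<^esub> b) \<oplus>\<^bsub>R\<^esub> b) = d" using b(2) by simp
      moreover have "(a \<oplus>\<^bsub>R\<^esub> \<ominus>\<^bsub>R\<^esub> b) \<oplus>\<^bsub>R\<^esub> b = a"
        using a(1) b(1) n a_assoc[of a "\<ominus>\<^bsub>R\<^esub> b" b] l_neg[of b] r_zero[of a] by simp
      ultimately show "c = d" using a(2) by simp
    qed
    show "?\<phi> ` carrier (cinf_quot A ?m) = UNIV"
    proof (intro subset_antisym subset_UNIV subsetI)
      fix r :: real
      have c: "?m +>\<^bsub>R\<^esub> scalar A r \<in> carrier (cinf_quot A ?m)"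
        using scalar_closed by (auto simp: cinf_quot_def A_RCOSETS_def')
      have "?\<phi> (?m +>\<^bsub>R\<^esub> scalar A r) = coset_value e (?m +>\<^bsub>R\<^esub> scalar A r)"
        using c by (rule restrict_apply')
      also have "\<dots> = r" using coset_value_coset(1)[OF kernel_ideal ker scalar_closed] point_scalar by simp
      finally show "r \<in> ?\<phi> ` carrier (cinf_quot A ?m)" using c by (intro image_eqI[OF sym])
    qed
  qed
  ultimately show ?thesis unfolding cinf_local_def using kernel_maximalideal by blast
qed

end


section \<open>Sheaves of real-valued functions\<close>

definition function_space ::
    "'w topology \<Rightarrow> ('w set \<Rightarrow> ('w \<Rightarrow> real) \<Rightarrow> bool) \<Rightarrow> ('w, 'w \<Rightarrow> real) cinf_space"
  where "function_space T P = \<lparr>base = T,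
    sections = (\<lambda>U. \<lparr>carrier = {h \<in> extensional U. P U h}, cop = (\<lambda>m g c. \<lambda>w\<in>U. g (\<lambda>i\<in>{..<m}. c i w))\<rparr>),
    restr = (\<lambda>U V. \<lambda>h\<in>{h \<in> extensional U. P U h}. restrict h V)\<rparr>"

text \<open>Serves both for smooth functions on intervals and for the flow domain.
  \<open>P_nonzero\<close> is what is retained of continuity: it provides the neighbourhoods on
  which germs are inverted, and it makes point maps into the spectrum continuous.\<close>

locale function_sheaf =
  fixes T :: "'w topology" and P :: "'w set \<Rightarrow> ('w \<Rightarrow> real) \<Rightarrow> bool"
  assumes P_compose: "\<lbrakk>openin T U; g \<in> Cinf m; \<And>i. i < m \<Longrightarrow> P U (c i)\<rbrakk> \<Longrightarrow> P U (\<lambda>w. g (\<lambda>i\<in>{..<m}. c i w))"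
    and P_cong: "\<lbrakk>P U f; \<And>w. w \<in> U \<Longrightarrow> f w = h w\<rbrakk> \<Longrightarrow> P U h"
    and P_subset: "\<lbrakk>P U f; V \<subseteq> U\<rbrakk> \<Longrightarrow> P V f"
    and P_local: "\<lbrakk>\<And>w. w \<in> U \<Longrightarrow> \<exists>V. openin T V \<and> w \<in> V \<and> V \<subseteq> U \<and> P V f\<rbrakk> \<Longrightarrow> P U f"
    and P_nonzero: "\<lbrakk>openin T U; P U f\<rbrakk> \<Longrightarrow> openin T {w \<in> U. f w \<noteq> 0}"
begin

abbreviation "X \<equiv> function_space T P"
abbreviation "S U \<equiv> {h \<in> extensional U. P U h}"

lemma X_simps [simp]:
  "base X = T" "carrier (sections X U) = S U"
  "cop (sections X U) m g c = (\<lambda>w\<in>U. g (\<lambda>i\<in>{..<m}. c i w))"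
  by (simp_all add: function_space_def)

lemma restr_X [simp]: "h \<in> S U \<Longrightarrow> restr X U V h = restrict h V"
  by (simp add: function_space_def)

lemma restrict_S:
  assumes "h \<in> S U" "V \<subseteq> U"
  shows "restrict h V \<in> S V"
proof -
  have "P V h" using assms P_subset by blast
  then have "P V (restrict h V)" by (rule P_cong) (rule restrict_apply'[symmetric])
  then show ?thesis by simp
qed

lemma cop_S:
  assumes "openin T U" "g \<in> Cinf m" "c \<in> tuples m (S U)"
  shows "(\<lambda>w\<in>U. g (\<lambda>i\<in>{..<m}. c i w)) \<in> S U"
proof -
  have "P U (\<lambda>w. g (\<lambda>i\<in>{..<m}. c i w))"
    by (rule P_compose[OF assms(1,2)]) (use assms(3) in auto)
  then have "P U (\<lambda>w\<in>U. g (\<lambda>i\<in>{..<m}. c i w))" by (rule P_cong) (rule restrict_apply'[symmetric])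
  then show ?thesis by simp
qed

lemma sections_cinf_ring:
  assumes U: "openin T U"
  shows "cinf_ring (sections X U)"
proof
  show "carrier (sections X U) \<noteq> {}"
    using cop_S[OF U Cinf_const[of 0 0], of "\<lambda>_. undefined"] by auto
next
  fix g m c assume "g \<in> Cinf m" "c \<in> tuples m (carrier (sections X U))"
  then show "cop (sections X U) m g c \<in> carrier (sections X U)"
    using cop_S[OF U] by (simp only: X_simps)
next
  fix g m n c and f :: "nat \<Rightarrow> (nat \<Rightarrow> real) \<Rightarrow> real"
  show "cop (sections X U) n (fcomp n m g f) c =
      cop (sections X U) m g (\<lambda>i\<in>{..<m}. cop (sections X U) n (f i) c)"
    unfolding X_simps
  proof (rule restrict_ext)
    fix w assume w: "w \<in> U"
    have "(\<lambda>i\<in>{..<n}. c i w) \<in> RR n" by simp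
    then show "fcomp n m g f (\<lambda>i\<in>{..<n}. c i w) =
        g (\<lambda>i\<in>{..<m}. (\<lambda>i\<in>{..<m}. \<lambda>w\<in>U. f i (\<lambda>i\<in>{..<n}. c i w)) i w)"
      using w by (simp add: fcomp_def cong: restrict_cong)
  qed
next
  fix j m c assume j: "j < m" and c: "c \<in> tuples m (carrier (sections X U))"
  then have "c j \<in> extensional U" by auto
  moreover have "coord m j (\<lambda>i\<in>{..<m}. c i w) = c j w" for w using j by (simp add: coord_def)
  ultimately show "cop (sections X U) m (coord m j) c = c j"
    by (simp add: extensional_restrict)
qed

lemma restr_cinf_hom:
  assumes U: "openin T U" and V: "V \<subseteq> U"
  shows "restr X U V \<in> cinf_hom (sections X U) (sections X V)"
  unfolding cinf_hom_def
proof (intro CollectI conjI allI ballI)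
  show "restr X U V \<in> carrier (sections X U) \<rightarrow>\<^sub>E carrier (sections X V)"
    using restrict_S[OF _ V] by (auto simp: function_space_def)
  fix m g c assume g: "g \<in> Cinf m" and c: "c \<in> tuples m (carrier (sections X U))"
  then have c': "c \<in> tuples m (S U)" by simp
  then have ci: "c i \<in> S U" if "i < m" for i using that by auto
  have "restr X U V (cop (sections X U) m g c) = restrict (\<lambda>w\<in>U. g (\<lambda>i\<in>{..<m}. c i w)) V"
    using cop_S[OF U g c'] by simp
  also have "\<dots> = (\<lambda>w\<in>V. g (\<lambda>i\<in>{..<m}. (\<lambda>i\<in>{..<m}. restr X U V (c i)) i w))"
  proof
    fix w
    show "restrict (\<lambda>w\<in>U. g (\<lambda>i\<in>{..<m}. c i w)) V w =
      (\<lambda>w\<in>V. g (\<lambda>i\<in>{..<m}. (\<lambda>i\<in>{..<m}. restr X U V (c i)) i w)) w"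
      using V ci by (cases "w \<in> V") (auto cong: restrict_cong)
  qed
  finally show "restr X U V (cop (sections X U) m g c) =
      cop (sections X V) m g (\<lambda>i\<in>{..<m}. restr X U V (c i))" by simp
qed

lemma sections_gluing:
  assumes U: "\<And>V. V \<in> \<U> \<Longrightarrow> openin T V" and \<sigma>: "\<And>V. V \<in> \<U> \<Longrightarrow> \<sigma> V \<in> S V"
    and c: "\<And>V W. V \<in> \<U> \<Longrightarrow> W \<in> \<U> \<Longrightarrow> restr X V (V \<inter> W) (\<sigma> V) = restr X W (V \<inter> W) (\<sigma> W)"
  shows "\<exists>!t. t \<in> S (\<Union>\<U>) \<and> (\<forall>V\<in>\<U>. restr X (\<Union>\<U>) V t = \<sigma> V)"
proof -
  define t where "t = (\<lambda>w\<in>\<Union>\<U>. \<sigma> (SOME V. V \<in> \<U> \<and> w \<in> V) w)"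
  have t: "t w = \<sigma> V w" if V: "V \<in> \<U>" and w: "w \<in> V" for V w
  proof -
    define W where "W = (SOME V. V \<in> \<U> \<and> w \<in> V)"
    have W: "W \<in> \<U> \<and> w \<in> W" unfolding W_def by (rule someI[of _ V]) (use V w in blast)
    have "restrict (\<sigma> V) (V \<inter> W) w = restrict (\<sigma> W) (V \<inter> W) w"
      using c[OF V, of W] \<sigma>[OF V] \<sigma>[of W] W by (simp only: restr_X)
    then have "\<sigma> V w = \<sigma> W w" using w W by simp
    moreover have "t w = \<sigma> W w" using V w by (auto simp: t_def W_def)
    ultimately show ?thesis by simp
  qed
  have tS: "t \<in> S (\<Union>\<U>)"
  proof -
    have "P (\<Union>\<U>) t"
    proof (rule P_local)
      fix w assume "w \<in> \<Union>\<U>"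
      then obtain V where V: "V \<in> \<U>" "w \<in> V" by blast
      have "P V (\<sigma> V)" using \<sigma>[OF V(1)] by simp
      then have "P V t" by (rule P_cong) (simp add: t[OF V(1)])
      then show "\<exists>V. openin T V \<and> w \<in> V \<and> V \<subseteq> \<Union>\<U> \<and> P V t" using V U by blast
    qed
    then show ?thesis by (simp add: t_def)
  qed
  show ?thesis
  proof (rule ex1I[of _ t])
    have "restr X (\<Union>\<U>) V t = \<sigma> V" if V: "V \<in> \<U>" for V
    proof -
      have "restrict t V = \<sigma> V"
        by (rule extensionalityI[of _ V]) (use \<sigma>[OF V] t[OF V] in auto)
      then show ?thesis using tS by (simp only: restr_X)
    qed
    with tS show "t \<in> S (\<Union>\<U>) \<and> (\<forall>V\<in>\<U>. restr X (\<Union>\<U>) V t = \<sigma> V)" by blast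
    fix u assume u: "u \<in> S (\<Union>\<U>) \<and> (\<forall>V\<in>\<U>. restr X (\<Union>\<U>) V u = \<sigma> V)"
    show "u = t"
    proof (rule extensionalityI[of _ "\<Union>\<U>"])
      fix w assume "w \<in> \<Union>\<U>"
      then obtain V where V: "V \<in> \<U>" "w \<in> V" by blast
      have "restrict u V = \<sigma> V" using u V(1) by (metis restr_X)
      then show "u w = t w" using V t by (metis restrict_apply')
    qed (use u tS in auto)
  qed
qed

section \<open>Germs and stalks\<close>

lemma restrict_eq_iff: "restrict f A = restrict g A \<longleftrightarrow> (\<forall>a\<in>A. f a = g a)"
proof
  assume eq: "restrict f A = restrict g A"
  show "\<forall>a\<in>A. f a = g a"
  proof
    fix a assume "a \<in> A"
    then show "f a = g a" using fun_cong[OF eq, of a] by simp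
  qed
next
  assume "\<forall>a\<in>A. f a = g a"
  then show "restrict f A = restrict g A" by (intro restrict_ext) (rule bspec)
qed

lemma mem_germ_iff:
  assumes "openin T U" "s \<in> S U"
  shows "(V, t) \<in> germ X x U s \<longleftrightarrow> openin T V \<and> x \<in> V \<and> t \<in> S V \<and>
    (\<exists>W. openin T W \<and> x \<in> W \<and> W \<subseteq> U \<inter> V \<and> (\<forall>w\<in>W. s w = t w))"
proof -
  have "restr X U W s = restr X V W t \<longleftrightarrow> (\<forall>w\<in>W. s w = t w)" if "t \<in> S V" for W
    using assms(2) that by (simp only: restr_X restrict_eq_iff)
  then show ?thesis unfolding germ_def X_simps mem_Collect_eq case_prod_conv by blast
qed

text \<open>A germ is encoded as the class of all pairs of a domain and a section that agree with a
  given one near x. Any neighbourhood that witnesses membership in one class is intersected with W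
  to witness membership in the other.\<close>

lemma germ_eqI:
  assumes U: "openin T U" "s \<in> S U" and V: "openin T V" "t \<in> S V"
    and W: "openin T W" "x \<in> W" "W \<subseteq> U \<inter> V" "\<And>w. w \<in> W \<Longrightarrow> s w = t w"
  shows "germ X x U s = germ X x V t"
proof -
  have "germ X x U s \<subseteq> germ X x V t"
    if U: "openin T U" "s \<in> S U" and V: "openin T V" "t \<in> S V"
      and W: "W \<subseteq> U \<inter> V" "\<And>w. w \<in> W \<Longrightarrow> s w = t w" for U V s t
  proof
    fix z assume z: "z \<in> germ X x U s"
    obtain V' t' where z': "z = (V', t')" by (cases z)
    from z obtain W' where W': "openin T V'" "x \<in> V'" "t' \<in> S V'" "openin T W'" "x \<in> W'" "W' \<subseteq> U \<inter> V'"
      "\<forall>w\<in>W'. s w = t' w"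
      unfolding z' mem_germ_iff[OF U] by blast
    have "openin T (W \<inter> W') \<and> x \<in> W \<inter> W' \<and> W \<inter> W' \<subseteq> V \<inter> V' \<and> (\<forall>w\<in>W \<inter> W'. t w = t' w)"
      using W W' assms(5,6) by auto
    then show "z \<in> germ X x V t" unfolding z' mem_germ_iff[OF V] using W'(1-3) by blast
  qed
  from this[OF U V W(3,4)] this[OF V U] W(3,4) show ?thesis by (metis Int_commute subset_antisym)
qed

lemma germ_eqD:
  assumes U: "openin T U" "s \<in> S U" and V: "openin T V" "t \<in> S V" "x \<in> V"
    and eq: "germ X x U s = germ X x V t"
  obtains W where "openin T W" "x \<in> W" "W \<subseteq> U \<inter> V" "\<And>w. w \<in> W \<Longrightarrow> s w = t w"
proof -
  have "(V, t) \<in> germ X x V t" unfolding mem_germ_iff[OF V(1,2)] using V by blast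
  then have "(V, t) \<in> germ X x U s" using eq by simp
  then show thesis unfolding mem_germ_iff[OF U] using that by blast
qed

lemma openin_finite_family:
  assumes "openin T U" "\<And>i. i < (m::nat) \<Longrightarrow> openin T (W i)"
  shows "openin T (\<Inter>(insert U (W ` {..<m})))"
  by (rule openin_Inter) (use assms in auto)

text \<open>The operation on germs is a definite description, so the result must be shown
  independent of the representatives. Two tuples with the same germs agree near x, because finitely
  many neighbourhoods have an open intersection.\<close>

lemma stalk_cop:
  assumes U: "openin T U" "x \<in> U" and s: "s \<in> tuples m (S U)" and g: "g \<in> Cinf m"
  shows "cop (stalk X x) m g (\<lambda>i\<in>{..<m}. germ X x U (s i)) = germ X x U (cop (sections X U) m g s)"
proof -
  have "(THE \<gamma>. \<exists>V. \<exists>t\<in>tuples m (S V). openin T V \<and> x \<in> V \<and>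
      (\<forall>i<m. (\<lambda>i\<in>{..<m}. germ X x U (s i)) i = germ X x V (t i)) \<and> \<gamma> = germ X x V (cop (sections X V) m g t)) =
    germ X x U (cop (sections X U) m g s)"
  proof (rule the_equality)
    show "\<exists>V. \<exists>t\<in>tuples m (S V). openin T V \<and> x \<in> V \<and>
      (\<forall>i<m. (\<lambda>i\<in>{..<m}. germ X x U (s i)) i = germ X x V (t i)) \<and>
      germ X x U (cop (sections X U) m g s) = germ X x V (cop (sections X V) m g t)"
      using U s by (intro exI[of _ U] bexI[of _ s]) auto
    fix \<gamma>
    assume "\<exists>V. \<exists>t\<in>tuples m (S V). openin T V \<and> x \<in> V \<and>
      (\<forall>i<m. (\<lambda>i\<in>{..<m}. germ X x U (s i)) i = germ X x V (t i)) \<and> \<gamma> = germ X x V (cop (sections X V) m g t)"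
    then obtain V t where V: "openin T V" "x \<in> V" and t: "t \<in> tuples m (S V)"
      and eq: "\<And>i. i < m \<Longrightarrow> germ X x U (s i) = germ X x V (t i)"
      and \<gamma>: "\<gamma> = germ X x V (cop (sections X V) m g t)" by auto
    have "\<exists>W. openin T W \<and> x \<in> W \<and> W \<subseteq> U \<inter> V \<and> (\<forall>w\<in>W. s i w = t i w)" if i: "i < m" for i
    proof -
      have "s i \<in> S U" "t i \<in> S V" using s t i by auto
      from germ_eqD[OF U(1) this(1) V(1) this(2) V(2) eq[OF i]] show ?thesis by metis
    qed
    then obtain W where W: "\<And>i. i < m \<Longrightarrow> openin T (W i) \<and> x \<in> W i \<and> (\<forall>w\<in>W i. s i w = t i w)" by metis
    let ?W = "\<Inter>(insert (U \<inter> V) (W ` {..<m}))"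
    show "\<gamma> = germ X x U (cop (sections X U) m g s)"
      unfolding \<gamma>
    proof (rule germ_eqI[OF V(1) _ U(1)])
      show "cop (sections X V) m g t \<in> S V" "cop (sections X U) m g s \<in> S U"
        using cop_S[OF V(1) g t] cop_S[OF U(1) g s] by simp_all
      show "openin T ?W" by (rule openin_finite_family) (use U V W in auto)
      show "x \<in> ?W" "?W \<subseteq> V \<inter> U" using U V W by auto
      fix w assume w: "w \<in> ?W"
      then have "(\<lambda>i\<in>{..<m}. t i w) = (\<lambda>i\<in>{..<m}. s i w)" using W by (intro restrict_ext) auto
      with w show "cop (sections X V) m g t w = cop (sections X U) m g s w" by simp
    qed
  qed
  then show ?thesis by (simp add: stalk_def)
qed

text \<open>The germs in a tuple come with different domains, while \<open>stalk_cop\<close>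
  computes on a single one; restricting to the intersection does not change the germs.\<close>

lemma stalk_tuple:
  assumes x: "x \<in> topspace T" and c: "c \<in> tuples m (carrier (stalk X x))"
  obtains U s where "openin T U" "x \<in> U" "s \<in> tuples m (S U)" "c = (\<lambda>i\<in>{..<m}. germ X x U (s i))"
proof -
  define Q where "Q i z \<longleftrightarrow> openin T (fst z) \<and> x \<in> fst z \<and> snd z \<in> S (fst z) \<and> c i = germ X x (fst z) (snd z)" for i z
  have "\<exists>z. Q i z" if "i < m" for i
  proof -
    have "c i \<in> carrier (stalk X x)" using c that by auto
    then obtain V t where "openin T V" "x \<in> V" "t \<in> S V" "c i = germ X x V t" by (auto simp: stalk_def)
    then show ?thesis by (intro exI[of _ "(V, t)"]) (simp add: Q_def)
  qed
  then obtain z where z: "\<And>i. i < m \<Longrightarrow> Q i (z i)" by metis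
  define V t where "V i = fst (z i)" and "t i = snd (z i)" for i
  have V: "openin T (V i) \<and> x \<in> V i \<and> t i \<in> S (V i) \<and> c i = germ X x (V i) (t i)" if "i < m" for i
    using z[OF that] unfolding Q_def V_def t_def .
  \<comment> \<open>\<open>topspace T\<close> is inserted so that \<open>?U\<close> is an open
    neighbourhood of x also for arity 0.\<close>
  let ?U = "\<Inter>(insert (topspace T) (V ` {..<m}))"
  have U: "openin T ?U" "x \<in> ?U" using openin_finite_family[of "topspace T" m V] V x by auto
  let ?s = "\<lambda>i\<in>{..<m}. restrict (t i) ?U"
  have s: "restrict (t i) ?U \<in> S ?U" if "i < m" for i by (rule restrict_S[where U = "V i"]) (use V that in auto)
  then have "?s \<in> tuples m (S ?U)" unfolding restrict_PiE_iff by blast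
  moreover have "c = (\<lambda>i\<in>{..<m}. germ X x ?U (?s i))"
  proof (rule extensionalityI[of _ "{..<m}"])
    fix i assume i: "i \<in> {..<m}"
    then have "germ X x (V i) (t i) = germ X x ?U (restrict (t i) ?U)"
      using V s U by (intro germ_eqI[of _ _ _ _ ?U]) auto
    then show "c i = (\<lambda>i\<in>{..<m}. germ X x ?U (?s i)) i" using V i by simp
  qed (use c in \<open>auto simp: PiE_def\<close>)
  ultimately show thesis using U that by blast
qed

lemma stalk_cinf_ring:
  assumes x: "x \<in> topspace T"
  shows "cinf_ring (stalk X x)"
proof
  have germ: "germ X x U s \<in> carrier (stalk X x)" if "openin T U" "x \<in> U" "s \<in> S U" for U s
    using that by (auto simp: stalk_def)
  have "openin T (topspace T)" by simp
  from cop_S[OF this Cinf_const[of 0 0], of "\<lambda>_. undefined"] germ[OF this x]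
  show "carrier (stalk X x) \<noteq> {}" by auto
  {
    fix g m c assume g: "g \<in> Cinf m" and c: "c \<in> tuples m (carrier (stalk X x))"
    obtain U s where U: "openin T U" "x \<in> U" "s \<in> tuples m (S U)" "c = (\<lambda>i\<in>{..<m}. germ X x U (s i))"
      using stalk_tuple[OF x c] .
    show "cop (stalk X x) m g c \<in> carrier (stalk X x)"
      unfolding U(4) stalk_cop[OF U(1-3) g] X_simps by (rule germ[OF U(1,2) cop_S[OF U(1) g U(3)]])
  }
  {
    fix g m n c f assume g: "g \<in> Cinf m" and f: "\<And>i. i < m \<Longrightarrow> f i \<in> Cinf n"
      and c: "c \<in> tuples n (carrier (stalk X x))"
    obtain U s where U: "openin T U" "x \<in> U" "s \<in> tuples n (S U)" "c = (\<lambda>i\<in>{..<n}. germ X x U (s i))"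
      using stalk_tuple[OF x c] .
    interpret U: cinf_ring "sections X U" by (rule sections_cinf_ring[OF U(1)])
    let ?t = "\<lambda>i\<in>{..<m}. cop (sections X U) n (f i) s"
    have "cop (sections X U) n (f i) s \<in> S U" if "i < m" for i
      using U.cop_closed[OF f[OF that]] U(3) by simp
    then have t: "?t \<in> tuples m (S U)" unfolding restrict_PiE_iff by blast
    have "cop (stalk X x) n (fcomp n m g f) c = germ X x U (cop (sections X U) n (fcomp n m g f) s)"
      unfolding U(4) by (rule stalk_cop[OF U(1-3) Cinf_fcomp[OF g f]])
    also have "cop (sections X U) n (fcomp n m g f) s = cop (sections X U) m g ?t"
      by (rule U.cop_comp[OF g f]) (use U(3) in simp_all)
    also have "germ X x U (cop (sections X U) m g ?t) = cop (stalk X x) m g (\<lambda>i\<in>{..<m}. germ X x U (?t i))"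
      by (rule stalk_cop[OF U(1,2) t g, symmetric])
    also have "(\<lambda>i\<in>{..<m}. germ X x U (?t i)) = (\<lambda>i\<in>{..<m}. cop (stalk X x) n (f i) c)"
      unfolding U(4) by (rule restrict_ext) (simp only: stalk_cop[OF U(1-3) f] restrict_apply' lessThan_iff)
    finally show "cop (stalk X x) n (fcomp n m g f) c =
        cop (stalk X x) m g (\<lambda>i\<in>{..<m}. cop (stalk X x) n (f i) c)" .
  }
  {
    fix j m c assume j: "j < m" and c: "c \<in> tuples m (carrier (stalk X x))"
    obtain U s where U: "openin T U" "x \<in> U" "s \<in> tuples m (S U)" "c = (\<lambda>i\<in>{..<m}. germ X x U (s i))"
      using stalk_tuple[OF x c] .
    interpret U: cinf_ring "sections X U" by (rule sections_cinf_ring[OF U(1)])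
    have "cop (sections X U) m (coord m j) s = s j" by (rule U.cop_coord[OF j]) (use U(3) in simp)
    then show "cop (stalk X x) m (coord m j) c = c j"
      unfolding U(4) stalk_cop[OF U(1-3) Cinf_coord[OF j]] using j by simp
  }
qed

text \<open>Restricted to the carrier so that it is extensional, as members of
  \<open>cinf_hom\<close> are. All representatives of a germ have the same value at x, so the choice
  is harmless.\<close>

definition germ_value :: "'w \<Rightarrow> ('w set \<times> ('w \<Rightarrow> real)) set \<Rightarrow> real"
  where "germ_value x = (\<lambda>\<gamma>\<in>carrier (stalk X x). snd (SOME z. z \<in> \<gamma>) x)"

lemma germ_value:
  assumes "openin T U" "x \<in> U" "s \<in> S U"
  shows "germ_value x (germ X x U s) = s x"
proof -
  have "(U, s) \<in> germ X x U s" unfolding mem_germ_iff[OF assms(1,3)] using assms by blast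
  then have "(SOME z. z \<in> germ X x U s) \<in> germ X x U s" by (rule someI)
  moreover obtain V t where "(SOME z. z \<in> germ X x U s) = (V, t)" by fastforce
  ultimately have "snd (SOME z. z \<in> germ X x U s) x = s x"
    using mem_germ_iff[OF assms(1,3)] by fastforce
  moreover have "germ X x U s \<in> carrier (stalk X x)" using assms by (auto simp: stalk_def)
  ultimately show ?thesis by (simp add: germ_value_def)
qed

lemma germ_value_point:
  assumes x: "x \<in> topspace T"
  shows "germ_value x \<in> cinf_hom (stalk X x) cinf_real"
  unfolding cinf_hom_def
proof (intro CollectI conjI allI ballI)
  show "germ_value x \<in> carrier (stalk X x) \<rightarrow>\<^sub>E carrier cinf_real"
    by (auto simp: cinf_real_def germ_value_def)
  fix m g c assume g: "g \<in> Cinf m" and c: "c \<in> tuples m (carrier (stalk X x))"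
  obtain U s where U: "openin T U" "x \<in> U" "s \<in> tuples m (S U)" "c = (\<lambda>i\<in>{..<m}. germ X x U (s i))"
    using stalk_tuple[OF x c] .
  have "germ_value x (cop (stalk X x) m g c) = g (\<lambda>i\<in>{..<m}. s i x)"
    unfolding U(4) stalk_cop[OF U(1-3) g] X_simps
    using germ_value[OF U(1,2) cop_S[OF U(1) g U(3)]] U(2) by simp
  moreover have "germ_value x (c i) = s i x" if "i < m" for i
    using germ_value[OF U(1,2), of "s i"] U(3,4) that by auto
  ultimately show "germ_value x (cop (stalk X x) m g c) = cop cinf_real m g (\<lambda>i\<in>{..<m}. germ_value x (c i))"
    by (simp add: cinf_real_def cong: restrict_cong)
qed

text \<open>A section s with s x nonzero is inverted near x by \<psi> \<circ> s, where \<psi> is the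
  global substitute for 1/y. This composite is a section on all of U, and it is an inverse of s
  where the cut-off of s is nonzero, a set that is open by \<open>P_nonzero\<close>.\<close>

lemma stalk_local:
  assumes x: "x \<in> topspace T"
  shows "cinf_local (stalk X x)"
proof -
  interpret cinf_ring "stalk X x" by (rule stalk_cinf_ring[OF x])
  interpret cinf_point "stalk X x" "germ_value x"
    by unfold_locales (rule germ_value_point[OF x])
  show ?thesis
  proof (rule cinf_local_if_units)
    fix a assume "a \<in> carrier (stalk X x)" and nz: "germ_value x a \<noteq> 0"
    then obtain U s where U: "openin T U" "x \<in> U" "s \<in> S U" and a: "a = germ X x U s"
      by (auto simp: stalk_def)
    have sx: "0 \<noteq> s x" using nz germ_value[OF U] a by simp
    obtain \<psi> e where \<psi>: "\<psi> \<in> Cinf 1" and e: "e \<in> Cinf 1" "\<And>y. y \<in> RR 1 \<Longrightarrow> y 0 = s x \<Longrightarrow> e y \<noteq> 0"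
      "\<And>y. y \<in> RR 1 \<Longrightarrow> e y \<noteq> 0 \<Longrightarrow> (y 0 - 0) * \<psi> y = 1"
      using Cinf_local_inverse[OF sx] by blast
    let ?y = "\<lambda>w. \<lambda>i\<in>{..<1::nat}. s w"
    define s' where "s' = (\<lambda>w\<in>U. \<psi> (?y w))"
    have y: "?y w \<in> RR 1" for w by simp
    have c: "(\<lambda>i\<in>{..<1::nat}. s) \<in> tuples 1 (S U)" unfolding restrict_PiE_iff using U(3) by blast
    have s': "s' \<in> S U" using cop_S[OF U(1) \<psi> c] by (simp add: s'_def cong: restrict_cong)
    have b: "germ X x U s' \<in> carrier (stalk X x)" using U s' by (auto simp: stalk_def)
    let ?W = "{w \<in> U. e (?y w) \<noteq> 0}"
    have W: "openin T ?W"
      by (rule P_nonzero[OF U(1) P_compose[OF U(1) e(1)]]) (use U(3) in auto)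
    have t: "pair s s' \<in> tuples 2 (S U)" by (rule pair_tuples[OF U(3) s'])
    have "a \<otimes>\<^bsub>underlying (stalk X x)\<^esub> germ X x U s' =
        cop (stalk X x) 2 (\<lambda>x\<in>RR 2. x 0 * x 1) (\<lambda>i\<in>{..<2}. germ X x U (pair s s' i))"
      unfolding a restrict_pair by (simp add: underlying_def)
    also have "\<dots> = germ X x U (cop (sections X U) 2 (\<lambda>x\<in>RR 2. x 0 * x 1) (pair s s'))"
      by (rule stalk_cop[OF U(1,2) t Cinf_times])
    also have "\<dots> = germ X x U (cop (sections X U) 0 (\<lambda>x\<in>RR 0. 1) (\<lambda>_. undefined))"
    proof (rule germ_eqI[OF U(1) _ U(1)])
      show "cop (sections X U) 2 (\<lambda>x\<in>RR 2. x 0 * x 1) (pair s s') \<in> S U"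
        unfolding X_simps by (rule cop_S[OF U(1) Cinf_times t])
      show "cop (sections X U) 0 (\<lambda>x\<in>RR 0. 1) (\<lambda>_. undefined) \<in> S U"
        unfolding X_simps by (rule cop_S[OF U(1) Cinf_const]) simp
      show "openin T ?W" by (rule W)
      show "x \<in> ?W" "?W \<subseteq> U \<inter> U" using U(2) e(2)[OF y] by auto
      fix w assume w: "w \<in> ?W"
      then have "s w * s' w = 1" using e(3)[OF y, of w] by (simp add: s'_def)
      moreover have "(\<lambda>i\<in>{..<0::nat}. undefined w) \<in> RR 0" unfolding restrict_PiE_iff by simp
      ultimately show "cop (sections X U) 2 (\<lambda>x\<in>RR 2. x 0 * x 1) (pair s s') w =
          cop (sections X U) 0 (\<lambda>x\<in>RR 0. 1) (\<lambda>_. undefined) w"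
        using w by (simp add: pair_def)
    qed
    also have "\<dots> = cop (stalk X x) 0 (\<lambda>x\<in>RR 0. 1) (\<lambda>i\<in>{..<0}. germ X x U undefined)"
      using stalk_cop[OF U(1,2) _ Cinf_const, of "\<lambda>_. undefined" 0 1] by simp
    also have "(\<lambda>i\<in>{..<0::nat}. germ X x U undefined) = (\<lambda>_. undefined)" by (simp add: fun_eq_iff)
    finally have "a \<otimes>\<^bsub>underlying (stalk X x)\<^esub> germ X x U s' = \<one>\<^bsub>underlying (stalk X x)\<^esub>"
      unfolding underlying_simps scalar_def .
    with b show "\<exists>b\<in>carrier (stalk X x).
        a \<otimes>\<^bsub>underlying (stalk X x)\<^esub> b = \<one>\<^bsub>underlying (stalk X x)\<^esub>" by (rule bexI[rotated])
  qed
qed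

lemma local_cinf_ringed_space: "local_cinf_ringed_space X"
proof (rule local_cinf_ringed_space.intro)
  fix \<U> and \<sigma> :: "'w set \<Rightarrow> 'w \<Rightarrow> real"
  assume "\<And>V. V \<in> \<U> \<Longrightarrow> openin (base X) V" "\<And>V. V \<in> \<U> \<Longrightarrow> \<sigma> V \<in> carrier (sections X V)"
    "\<And>V W. \<lbrakk>V \<in> \<U>; W \<in> \<U>\<rbrakk> \<Longrightarrow> restr X V (V \<inter> W) (\<sigma> V) = restr X W (V \<inter> W) (\<sigma> W)"
  then show "\<exists>!t. t \<in> carrier (sections X (\<Union>\<U>)) \<and> (\<forall>V\<in>\<U>. restr X (\<Union>\<U>) V t = \<sigma> V)"
    unfolding X_simps by (rule sections_gluing)
next
  fix U s assume "openin (base X) U" "s \<in> carrier (sections X U)"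
  then show "restr X U U s = s" by (simp add: extensional_restrict)
next
  fix U V W s assume *: "W \<subseteq> V" "V \<subseteq> U" "s \<in> carrier (sections X U)"
  then have "s \<in> S U" by simp
  then have "restr X V W (restr X U V s) = restrict (restrict s V) W"
    using restrict_S[OF _ *(2)] by (simp only: restr_X)
  also have "\<dots> = restrict s W" using *(1) by (simp add: Int_absorb1)
  finally show "restr X V W (restr X U V s) = restr X U W s" using \<open>s \<in> S U\<close> by (simp only: restr_X)
next
  fix U assume "openin (base X) U"
  then show "cinf_ring (sections X U)" unfolding X_simps(1) by (rule sections_cinf_ring)
next
  fix U V assume "openin (base X) U" "V \<subseteq> U"
  then show "restr X U V \<in> cinf_hom (sections X U) (sections X V)"
    unfolding X_simps(1) by (rule restr_cinf_hom)
next
  fix x assume "x \<in> topspace (base X)"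
  then show "cinf_local (stalk X x)" unfolding X_simps(1) by (rule stalk_local)
qed

end


section \<open>Maps to the spectrum\<close>

context cinf_point
begin

lemma germ_ideal_zero: "h \<in> germ_ideal A e \<Longrightarrow> e h = 0"
  unfolding germ_ideal_def using point_mult[of h] point_scalar[of 0] by fastforce

text \<open>If d annihilates a and d' annihilates b, their product annihilates both and is nonzero
  at e, because e is multiplicative.\<close>

lemma germ_ideal_ideal: "ideal (germ_ideal A e) R"
proof (rule idealI_absorbing)
  interpret cring R by (rule cring_underlying)
  show "germ_ideal A e \<subseteq> carrier A" by (auto simp: germ_ideal_def)
  show "scalar A 0 \<in> germ_ideal A e"
    unfolding germ_ideal_def
    using scalar_closed[of 0] scalar_closed[of 1] point_scalar[of 1] l_null[of "scalar A 1"] by force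
  fix a b
  assume a: "a \<in> germ_ideal A e"
  then obtain d where d: "d \<in> carrier A" "e d \<noteq> 0" "a \<otimes>\<^bsub>R\<^esub> d = \<zero>\<^bsub>R\<^esub>" and aA: "a \<in> carrier A"
    by (auto simp: germ_ideal_def)
  {
    assume b: "b \<in> carrier A"
    have "b \<otimes>\<^bsub>R\<^esub> a \<otimes>\<^bsub>R\<^esub> d = \<zero>\<^bsub>R\<^esub>"
      using m_assoc[of b a d] r_null[of b] aA b d by simp
    then show "b \<otimes>\<^bsub>R\<^esub> a \<in> germ_ideal A e"
      unfolding germ_ideal_def using d(1,2) mult_closed[OF b aA] by auto
  }
  {
    assume b: "b \<in> germ_ideal A e"
    then obtain d' where d': "d' \<in> carrier A" "e d' \<noteq> 0" "b \<otimes>\<^bsub>R\<^esub> d' = \<zero>\<^bsub>R\<^esub>" and bA: "b \<in> carrier A"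
      by (auto simp: germ_ideal_def)
    have dd: "d \<otimes>\<^bsub>R\<^esub> d' \<in> carrier A" by (rule mult_closed[OF d(1) d'(1)])
    have "a \<otimes>\<^bsub>R\<^esub> (d \<otimes>\<^bsub>R\<^esub> d') = \<zero>\<^bsub>R\<^esub>"
      using m_assoc[of a d d'] l_null[of d'] aA d d' by simp
    moreover have "b \<otimes>\<^bsub>R\<^esub> (d \<otimes>\<^bsub>R\<^esub> d') = \<zero>\<^bsub>R\<^esub>"
      using m_lcomm[of b d d'] r_null[of d] bA d d' by simp
    ultimately have "(a \<oplus>\<^bsub>R\<^esub> b) \<otimes>\<^bsub>R\<^esub> (d \<otimes>\<^bsub>R\<^esub> d') = \<zero>\<^bsub>R\<^esub>"
      using l_distr[of a b "d \<otimes>\<^bsub>R\<^esub> d'"] l_zero[of "\<zero>\<^bsub>R\<^esub>"] aA bA dd scalar_closed[of 0] by simp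
    moreover have "e (d \<otimes>\<^bsub>R\<^esub> d') \<noteq> 0" using d d' by (simp add: point_mult)
    ultimately show "a \<oplus>\<^bsub>R\<^esub> b \<in> germ_ideal A e"
      unfolding germ_ideal_def using dd add_closed[OF aA bA] by blast
  }
qed

lemma loc_proj_value: "a \<in> carrier A \<Longrightarrow> coset_value e (loc_proj A e a) = e a"
  unfolding loc_proj_def by (rule coset_value_coset(1)[OF germ_ideal_ideal germ_ideal_zero])

lemma loc_proj_closed: "a \<in> carrier A \<Longrightarrow> loc_proj A e a \<in> carrier (loc A e)"
  by (auto simp: loc_proj_def loc_def cinf_quot_def A_RCOSETS_def')

lemma loc_proj_eqI:
  assumes u: "u \<in> carrier A" and w: "w \<in> carrier A" and d: "d \<in> carrier A" "e d \<noteq> 0"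
    and eq: "u \<otimes>\<^bsub>R\<^esub> d = w \<otimes>\<^bsub>R\<^esub> d"
  shows "loc_proj A e u = loc_proj A e w"
proof -
  interpret cring R by (rule cring_underlying)
  let ?z = "u \<oplus>\<^bsub>R\<^esub> \<ominus>\<^bsub>R\<^esub> w"
  have n: "\<ominus>\<^bsub>R\<^esub> w \<in> carrier A" using a_inv_closed[of w] w by simp
  have "?z \<otimes>\<^bsub>R\<^esub> d = u \<otimes>\<^bsub>R\<^esub> d \<oplus>\<^bsub>R\<^esub> \<ominus>\<^bsub>R\<^esub> (w \<otimes>\<^bsub>R\<^esub> d)"
    using l_distr[of u "\<ominus>\<^bsub>R\<^esub> w" d] l_minus[of w d] u n w d by simp
  also have "\<dots> = \<zero>\<^bsub>R\<^esub>" using r_neg[of "w \<otimes>\<^bsub>R\<^esub> d"] mult_closed[OF w d(1)] by (simp add: eq)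
  finally have "?z \<in> germ_ideal A e"
    unfolding germ_ideal_def using d add_closed[OF u n] by blast
  from coset_add_left[OF germ_ideal_ideal this w]
  have "loc_proj A e (?z \<oplus>\<^bsub>R\<^esub> w) = loc_proj A e w" by (simp add: loc_proj_def)
  moreover have "?z \<oplus>\<^bsub>R\<^esub> w = u"
    using a_assoc[of u "\<ominus>\<^bsub>R\<^esub> w" w] l_neg[of w] r_zero[of u] u n w by simp
  ultimately show ?thesis by simp
qed

lemma common_annihilator:
  fixes m :: nat
  shows "(\<And>i. i < m \<Longrightarrow> h i \<in> germ_ideal A e) \<Longrightarrow>
    \<exists>d\<in>carrier A. e d \<noteq> 0 \<and> (\<forall>i<m. h i \<otimes>\<^bsub>R\<^esub> d = \<zero>\<^bsub>R\<^esub>)"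
proof (induction m)
  case 0
  show ?case by (rule bexI[of _ "scalar A 1"]) (simp_all add: point_scalar scalar_closed)
next
  case (Suc m)
  interpret cring R by (rule cring_underlying)
  obtain d where d: "d \<in> carrier A" "e d \<noteq> 0" "\<forall>i<m. h i \<otimes>\<^bsub>R\<^esub> d = \<zero>\<^bsub>R\<^esub>"
    using Suc.IH Suc.prems by (meson less_SucI)
  obtain d' where d': "d' \<in> carrier A" "e d' \<noteq> 0" "h m \<otimes>\<^bsub>R\<^esub> d' = \<zero>\<^bsub>R\<^esub>"
    using Suc.prems[of m] by (auto simp: germ_ideal_def)
  have h: "h i \<in> carrier A" if "i < Suc m" for i using Suc.prems[OF that] by (simp add: germ_ideal_def)
  have "h i \<otimes>\<^bsub>R\<^esub> (d \<otimes>\<^bsub>R\<^esub> d') = \<zero>\<^bsub>R\<^esub>" if i: "i < Suc m" for i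
  proof (cases "i = m")
    case True
    then show ?thesis using m_lcomm[of "h i" d d'] r_null[of d] h[OF i] d d' by simp
  next
    case False
    then show ?thesis using m_assoc[of "h i" d d'] l_null[of d'] h[OF i] d d' i by simp
  qed
  moreover have "e (d \<otimes>\<^bsub>R\<^esub> d') \<noteq> 0" using d d' by (simp add: point_mult)
  ultimately show ?case using mult_closed[OF d(1) d'(1)] by blast
qed

text \<open>Multiplying the arguments by a cutoff function of an annihilator \<open>d\<close> of the differences makes them
  equal without changing the value of the operation where \<open>d\<close> is close to \<open>e d\<close>; this avoids
  Hadamard's lemma.\<close>

lemma cop_cutoff:
  assumes g: "g \<in> Cinf m" and c: "c \<in> tuples m (carrier A)" and d: "d \<in> carrier A"
    and \<psi>: "\<psi> \<in> Cinf 1" and q: "q \<in> Cinf 1"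
    and inv: "\<And>x. x \<in> RR 1 \<Longrightarrow> q x \<noteq> 0 \<Longrightarrow> x 0 * \<psi> x = 1"
  defines "E f \<equiv> cop A 1 f (\<lambda>i\<in>{..<1}. d)"
  shows "cop A m g c \<otimes>\<^bsub>R\<^esub> E q = cop A m g (\<lambda>i\<in>{..<m}. d \<otimes>\<^bsub>R\<^esub> E \<psi> \<otimes>\<^bsub>R\<^esub> c i) \<otimes>\<^bsub>R\<^esub> E q"
proof -
  \<comment> \<open>One extra variable, placed last, carries d; the claim becomes an identity of
    functions on R^(m+1), evaluated at the tuple \<open>t\<close>.\<close>
  define n where "n = Suc m"
  define t where "t = (\<lambda>i\<in>{..<n}. if i < m then c i else d)"
  have t: "t \<in> tuples n (carrier A)" unfolding t_def restrict_PiE_iff using c d by (auto simp: PiE_iff)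
  define y where "y f = fcomp n 1 f (\<lambda>_. coord n m)" for f
  have y: "y f \<in> Cinf n" if "f \<in> Cinf 1" for f
    unfolding y_def by (rule Cinf_fcomp[OF that Cinf_coord]) (simp add: n_def)
  have ti: "cop A n (coord n i) t = c i" if "i < m" for i
    using that cop_coord[OF _ t, of i] by (simp add: t_def n_def)
  have tm: "cop A n (coord n m) t = d" using cop_coord[OF _ t, of m] by (simp add: t_def n_def)
  have E: "cop A n (y f) t = E f" if "f \<in> Cinf 1" for f
  proof -
    have "cop A n (y f) t = cop A 1 f (\<lambda>i\<in>{..<1}. cop A n (coord n m) t)"
      unfolding y_def by (rule cop_comp[OF that Cinf_coord t]) (simp add: n_def)
    then show ?thesis unfolding tm E_def .
  qed
  have cm: "coord n m \<in> Cinf n" by (simp add: Cinf_coord n_def)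
  define \<phi> where "\<phi> = (\<lambda>x\<in>RR n. coord n m x * y \<psi> x)"
  have \<phi>: "\<phi> \<in> Cinf n" unfolding \<phi>_def by (rule Cinf_mult[OF cm y[OF \<psi>]])
  have \<phi>t: "cop A n \<phi> t = d \<otimes>\<^bsub>R\<^esub> E \<psi>"
    unfolding \<phi>_def using cop_times[OF cm y[OF \<psi>] t] by (simp only: tm E[OF \<psi>])
  define p where "p i = (\<lambda>x\<in>RR n. \<phi> x * coord n i x)" for i
  have ci: "coord n i \<in> Cinf n" if "i < m" for i using that by (simp add: Cinf_coord n_def)
  have p: "p i \<in> Cinf n" if "i < m" for i unfolding p_def by (rule Cinf_mult[OF \<phi> ci[OF that]])
  have pt: "cop A n (p i) t = d \<otimes>\<^bsub>R\<^esub> E \<psi> \<otimes>\<^bsub>R\<^esub> c i" if "i < m" for i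
    unfolding p_def using cop_times[OF \<phi> ci[OF that] t] by (simp only: \<phi>t ti[OF that])
  have "cop A m g c = cop A m g (\<lambda>i\<in>{..<m}. cop A n (coord n i) t)"
    by (rule arg_cong[where f = "cop A m g"], rule extensionalityI[of _ "{..<m}"])
      (use c ti in \<open>auto simp: PiE_def\<close>)
  also have "\<dots> = cop A n (fcomp n m g (coord n)) t" by (rule cop_comp[OF g ci t, symmetric])
  finally have 1: "cop A m g c = cop A n (fcomp n m g (coord n)) t" .
  have "cop A m g (\<lambda>i\<in>{..<m}. d \<otimes>\<^bsub>R\<^esub> E \<psi> \<otimes>\<^bsub>R\<^esub> c i) = cop A m g (\<lambda>i\<in>{..<m}. cop A n (p i) t)"
    by (rule arg_cong[where f = "cop A m g"], rule restrict_ext) (simp add: pt)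
  also have "\<dots> = cop A n (fcomp n m g p) t" by (rule cop_comp[OF g p t, symmetric])
  finally have 2: "cop A m g (\<lambda>i\<in>{..<m}. d \<otimes>\<^bsub>R\<^esub> E \<psi> \<otimes>\<^bsub>R\<^esub> c i) = cop A n (fcomp n m g p) t" .
  \<comment> \<open>Where the cut-off is nonzero, \<open>inv\<close> gives \<phi> = 1 and the inner
    arguments coincide; elsewhere both sides are 0.\<close>
  have "(\<lambda>x\<in>RR n. fcomp n m g (coord n) x * y q x) = (\<lambda>x\<in>RR n. fcomp n m g p x * y q x)"
  proof (rule restrict_ext)
    fix x assume x: "x \<in> RR n"
    show "fcomp n m g (coord n) x * y q x = fcomp n m g p x * y q x"
    proof (cases "y q x = 0")
      case False
      let ?x = "\<lambda>i\<in>{..<1::nat}. coord n m x"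
      have "?x \<in> RR 1" unfolding restrict_PiE_iff by simp
      moreover have "q ?x \<noteq> 0" using False x by (simp add: y_def fcomp_def)
      ultimately have "?x 0 * \<psi> ?x = 1" by (rule inv)
      then have "\<phi> x = 1" using x by (simp add: \<phi>_def y_def fcomp_def)
      then have "(\<lambda>i\<in>{..<m}. p i x) = (\<lambda>i\<in>{..<m}. coord n i x)"
        using x by (intro restrict_ext) (simp add: p_def)
      then show ?thesis using x by (simp add: fcomp_def)
    qed simp
  qed
  then show ?thesis
    unfolding 1 2 E[OF q, symmetric]
    using cop_times[OF Cinf_fcomp[OF g ci] y[OF q] t] cop_times[OF Cinf_fcomp[OF g p] y[OF q] t] by simp
qed

text \<open>The operation on the localization uses chosen representatives b, which differ from a by
  elements of \<open>germ_ideal A e\<close>. These have a common annihilator d, and cutting off with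
  d makes the arguments equal; the results then agree after multiplication by an element that does
  not vanish at e, hence in the localization.\<close>

lemma loc_proj_cop:
  assumes g: "g \<in> Cinf m" and a: "a \<in> tuples m (carrier A)"
  shows "cop (loc A e) m g (\<lambda>i\<in>{..<m}. loc_proj A e (a i)) = loc_proj A e (cop A m g a)"
proof -
  interpret cring R by (rule cring_underlying)
  interpret I: ideal "germ_ideal A e" R by (rule germ_ideal_ideal)
  define b where "b = (\<lambda>i\<in>{..<m}. SOME a'. a' \<in> loc_proj A e (a i))"
  have ai: "a i \<in> carrier A" if "i < m" for i using a that by auto
  have "\<exists>h. h \<in> germ_ideal A e \<and> b i = h \<oplus>\<^bsub>R\<^esub> a i" if "i < m" for i
  proof -
    have c: "loc_proj A e (a i) = (\<Union>h\<in>germ_ideal A e. {h \<oplus>\<^bsub>R\<^esub> a i})" by (simp add: loc_proj_def a_r_coset_def')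
    have "\<zero>\<^bsub>R\<^esub> \<oplus>\<^bsub>R\<^esub> a i \<in> loc_proj A e (a i)"
      unfolding c using additive_subgroup.zero_closed[OF I.additive_subgroup_axioms] by (rule UN_I) simp
    then have "(SOME a'. a' \<in> loc_proj A e (a i)) \<in> loc_proj A e (a i)" by (rule someI)
    then have "b i \<in> loc_proj A e (a i)" using that by (simp add: b_def)
    then show ?thesis unfolding c by blast
  qed
  then obtain h where h: "\<And>i. i < m \<Longrightarrow> h i \<in> germ_ideal A e" "\<And>i. i < m \<Longrightarrow> b i = h i \<oplus>\<^bsub>R\<^esub> a i" by metis
  have hi: "h i \<in> carrier A" if "i < m" for i using h(1)[OF that] by (simp add: germ_ideal_def)
  have bi: "b i \<in> carrier A" if "i < m" for i using h(2)[OF that] hi[OF that] ai[OF that] add_closed by simp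
  have b: "b \<in> tuples m (carrier A)" using bi by (auto simp: PiE_iff b_def)
  obtain d where d: "d \<in> carrier A" "e d \<noteq> 0" "\<And>i. i < m \<Longrightarrow> h i \<otimes>\<^bsub>R\<^esub> d = \<zero>\<^bsub>R\<^esub>"
    using common_annihilator[of m h] h(1) by blast
  have d0: "0 \<noteq> e d" using d(2) by simp
  obtain \<psi> q where \<psi>: "\<psi> \<in> Cinf 1" and q: "q \<in> Cinf 1" "\<And>x. x \<in> RR 1 \<Longrightarrow> x 0 = e d \<Longrightarrow> q x \<noteq> 0"
    "\<And>x. x \<in> RR 1 \<Longrightarrow> q x \<noteq> 0 \<Longrightarrow> (x 0 - 0) * \<psi> x = 1"
    by (rule Cinf_local_inverse[OF d0]) blast
  let ?E = "\<lambda>f. cop A 1 f (\<lambda>i\<in>{..<1}. d)"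
  have dt: "(\<lambda>i\<in>{..<1::nat}. d) \<in> tuples 1 (carrier A)" unfolding restrict_PiE_iff using d(1) by simp
  have E: "?E f \<in> carrier A" if "f \<in> Cinf 1" for f by (rule cop_closed[OF that dt])
  have "d \<otimes>\<^bsub>R\<^esub> ?E \<psi> \<otimes>\<^bsub>R\<^esub> b i = d \<otimes>\<^bsub>R\<^esub> ?E \<psi> \<otimes>\<^bsub>R\<^esub> a i" if i: "i < m" for i
  proof -
    have c: "d \<otimes>\<^bsub>R\<^esub> ?E \<psi> \<in> carrier R" "h i \<in> carrier R" "a i \<in> carrier R" "d \<in> carrier R" "?E \<psi> \<in> carrier R"
      using mult_closed[OF d(1) E[OF \<psi>]] hi[OF i] ai[OF i] d(1) E[OF \<psi>] by simp_all
    have "d \<otimes>\<^bsub>R\<^esub> ?E \<psi> \<otimes>\<^bsub>R\<^esub> h i = ?E \<psi> \<otimes>\<^bsub>R\<^esub> (h i \<otimes>\<^bsub>R\<^esub> d)"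
      using m_comm[OF c(4,5)] m_comm[OF c(4,2)] m_assoc[OF c(5,4,2)] by simp
    also have "\<dots> = \<zero>\<^bsub>R\<^esub>" unfolding d(3)[OF i] by (rule r_null[OF c(5)])
    finally show ?thesis unfolding h(2)[OF i] r_distr[OF c(2,3,1)]
      using l_zero[OF m_closed[OF c(1,3)]] by simp
  qed
  then have "(\<lambda>i\<in>{..<m}. d \<otimes>\<^bsub>R\<^esub> ?E \<psi> \<otimes>\<^bsub>R\<^esub> b i) = (\<lambda>i\<in>{..<m}. d \<otimes>\<^bsub>R\<^esub> ?E \<psi> \<otimes>\<^bsub>R\<^esub> a i)"
    by (intro restrict_ext) simp
  then have "cop A m g b \<otimes>\<^bsub>R\<^esub> ?E q = cop A m g a \<otimes>\<^bsub>R\<^esub> ?E q"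
    using cop_cutoff[OF g b d(1) \<psi> q(1)] cop_cutoff[OF g a d(1) \<psi> q(1)] q(3) by simp
  moreover have "e (?E q) \<noteq> 0"
    unfolding point_cop[OF q(1) dt] by (rule q(2)) (simp_all add: restrict_PiE_iff)
  ultimately have "loc_proj A e (cop A m g b) = loc_proj A e (cop A m g a)"
    by (intro loc_proj_eqI[OF cop_closed[OF g b] cop_closed[OF g a] E[OF q(1)]])
  moreover have "b = (\<lambda>i\<in>{..<m}. SOME a'. a' \<in> (\<lambda>i\<in>{..<m}. loc_proj A e (a i)) i)"
    unfolding b_def by (rule restrict_ext) simp
  ultimately show ?thesis by (simp add: loc_def cinf_quot_def loc_proj_def)
qed

lemma loc_value_cop:
  assumes "g \<in> Cinf m" "\<And>i. i < m \<Longrightarrow> c i \<in> carrier (loc A e)"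
  shows "coset_value e (cop (loc A e) m g c) = g (\<lambda>i\<in>{..<m}. coset_value e (c i))"
  using coset_value_cop(1)[OF germ_ideal_ideal germ_ideal_zero, of g m c] assms unfolding loc_def by blast

end

section \<open>Topology and sections of the spectrum\<close>

lemma Spec_simps [simp]:
  "base (Spec A) = spec_top A" "sections (Spec A) = spec_sections A"
  "s \<in> carrier (spec_sections A U) \<Longrightarrow> restr (Spec A) U V s = restrict s V"
  by (simp_all add: Spec_def)

context cinf_ring
begin

lemma point: "x \<in> points A \<Longrightarrow> cinf_point A x"
  by (simp add: cinf_point_def cinf_point_axioms_def points_def cinf_ring_axioms)

lemma openin_basic: "a \<in> carrier A \<Longrightarrow> openin (spec_top A) {x \<in> points A. x a \<noteq> 0}"
  unfolding spec_top_def by (rule topology_generated_by_Basis) blast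

lemma topspace_spec: "topspace (spec_top A) = points A"
proof
  show "topspace (spec_top A) \<subseteq> points A" unfolding spec_top_def by auto
  show "points A \<subseteq> topspace (spec_top A)"
  proof
    fix x assume x: "x \<in> points A"
    then have "x (scalar A 1) = 1" using cinf_point.point_scalar[OF point] by blast
    then have "x \<in> {x \<in> points A. x (scalar A 1) \<noteq> 0}" using x by simp
    then show "x \<in> topspace (spec_top A)" using openin_subset[OF openin_basic[OF scalar_closed]] by blast
  qed
qed

lemma openin_spec_subset: "openin (spec_top A) U \<Longrightarrow> U \<subseteq> points A"
  using openin_subset topspace_spec by blast

lemma section_local:
  assumes "s \<in> carrier (spec_sections A U)" "x \<in> U"
  obtains V a where "openin (spec_top A) V" "x \<in> V" "V \<subseteq> U" "a \<in> carrier A"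
    "\<And>y. y \<in> V \<Longrightarrow> s y = loc_proj A y a"
  using assms by (auto simp: spec_sections_def)

lemma section_closed:
  "s \<in> carrier (spec_sections A U) \<Longrightarrow> x \<in> U \<Longrightarrow> s x \<in> carrier (loc A x)"
  by (auto simp: spec_sections_def)

lemma sectionI:
  assumes "U \<subseteq> points A" "s \<in> extensional U"
    and l: "\<And>x. x \<in> U \<Longrightarrow> \<exists>V a. openin (spec_top A) V \<and> x \<in> V \<and> V \<subseteq> U \<and> a \<in> carrier A \<and>
      (\<forall>y\<in>V. s y = loc_proj A y a)"
  shows "s \<in> carrier (spec_sections A U)"
proof -
  have "s x \<in> carrier (loc A x)" if x: "x \<in> U" for x
  proof -
    obtain V a where "x \<in> V" "a \<in> carrier A" "\<forall>y\<in>V. s y = loc_proj A y a" using l[OF x] by blast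
    then show ?thesis using cinf_point.loc_proj_closed[OF point] assms(1) x by auto
  qed
  then have "s \<in> (\<Pi>\<^sub>E x\<in>U. carrier (loc A x))" using assms(2) by (auto simp: PiE_iff)
  moreover have "\<forall>x\<in>U. \<exists>V. openin (spec_top A) V \<and> x \<in> V \<and> V \<subseteq> U \<and>
      (\<exists>a\<in>carrier A. \<forall>y\<in>V. s y = loc_proj A y a)"
  proof
    fix x assume "x \<in> U"
    from l[OF this] show "\<exists>V. openin (spec_top A) V \<and> x \<in> V \<and> V \<subseteq> U \<and>
        (\<exists>a\<in>carrier A. \<forall>y\<in>V. s y = loc_proj A y a)" by blast
  qed
  ultimately show ?thesis unfolding spec_sections_def by simp
qed

lemma global_section:
  assumes "openin (spec_top A) U" "a \<in> carrier A"
  shows "(\<lambda>x\<in>U. loc_proj A x a) \<in> carrier (spec_sections A U)"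
  using assms openin_spec_subset[OF assms(1)]
  by (intro sectionI) (auto intro!: exI[of _ U] exI[of _ a])

lemma restrict_section:
  assumes V: "openin (spec_top A) V" "V \<subseteq> U" and s: "s \<in> carrier (spec_sections A U)"
  shows "restrict s V \<in> carrier (spec_sections A V)"
proof (rule sectionI)
  fix x assume x: "x \<in> V"
  then have "x \<in> U" using V by blast
  then obtain W a where "openin (spec_top A) W" "x \<in> W" "W \<subseteq> U" "a \<in> carrier A"
    "\<And>y. y \<in> W \<Longrightarrow> s y = loc_proj A y a" using section_local[OF s] by metis
  then show "\<exists>W a. openin (spec_top A) W \<and> x \<in> W \<and> W \<subseteq> V \<and> a \<in> carrier A \<and>
      (\<forall>y\<in>W. restrict s V y = loc_proj A y a)"
    using V x by (intro exI[of _ "V \<inter> W"] exI[of _ a]) auto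
qed (use V openin_spec_subset in auto)

text \<open>Near x the finitely many sections come from ring elements on a common neighbourhood,
  where \<open>loc_proj_cop\<close> turns the operation in each localization into a single operation
  in A.\<close>

lemma sections_cop_closed:
  assumes U: "openin (spec_top A) U" and g: "g \<in> Cinf m" and c: "c \<in> tuples m (carrier (spec_sections A U))"
  shows "cop (spec_sections A U) m g c \<in> carrier (spec_sections A U)"
proof (rule sectionI)
  show "U \<subseteq> points A" by (rule openin_spec_subset[OF U])
  show "cop (spec_sections A U) m g c \<in> extensional U" by (simp add: spec_sections_def)
  fix x assume x: "x \<in> U"
  have "\<exists>z. openin (spec_top A) (fst z) \<and> x \<in> fst z \<and> fst z \<subseteq> U \<and> snd z \<in> carrier A \<and>
      (\<forall>y\<in>fst z. c i y = loc_proj A y (snd z))" if "i < m" for i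
  proof -
    have "c i \<in> carrier (spec_sections A U)" using c that by auto
    from section_local[OF this x] show ?thesis by (metis fst_conv snd_conv)
  qed
  then obtain z where z: "\<And>i. i < m \<Longrightarrow> openin (spec_top A) (fst (z i)) \<and> x \<in> fst (z i) \<and> snd (z i) \<in> carrier A \<and>
      (\<forall>y\<in>fst (z i). c i y = loc_proj A y (snd (z i)))" by metis
  let ?V = "\<Inter>(insert U ((\<lambda>i. fst (z i)) ` {..<m}))"
  let ?a = "\<lambda>i\<in>{..<m}. snd (z i)"
  have a: "?a \<in> tuples m (carrier A)" unfolding restrict_PiE_iff using z by blast
  have V: "openin (spec_top A) ?V" by (rule openin_Inter) (use U z in auto)
  have "cop (spec_sections A U) m g c y = loc_proj A y (cop A m g ?a)" if y: "y \<in> ?V" for y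
  proof -
    have "y \<in> points A" using y openin_spec_subset[OF U] by blast
    then interpret cinf_point A y by (rule point)
    have "(\<lambda>i\<in>{..<m}. c i y) = (\<lambda>i\<in>{..<m}. loc_proj A y (?a i))"
      by (rule restrict_ext) (use z y in auto)
    then show ?thesis using loc_proj_cop[OF g a] y by (simp add: spec_sections_def)
  qed
  then show "\<exists>V a. openin (spec_top A) V \<and> x \<in> V \<and> V \<subseteq> U \<and> a \<in> carrier A \<and>
      (\<forall>y\<in>V. cop (spec_sections A U) m g c y = loc_proj A y a)"
    using V z x cop_closed[OF g a] by (intro exI[of _ ?V] exI[of _ "cop A m g ?a"]) auto
qed

lemma continuous_map_spec:
  assumes "f \<in> topspace T \<rightarrow> points A" "\<And>a. a \<in> carrier A \<Longrightarrow> openin T {t \<in> topspace T. f t a \<noteq> 0}"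
  shows "continuous_map T (spec_top A) f"
  unfolding spec_top_def continuous_on_generated_topo_iff
proof (intro conjI allI impI)
  fix U assume "U \<in> {{x \<in> points A. x a \<noteq> 0} |a. a \<in> carrier A}"
  then obtain a where a: "a \<in> carrier A" "U = {x \<in> points A. x a \<noteq> 0}" by blast
  have "f -` U \<inter> topspace T = {t \<in> topspace T. f t a \<noteq> 0}" using a assms(1) by auto
  then show "openin T (f -` U \<inter> topspace T)" using assms(2)[OF a(1)] by simp
next
  have "f ` topspace T \<subseteq> points A" using assms(1) by blast
  also have "\<dots> \<subseteq> \<Union> {{x \<in> points A. x a \<noteq> 0} |a. a \<in> carrier A}"
    using topspace_spec unfolding spec_top_def by simp
  finally show "f ` topspace T \<subseteq> \<Union> {{x \<in> points A. x a \<noteq> 0} |a. a \<in> carrier A}" .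
qed

end

section \<open>Maps from function sheaves to the spectrum\<close>

definition pullback_map ::
    "'a cinf_ring \<Rightarrow> 'w set \<Rightarrow> ('w \<Rightarrow> 'a \<Rightarrow> real) \<Rightarrow> ('w, 'w \<Rightarrow> real, 'a \<Rightarrow> real, ('a \<Rightarrow> real) \<Rightarrow> 'a set) cinf_space_map"
  where "pullback_map A W f = (f, \<lambda>U\<in>{U. openin (spec_top A) U}. \<lambda>s\<in>carrier (spec_sections A U).
    \<lambda>t\<in>{t \<in> W. f t \<in> U}. coset_value (f t) (s (f t)))"

lemma fst_pullback_map [simp]: "fst (pullback_map A W f) = f"
  by (simp add: pullback_map_def)

lemma snd_pullback_map:
  "openin (spec_top A) U \<Longrightarrow> s \<in> carrier (spec_sections A U) \<Longrightarrow>
    snd (pullback_map A W f) U s = (\<lambda>t\<in>{t \<in> W. f t \<in> U}. coset_value (f t) (s (f t)))"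
  by (simp add: pullback_map_def)

locale function_sheaf_over = function_sheaf T P + cinf_ring A
  for T :: "'w topology" and P and A :: "'a cinf_ring"
begin

lemma preim_X: "preim X f U = {t \<in> topspace T. fst f t \<in> U}"
  by (simp add: preim_def)

lemma continuous_map_spec_P:
  assumes f: "f \<in> topspace T \<rightarrow> points A" and P: "\<And>a. a \<in> carrier A \<Longrightarrow> P (topspace T) (\<lambda>t. f t a)"
  shows "continuous_map T (spec_top A) f"
  by (rule continuous_map_spec[OF f]) (rule P_nonzero[OF openin_topspace P])

text \<open>Near t the section s comes from a ring element a, and there the pulled back function is
  t \<mapsto> f t a, for which P is assumed.\<close>

lemma pullback_section:
  assumes f: "f \<in> topspace T \<rightarrow> points A" and P: "\<And>a. a \<in> carrier A \<Longrightarrow> P (topspace T) (\<lambda>t. f t a)"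
    and s: "s \<in> carrier (spec_sections A U)"
  shows "(\<lambda>t\<in>{t \<in> topspace T. f t \<in> U}. coset_value (f t) (s (f t))) \<in> S {t \<in> topspace T. f t \<in> U}"
proof -
  let ?W = "{t \<in> topspace T. f t \<in> U}"
  have "P ?W (\<lambda>t. coset_value (f t) (s (f t)))"
  proof (rule P_local)
    fix t assume t: "t \<in> ?W"
    then obtain V a where V: "openin (spec_top A) V" "f t \<in> V" "V \<subseteq> U" "a \<in> carrier A"
      "\<And>y. y \<in> V \<Longrightarrow> s y = loc_proj A y a" using section_local[OF s] by blast
    let ?V = "{t \<in> topspace T. f t \<in> V}"
    have "P ?V (\<lambda>t. f t a)" by (rule P_subset[OF P[OF V(4)]]) simp
    then have "P ?V (\<lambda>t. coset_value (f t) (s (f t)))"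
    proof (rule P_cong)
      fix t assume t: "t \<in> ?V"
      then have "f t \<in> points A" using f by blast
      then show "f t a = coset_value (f t) (s (f t))"
        using V(4,5) t cinf_point.loc_proj_value[OF point] by simp
    qed
    moreover have "openin T ?V"
      by (rule openin_continuous_map_preimage[OF continuous_map_spec_P[OF f P] V(1)])
    ultimately show "\<exists>V. openin T V \<and> t \<in> V \<and> V \<subseteq> ?W \<and> P V (\<lambda>t. coset_value (f t) (s (f t)))"
      using t V(2,3) by (intro exI[of _ ?V]) blast
  qed
  then have "P ?W (\<lambda>t\<in>?W. coset_value (f t) (s (f t)))" by (rule P_cong) (rule restrict_apply'[symmetric])
  then show ?thesis by simp
qed

lemma pullback_space_map:
  assumes f: "f \<in> topspace T \<rightarrow>\<^sub>E points A" and P: "\<And>a. a \<in> carrier A \<Longrightarrow> P (topspace T) (\<lambda>t. f t a)"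
  shows "space_map X (Spec A) (pullback_map A (topspace T) f)"
proof -
  let ?F = "pullback_map A (topspace T) f"
  have f': "f \<in> topspace T \<rightarrow> points A" using f by blast
  have "snd ?F U \<in> cinf_hom (spec_sections A U) (sections X (preim X ?F U))" if U: "openin (spec_top A) U" for U
    unfolding cinf_hom_def
  proof (intro CollectI conjI allI ballI)
    show "snd ?F U \<in> carrier (spec_sections A U) \<rightarrow>\<^sub>E carrier (sections X (preim X ?F U))"
      using pullback_section[OF f' P] U by (auto simp: pullback_map_def preim_X)
    fix m g c assume g: "g \<in> Cinf m" and c: "c \<in> tuples m (carrier (spec_sections A U))"
    then have ci: "c i \<in> carrier (spec_sections A U)" if "i < m" for i using that by auto
    have "coset_value (f t) (cop (spec_sections A U) m g c (f t)) =
        g (\<lambda>i\<in>{..<m}. (\<lambda>i\<in>{..<m}. snd ?F U (c i)) i t)" if t: "t \<in> {t \<in> topspace T. f t \<in> U}" for t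
    proof -
      have "f t \<in> points A" using f' t by blast
      then interpret cinf_point A "f t" by (rule point)
      have "coset_value (f t) (cop (spec_sections A U) m g c (f t)) =
          coset_value (f t) (cop (loc A (f t)) m g (\<lambda>i\<in>{..<m}. c i (f t)))"
        using t by (simp add: spec_sections_def)
      also have "\<dots> = g (\<lambda>i\<in>{..<m}. coset_value (f t) ((\<lambda>i\<in>{..<m}. c i (f t)) i))"
        by (rule loc_value_cop[OF g]) (use section_closed[OF ci] t in simp)
      also have "(\<lambda>i\<in>{..<m}. coset_value (f t) ((\<lambda>i\<in>{..<m}. c i (f t)) i)) =
          (\<lambda>i\<in>{..<m}. (\<lambda>i\<in>{..<m}. snd ?F U (c i)) i t)"
        by (rule restrict_ext) (use t ci in \<open>simp add: snd_pullback_map[OF U]\<close>)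
      finally show ?thesis .
    qed
    then show "snd ?F U (cop (spec_sections A U) m g c) =
        cop (sections X (preim X ?F U)) m g (\<lambda>i\<in>{..<m}. snd ?F U (c i))"
      unfolding snd_pullback_map[OF U sections_cop_closed[OF U g c]] X_simps preim_X fst_pullback_map
      by (rule restrict_ext)
  qed
  moreover have "restr X (preim X ?F U) (preim X ?F V) (snd ?F U s) = snd ?F V (restr (Spec A) U V s)"
    if U: "openin (spec_top A) U" and V: "openin (spec_top A) V" "V \<subseteq> U" and s: "s \<in> carrier (spec_sections A U)"
    for U V s
  proof -
    have "snd ?F U s \<in> S (preim X ?F U)"
      using pullback_section[OF f' P s] by (simp add: snd_pullback_map[OF U s] preim_X)
    then have "restr X (preim X ?F U) (preim X ?F V) (snd ?F U s) = restrict (snd ?F U s) (preim X ?F V)"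
      by (rule restr_X)
    also have "\<dots> = snd ?F V (restrict s V)"
      unfolding snd_pullback_map[OF U s] snd_pullback_map[OF V(1) restrict_section[OF V s]] preim_X fst_pullback_map
      using V(2) by (auto simp: fun_eq_iff)
    finally show ?thesis using s by simp
  qed
  moreover have "snd ?F \<in> extensional {U. openin (spec_top A) U}" by (simp add: pullback_map_def)
  moreover have "f \<in> extensional (topspace T)" using f by (simp add: PiE_iff)
  ultimately show ?thesis
    unfolding space_map_def Spec_simps(1,2) X_simps(1) fst_pullback_map
    using continuous_map_spec_P[OF f' P] by (intro conjI allI impI ballI) simp_all
qed

text \<open>If the value \<open>q\<close> of the image section at \<open>t\<close> differed from the value \<open>r\<close> of the section, a smooth function
  that vanishes at \<open>q\<close> and is \<open>1\<close> near \<open>r\<close> would send the section to \<open>1\<close> near the image of \<open>t\<close>, and its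
  image to a function that vanishes at \<open>t\<close>.\<close>

lemma space_map_value:
  assumes \<sigma>: "space_map X (Spec A) \<sigma>" and U: "openin (spec_top A) U" and s: "s \<in> carrier (spec_sections A U)"
    and t: "t \<in> topspace T" "fst \<sigma> t \<in> U"
  shows "snd \<sigma> U s t = coset_value (fst \<sigma> t) (s (fst \<sigma> t))"
proof (rule ccontr)
  let ?val = "\<lambda>y. coset_value y (s y)"
  let ?q = "snd \<sigma> U s t" and ?r = "?val (fst \<sigma> t)"
  assume qr: "?q \<noteq> ?r"
  obtain \<psi> e where \<psi>: "\<psi> \<in> Cinf 1" and e: "e \<in> Cinf 1" "\<And>x. x \<in> RR 1 \<Longrightarrow> x 0 = ?r \<Longrightarrow> e x \<noteq> 0"
    "\<And>x. x \<in> RR 1 \<Longrightarrow> e x \<noteq> 0 \<Longrightarrow> (x 0 - ?q) * \<psi> x = 1"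
    by (rule Cinf_local_inverse[OF qr]) blast
  define l where "l = (\<lambda>x\<in>RR 1. coord 1 0 x + (\<lambda>x\<in>RR 1. - ?q) x)"
  have l: "l \<in> Cinf 1" unfolding l_def by (intro Cinf_add Cinf_coord Cinf_const) simp
  define \<phi> where "\<phi> = (\<lambda>x\<in>RR 1. l x * \<psi> x)"
  have \<phi>: "\<phi> \<in> Cinf 1" unfolding \<phi>_def by (rule Cinf_mult[OF l \<psi>])
  define one where "one = (\<lambda>x\<in>RR 1. 1::real)"
  have one: "one \<in> Cinf 1" unfolding one_def by (rule Cinf_const)
  have \<phi>x: "\<phi> x = (x 0 - ?q) * \<psi> x" if "x \<in> RR 1" for x using that by (simp add: \<phi>_def l_def coord_def)
  let ?c = "\<lambda>b. \<lambda>i\<in>{..<1::nat}. b"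
  have R1: "?c b \<in> RR 1" for b unfolding restrict_PiE_iff by simp
  define V where "V = {y \<in> U. e (?c (?val y)) \<noteq> 0}"
  \<comment> \<open>Where s comes from a, the condition that defines V says that z does not vanish
    on the ring element e(a), and this cuts out a basic open set.\<close>
  have local: "\<exists>W a. openin (spec_top A) W \<and> y \<in> W \<and> W \<subseteq> V \<and> a \<in> carrier A \<and>
      (\<forall>z\<in>W. s z = loc_proj A z a \<and> z (cop A 1 e (?c a)) \<noteq> 0)" if y: "y \<in> V" for y
  proof -
    have yU: "y \<in> U" using y by (simp add: V_def)
    obtain W a where W: "openin (spec_top A) W" "y \<in> W" "W \<subseteq> U" and a: "a \<in> carrier A"
      and eq: "\<And>z. z \<in> W \<Longrightarrow> s z = loc_proj A z a" by (rule section_local[OF s yU]) blast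
    have ca: "?c a \<in> tuples 1 (carrier A)" unfolding restrict_PiE_iff using a by simp
    have z: "z (cop A 1 e (?c a)) = e (?c (?val z))" if "z \<in> W" for z
    proof -
      have "z \<in> points A" using that openin_spec_subset[OF W(1)] by blast
      then interpret cinf_point A z by (rule point)
      have "z (cop A 1 e (?c a)) = e (\<lambda>i\<in>{..<1}. z (?c a i))" by (rule point_cop[OF e(1) ca])
      also have "(\<lambda>i\<in>{..<1}. z (?c a i)) = ?c (?val z)"
        by (rule restrict_ext) (simp add: eq[OF that] loc_proj_value[OF a])
      finally show ?thesis .
    qed
    let ?W = "W \<inter> {z \<in> points A. z (cop A 1 e (?c a)) \<noteq> 0}"
    have "openin (spec_top A) ?W" by (intro openin_Int W openin_basic cop_closed[OF e(1) ca])
    moreover have "y \<in> ?W" using W(2) z[OF W(2)] y openin_spec_subset[OF W(1)] by (auto simp: V_def)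
    moreover have "?W \<subseteq> V" using W(3) z by (auto simp: V_def)
    ultimately show ?thesis using a eq by (intro exI[of _ ?W] exI[of _ a]) auto
  qed
  have V: "openin (spec_top A) V"
  proof (subst openin_subopen, rule ballI)
    fix y assume "y \<in> V"
    from local[OF this] show "\<exists>W. openin (spec_top A) W \<and> y \<in> W \<and> W \<subseteq> V" by blast
  qed
  have VU: "V \<subseteq> U" by (auto simp: V_def)
  have tV: "fst \<sigma> t \<in> V" using t e(2)[OF R1] by (simp add: V_def)
  define s' where "s' = restrict s V"
  have s': "s' \<in> carrier (spec_sections A V)" unfolding s'_def by (rule restrict_section[OF V VU s])
  define h where "h = snd \<sigma> V s'"
  have hom: "snd \<sigma> U' \<in> cinf_hom (spec_sections A U') (sections X (preim X \<sigma> U'))" if "openin (spec_top A) U'" for U'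
    using \<sigma> that by (simp add: space_map_def)
  have "restr X (preim X \<sigma> U) (preim X \<sigma> V) (snd \<sigma> U s) = snd \<sigma> V (restr (Spec A) U V s)"
    using \<sigma> U V VU s unfolding space_map_def Spec_simps(1,2) by blast
  moreover have "snd \<sigma> U s \<in> S (preim X \<sigma> U)" using hom[OF U] s by (auto simp: cinf_hom_def)
  ultimately have "h = restrict (snd \<sigma> U s) (preim X \<sigma> V)" using s by (simp add: h_def s'_def)
  then have ht: "h t = ?q" using t tV by (simp add: preim_X)
  have c: "?c s' \<in> tuples 1 (carrier (spec_sections A V))" unfolding restrict_PiE_iff using s' by simp
  have image: "snd \<sigma> V (cop (spec_sections A V) 1 g (?c s')) t = g (?c ?q)" if g: "g \<in> Cinf 1" for g
  proof -
    have "snd \<sigma> V (cop (spec_sections A V) 1 g (?c s')) =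
        cop (sections X (preim X \<sigma> V)) 1 g (\<lambda>i\<in>{..<1}. snd \<sigma> V (?c s' i))"
      using hom[OF V] g c unfolding cinf_hom_def by blast
    moreover have "(\<lambda>i\<in>{..<1}. (\<lambda>i\<in>{..<1}. snd \<sigma> V (?c s' i)) i t) = ?c ?q"
      by (rule restrict_ext) (simp add: ht[unfolded h_def])
    ultimately show ?thesis using t tV by (simp add: preim_X)
  qed
  have "cop (spec_sections A V) 1 \<phi> (?c s') = cop (spec_sections A V) 1 one (?c s')"
    unfolding spec_sections_def cinf_ring.select_convs
  proof (rule restrict_ext)
    fix y assume y: "y \<in> V"
    then have "y \<in> points A" using openin_spec_subset[OF V] by blast
    then interpret cinf_point A y by (rule point)
    obtain a where a: "a \<in> carrier A" "s y = loc_proj A y a" "y (cop A 1 e (?c a)) \<noteq> 0" using local[OF y] by blast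
    have ca: "?c a \<in> tuples 1 (carrier A)" unfolding restrict_PiE_iff using a by simp
    \<comment> \<open>\<phi> and 1 agree after multiplication by e, and e(a) does not vanish at y,
      so \<phi>(a) and 1 have the same class in the localization at y.\<close>
    have "(\<lambda>x\<in>RR 1. \<phi> x * e x) = (\<lambda>x\<in>RR 1. one x * e x)"
      by (rule restrict_ext) (use \<phi>x e(3) in \<open>auto simp: one_def\<close>)
    then have "cop A 1 \<phi> (?c a) \<otimes>\<^bsub>R\<^esub> cop A 1 e (?c a) = cop A 1 one (?c a) \<otimes>\<^bsub>R\<^esub> cop A 1 e (?c a)"
      unfolding cop_times[OF \<phi> e(1) ca] cop_times[OF one e(1) ca] by simp
    then have "loc_proj A y (cop A 1 \<phi> (?c a)) = loc_proj A y (cop A 1 one (?c a))"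
      by (intro loc_proj_eqI[OF cop_closed[OF \<phi> ca] cop_closed[OF one ca] cop_closed[OF e(1) ca] a(3)])
    moreover have "(\<lambda>i\<in>{..<1}. ?c s' i y) = (\<lambda>i\<in>{..<1}. loc_proj A y (?c a i))"
      by (rule restrict_ext) (use y a(2) in \<open>simp add: s'_def\<close>)
    ultimately show "cop (loc A y) 1 \<phi> (\<lambda>i\<in>{..<1}. ?c s' i y) = cop (loc A y) 1 one (\<lambda>i\<in>{..<1}. ?c s' i y)"
      by (simp only: loc_proj_cop[OF \<phi> ca] loc_proj_cop[OF one ca])
  qed
  then have "\<phi> (?c ?q) = one (?c ?q)" using image[OF \<phi>] image[OF one] by simp
  moreover have "\<phi> (?c ?q) = 0" using \<phi>x[OF R1, of ?q] by simp
  moreover have "one (?c ?q) = 1" using R1[of ?q] by (simp add: one_def)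
  ultimately show False by simp
qed

lemma space_map_eq_pullback:
  assumes \<sigma>: "space_map X (Spec A) \<sigma>"
  shows "\<sigma> = pullback_map A (topspace T) (fst \<sigma>)"
proof (rule prod_eqI)
  show "snd \<sigma> = snd (pullback_map A (topspace T) (fst \<sigma>))"
  proof (rule extensionalityI[of _ "{U. openin (spec_top A) U}"])
    show "snd \<sigma> \<in> extensional {U. openin (spec_top A) U}" using \<sigma> by (simp add: space_map_def)
    show "snd (pullback_map A (topspace T) (fst \<sigma>)) \<in> extensional {U. openin (spec_top A) U}"
      by (simp add: pullback_map_def)
    fix U assume "U \<in> {U. openin (spec_top A) U}"
    then have U: "openin (spec_top A) U" by simp
    then have h: "snd \<sigma> U \<in> carrier (spec_sections A U) \<rightarrow>\<^sub>E S (preim X \<sigma> U)"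
      using \<sigma> by (simp add: space_map_def cinf_hom_def)
    show "snd \<sigma> U = snd (pullback_map A (topspace T) (fst \<sigma>)) U"
    proof (rule extensionalityI[of _ "carrier (spec_sections A U)"])
      show "snd \<sigma> U \<in> extensional (carrier (spec_sections A U))" using h by (simp add: PiE_iff)
      show "snd (pullback_map A (topspace T) (fst \<sigma>)) U \<in> extensional (carrier (spec_sections A U))"
        using U by (simp add: pullback_map_def)
      fix s assume s: "s \<in> carrier (spec_sections A U)"
      show "snd \<sigma> U s = snd (pullback_map A (topspace T) (fst \<sigma>)) U s"
        unfolding snd_pullback_map[OF U s]
      proof (rule extensionalityI[of _ "{t \<in> topspace T. fst \<sigma> t \<in> U}"])
        show "snd \<sigma> U s \<in> extensional {t \<in> topspace T. fst \<sigma> t \<in> U}"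
          using h s by (auto simp: preim_X)
        fix t assume "t \<in> {t \<in> topspace T. fst \<sigma> t \<in> U}"
        then show "snd \<sigma> U s t = (\<lambda>t\<in>{t \<in> topspace T. fst \<sigma> t \<in> U}. coset_value (fst \<sigma> t) (s (fst \<sigma> t))) t"
          using space_map_value[OF \<sigma> U s] by simp
      qed simp
    qed
  qed
qed simp

end


section \<open>Integral curves as families of points\<close>

lemma at_within_Int_open:
  assumes S: "open S" "t \<in> S"
  shows "at t within (K \<inter> S) = at t within K"
proof -
  have "(\<exists>W. open W \<and> t \<in> W \<and> (\<forall>x\<in>W. x \<noteq> t \<longrightarrow> x \<in> K \<inter> S \<longrightarrow> P x)) \<longleftrightarrow>
      (\<exists>W. open W \<and> t \<in> W \<and> (\<forall>x\<in>W. x \<noteq> t \<longrightarrow> x \<in> K \<longrightarrow> P x))" (is "?l \<longleftrightarrow> ?r") for P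
  proof
    assume ?l
    then obtain W where "open W" "t \<in> W" "\<forall>x\<in>W. x \<noteq> t \<longrightarrow> x \<in> K \<inter> S \<longrightarrow> P x" by blast
    then show ?r using S by (intro exI[of _ "W \<inter> S"]) auto
  qed blast
  then show ?thesis unfolding filter_eq_iff eventually_at_topological by blast
qed

text \<open>Lets one curve stand for another near t: S localizes both the domains and the functions.
  With S = UNIV it is restriction to a subset.\<close>

lemma has_field_derivative_transfer:
  fixes f g :: "real \<Rightarrow> real"
  assumes f: "(f has_field_derivative D) (at t within L)" and S: "open S" "t \<in> S" and t: "t \<in> K"
    and K: "K \<inter> S \<subseteq> L" and eq: "\<And>s. s \<in> K \<inter> S \<Longrightarrow> f s = g s"
  shows "(g has_field_derivative D) (at t within K)"
proof -
  have "(f has_field_derivative D) (at t within K)"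
    using DERIV_subset[OF f K] unfolding at_within_Int_open[OF S] .
  moreover have "\<forall>\<^sub>F s in at t within K. f s = g s"
    unfolding eventually_at_topological using S eq by (intro exI[of _ S]) blast
  moreover have "f t = g t" using eq S t by blast
  ultimately show ?thesis using has_field_derivative_cong_eventually by blast
qed

lemma has_field_derivative_within_unique:
  fixes f :: "real \<Rightarrow> real"
  assumes "(f has_field_derivative D) (at t within L)" "(f has_field_derivative E) (at t within L)" "t islimpt L"
  shows "D = E"
proof -
  have "at t within L \<noteq> bot" using assms(3) trivial_limit_within[of t L] by blast
  from vector_derivative_within[OF this] assms(1,2) show ?thesis
    unfolding has_real_derivative_iff_has_vector_derivative by metis
qed

text \<open>The function exp(-C x) q x has nonpositive derivative, so by the mean value theorem it
  does not exceed its value 0 at a.\<close>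

lemma gronwall_nonpos:
  fixes q :: "real \<Rightarrow> real"
  assumes "a \<le> b"
    and q: "\<And>x. x \<in> {a..b} \<Longrightarrow> (q has_field_derivative q' x) (at x within {a..b})"
    and le: "\<And>x. x \<in> {a..b} \<Longrightarrow> q' x \<le> C * q x" and "q a = 0"
  shows "q b \<le> 0"
proof (cases "a = b")
  case False
  then have ab: "a < b" using assms(1) by simp
  have "((\<lambda>x. exp (- C * x) * q x) has_field_derivative exp (- C * x) * (q' x - C * q x)) (at x within {a..b})"
    if "x \<in> {a..b}" for x
    by (rule derivative_eq_intros q[OF that] refl | simp add: algebra_simps)+
  then have "\<exists>x\<in>{a<..<b}. exp (- C * b) * q b - exp (- C * a) * q a = (exp (- C * x) * (q' x - C * q x)) * (b - a)"
    using mvt_simple[OF ab, of "\<lambda>x. exp (- C * x) * q x" "\<lambda>x. (*) (exp (- C * x) * (q' x - C * q x))"]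
    by (simp add: has_field_derivative_def)
  then obtain x where x: "x \<in> {a<..<b}" "exp (- C * b) * q b = exp (- C * x) * (q' x - C * q x) * (b - a)"
    using assms(4) by auto
  have "q' x - C * q x \<le> 0" using le[of x] x(1) by simp
  then have "exp (- C * x) * (q' x - C * q x) * (b - a) \<le> 0"
    using ab by (intro mult_nonpos_nonneg mult_nonneg_nonpos) auto
  then have "exp (- C * b) * q b \<le> 0" using x(2) by simp
  then show ?thesis by (simp add: mult_le_0_iff)
qed (use assms in simp)

text \<open>The box is convex, so the segment from y to x stays in it, and the mean value theorem
  along the segment bounds the difference by partial derivatives. On a small enough box each of
  these differs from its value at z by less than 1; C adds up the resulting bounds.\<close>

lemma Cinf_locally_lipschitz:
  assumes \<beta>: "\<beta> \<in> Cinf n" and z: "z \<in> RR n"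
  obtains d C where "0 < d" "0 \<le> C" "\<And>x y. x \<in> RR n \<Longrightarrow> y \<in> RR n \<Longrightarrow> (\<And>i. i < n \<Longrightarrow> \<bar>x i - z i\<bar> < d) \<Longrightarrow>
    (\<And>i. i < n \<Longrightarrow> \<bar>y i - z i\<bar> < d) \<Longrightarrow> \<bar>\<beta> x - \<beta> y\<bar> \<le> C * (\<Sum>i<n. \<bar>x i - y i\<bar>)"
proof -
  have "\<exists>d>0. \<forall>y\<in>RR n. (\<forall>j<n. \<bar>y j - z j\<bar> < d) \<longrightarrow> \<bar>partial n i \<beta> y - partial n i \<beta> z\<bar> < 1" if "i < n" for i
    by (rule continuous_map_box[OF Ck_continuous[OF Ck_partial[OF Cinf_D[OF \<beta>] that]] z]) simp
  then obtain d where d: "\<And>i. i < n \<Longrightarrow> d i > 0"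
    "\<And>i y. i < n \<Longrightarrow> y \<in> RR n \<Longrightarrow> (\<forall>j<n. \<bar>y j - z j\<bar> < d i) \<Longrightarrow> \<bar>partial n i \<beta> y - partial n i \<beta> z\<bar> < 1"
    by metis
  define D where "D = Min (insert 1 (d ` {..<n}))"
  have D: "D > 0" unfolding D_def using d(1) by (subst Min_gr_iff) auto
  have Dd: "D \<le> d i" if "i < n" for i unfolding D_def using that by (intro Min_le) auto
  define C where "C = (\<Sum>i<n. \<bar>partial n i \<beta> z\<bar> + 1)"
  have Ci: "\<bar>partial n i \<beta> z\<bar> + 1 \<le> C" if "i < n" for i
    unfolding C_def by (rule member_le_sum[of i "{..<n}" "\<lambda>i. \<bar>partial n i \<beta> z\<bar> + 1"]) (use that in auto)
  have C: "0 \<le> C" unfolding C_def by (intro sum_nonneg) simp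
  show thesis
  proof (rule that[OF D C])
    fix x y assume x: "x \<in> RR n" "\<And>i. i < n \<Longrightarrow> \<bar>x i - z i\<bar> < D"
      and y: "y \<in> RR n" "\<And>i. i < n \<Longrightarrow> \<bar>y i - z i\<bar> < D"
    let ?h = "\<lambda>i s. y i + s * (x i - y i)"
    have "((\<lambda>s. \<beta> (\<lambda>i\<in>{..<n}. ?h i s)) has_field_derivative
        (\<Sum>i<n. partial n i \<beta> (\<lambda>i\<in>{..<n}. ?h i s) * (x i - y i))) (at s)" for s
      by (rule chain_rule_Ck[OF Cinf_D[OF \<beta>, of "Suc 0"]]) (auto intro!: derivative_eq_intros)
    then obtain s where s: "0 < s" "s < 1" and eq: "\<beta> (\<lambda>i\<in>{..<n}. ?h i 1) - \<beta> (\<lambda>i\<in>{..<n}. ?h i 0) =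
        (1 - 0) * (\<Sum>i<n. partial n i \<beta> (\<lambda>i\<in>{..<n}. ?h i s) * (x i - y i))"
      using MVT2[of 0 1 "\<lambda>s. \<beta> (\<lambda>i\<in>{..<n}. ?h i s)"
          "\<lambda>s. \<Sum>i<n. partial n i \<beta> (\<lambda>i\<in>{..<n}. ?h i s) * (x i - y i)"] by auto
    have "(\<lambda>i\<in>{..<n}. ?h i 1) = x" "(\<lambda>i\<in>{..<n}. ?h i 0) = y"
      using x(1) y(1) by (auto simp: PiE_iff extensional_def fun_eq_iff)
    with eq have eq: "\<beta> x - \<beta> y = (\<Sum>i<n. partial n i \<beta> (\<lambda>i\<in>{..<n}. ?h i s) * (x i - y i))" by simp
    have box: "\<bar>?h j s - z j\<bar> < D" if j: "j < n" for j
    proof -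
      have "?h j s - z j = (1 - s) * (y j - z j) + s * (x j - z j)" by (simp add: algebra_simps)
      then have "\<bar>?h j s - z j\<bar> \<le> (1 - s) * \<bar>y j - z j\<bar> + s * \<bar>x j - z j\<bar>"
        using s by (metis abs_mult abs_of_pos abs_triangle_ineq diff_gt_0_iff_gt)
      also have "\<dots> < (1 - s) * D + s * D"
        using s x(2)[OF j] y(2)[OF j] by (intro add_strict_mono mult_strict_left_mono) auto
      finally show ?thesis by (simp add: algebra_simps)
    qed
    have "\<bar>partial n i \<beta> (\<lambda>i\<in>{..<n}. ?h i s)\<bar> \<le> C" if i: "i < n" for i
    proof -
      have "\<forall>j<n. \<bar>(\<lambda>i\<in>{..<n}. ?h i s) j - z j\<bar> < d i" using box Dd[OF i] by fastforce
      moreover have "(\<lambda>i\<in>{..<n}. ?h i s) \<in> RR n" unfolding restrict_PiE_iff by simp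
      ultimately have "\<bar>partial n i \<beta> (\<lambda>i\<in>{..<n}. ?h i s) - partial n i \<beta> z\<bar> < 1" by (intro d(2)[OF i])
      with Ci[OF i] show ?thesis by linarith
    qed
    then have "\<bar>\<beta> x - \<beta> y\<bar> \<le> (\<Sum>i<n. C * \<bar>x i - y i\<bar>)"
      unfolding eq by (intro order_trans[OF sum_abs] sum_mono) (auto simp: abs_mult intro!: mult_right_mono)
    then show "\<bar>\<beta> x - \<beta> y\<bar> \<le> C * (\<Sum>i<n. \<bar>x i - y i\<bar>)" by (simp add: sum_distrib_left)
  qed
qed

lemma interval_space_eq: "interval_space L = function_space (top_of_set L) smooth_on_set"
proof -
  have "interval_sections = (\<lambda>U. \<lparr>carrier = {h \<in> extensional U. smooth_on_set U h},
      cop = (\<lambda>m g c. \<lambda>w\<in>U. g (\<lambda>i\<in>{..<m}. c i w))\<rparr>)"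
    by (rule ext) (simp add: interval_sections_def)
  moreover have "carrier (interval_sections U) = {h \<in> extensional U. smooth_on_set U h}" for U
    by (simp add: interval_sections_def)
  ultimately show ?thesis by (simp only: interval_space_def function_space_def)
qed

lemma function_sheaf_interval: "function_sheaf (top_of_set L) smooth_on_set"
proof
  fix U and f :: "real \<Rightarrow> real"
  assume l: "\<And>t. t \<in> U \<Longrightarrow> \<exists>V. openin (top_of_set L) V \<and> t \<in> V \<and> V \<subseteq> U \<and> smooth_on_set V f"
  show "smooth_on_set U f"
  proof (rule smooth_on_set_local)
    fix t assume t: "t \<in> U"
    obtain V where V: "openin (top_of_set L) V" "t \<in> V" "smooth_on_set V f" using l[OF t] by blast
    then obtain S where S: "open S" "V = L \<inter> S" by (auto simp: openin_open)
    have "U \<subseteq> L" using l openin_imp_subset by blast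
    then have "smooth_on_set (U \<inter> S) f" by (intro smooth_on_set_subset[OF V(3)]) (auto simp: S)
    then show "\<exists>S. open S \<and> t \<in> S \<and> smooth_on_set (U \<inter> S) f" using S V(2) by blast
  qed
next
  fix U and f :: "real \<Rightarrow> real" assume U: "openin (top_of_set L) U" and f: "smooth_on_set U f"
  have "openin (top_of_set U) (U \<inter> f -` (- {0}))"
    by (rule continuous_openin_preimage_gen[OF smooth_on_set_continuous_on[OF f]]) auto
  moreover have "U \<inter> f -` (- {0}) = {w \<in> U. f w \<noteq> 0}" by auto
  ultimately show "openin (top_of_set L) {w \<in> U. f w \<noteq> 0}" using U openin_trans by metis
qed (auto intro: smooth_on_set_compose smooth_on_set_cong smooth_on_set_subset)

section \<open>The derivative of ring elements along integral curves\<close>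

locale spec_vector_field = cinf_ring A for A :: "'a cinf_ring" +
  fixes v :: "('a \<Rightarrow> real) set \<Rightarrow> (('a \<Rightarrow> real) \<Rightarrow> 'a set) \<Rightarrow> ('a \<Rightarrow> real) \<Rightarrow> 'a set"
  assumes vector_field: "vector_field (Spec A) v"
begin

abbreviation "global a \<equiv> \<lambda>x\<in>points A. loc_proj A x a"

text \<open>The right-hand side of the differential equation: the rate at which the value of a
  changes along an integral curve when it passes through y.\<close>

definition velocity :: "'a \<Rightarrow> ('a \<Rightarrow> real) \<Rightarrow> real"
  where "velocity a y = coset_value y (v (points A) (global a) y)"

lemma openin_points: "openin (spec_top A) (points A)"
  using openin_topspace[of "spec_top A"] topspace_spec by simp

lemma global_closed: "a \<in> carrier A \<Longrightarrow> global a \<in> carrier (spec_sections A (points A))"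
  by (rule global_section[OF openin_points])

lemma v_closed:
  "openin (spec_top A) U \<Longrightarrow> s \<in> carrier (spec_sections A U) \<Longrightarrow> v U s \<in> carrier (spec_sections A U)"
  using vector_field unfolding vector_field_def cinf_derivation_def by (simp add: Pi_iff)

lemma v_restrict:
  assumes "openin (spec_top A) U" "openin (spec_top A) V" "V \<subseteq> U" "s \<in> carrier (spec_sections A U)"
  shows "restrict (v U s) V = v V (restrict s V)"
proof -
  have "restr (Spec A) U V (v U s) = v V (restr (Spec A) U V s)"
    by (rule conjunct2[OF vector_field[unfolded vector_field_def Spec_simps(1,2)], rule_format])
      (use assms in simp_all)
  then show ?thesis using assms(4) v_closed[OF assms(1,4)] by simp
qed

text \<open>v commutes with restrictions, so v s at y depends only on s near y, and there s is the
  section of a.\<close>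

lemma v_local:
  assumes U: "openin (spec_top A) U" and s: "s \<in> carrier (spec_sections A U)"
    and V: "openin (spec_top A) V" "V \<subseteq> U" "y \<in> V" and a: "a \<in> carrier A"
    and eq: "\<And>z. z \<in> V \<Longrightarrow> s z = loc_proj A z a"
  shows "coset_value y (v U s y) = velocity a y"
proof -
  have VX: "V \<subseteq> points A" by (rule openin_spec_subset[OF V(1)])
  have "restrict s V = restrict (global a) V"
  proof (rule restrict_ext)
    fix z assume z: "z \<in> V"
    then have "z \<in> points A" using VX by blast
    then show "s z = global a z" unfolding eq[OF z] by (rule restrict_apply'[symmetric])
  qed
  then have "restrict (v U s) V = restrict (v (points A) (global a)) V"
    using v_restrict[OF U V(1,2) s] v_restrict[OF openin_points V(1) VX global_closed[OF a]] by simp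
  then have "restrict (v U s) V y = restrict (v (points A) (global a)) V y" by (simp only:)
  then have "v U s y = v (points A) (global a) y" using V(3) by simp
  then show ?thesis by (simp add: velocity_def)
qed

text \<open>v applied to the section of a is again a section, so near y it comes from a ring element
  b. This b is a smooth function of the generators, which gives Lipschitz estimates; it can also be
  differentiated along curves in its turn, which gives all higher derivatives.\<close>

lemma velocity_local:
  assumes a: "a \<in> carrier A" and y: "y \<in> points A"
  obtains V b where "openin (spec_top A) V" "y \<in> V" "b \<in> carrier A" "\<And>z. z \<in> V \<Longrightarrow> velocity a z = z b"
proof -
  obtain V b where V: "openin (spec_top A) V" "y \<in> V" "b \<in> carrier A"
    and eq: "\<And>z. z \<in> V \<Longrightarrow> v (points A) (global a) z = loc_proj A z b"
    by (rule section_local[OF v_closed[OF openin_points global_closed[OF a]] y]) blast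
  have "velocity a z = z b" if z: "z \<in> V" for z
  proof -
    have "z \<in> points A" using z openin_spec_subset[OF V(1)] by blast
    then show ?thesis unfolding velocity_def eq[OF z]
      by (rule cinf_point.loc_proj_value[OF point V(3)])
  qed
  with V that show thesis by blast
qed

text \<open>The interval {0} is covered by the same clauses: there \<open>at t within L\<close> is
  the trivial filter, so the derivative condition holds vacuously, and every function on a single
  point is smooth.\<close>

definition trajectory :: "('a \<Rightarrow> real) \<Rightarrow> real set \<Rightarrow> (real \<Rightarrow> 'a \<Rightarrow> real) \<Rightarrow> bool"
  where "trajectory p L f \<longleftrightarrow> connected L \<and> 0 \<in> L \<and> f \<in> L \<rightarrow>\<^sub>E points A \<and> f 0 = p \<and>
    (\<forall>a\<in>carrier A. smooth_on_set L (\<lambda>t. f t a)) \<and>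
    (\<forall>t\<in>L. \<forall>a\<in>carrier A. ((\<lambda>s. f s a) has_field_derivative velocity a (f t)) (at t within L))"

lemma trajectoryD:
  assumes "trajectory p L f"
  shows "connected L" "0 \<in> L" "f \<in> L \<rightarrow>\<^sub>E points A" "f 0 = p" "\<And>t. t \<in> L \<Longrightarrow> f t \<in> points A"
    "\<And>a. a \<in> carrier A \<Longrightarrow> smooth_on_set L (\<lambda>t. f t a)"
    "\<And>t a. t \<in> L \<Longrightarrow> a \<in> carrier A \<Longrightarrow> ((\<lambda>s. f s a) has_field_derivative velocity a (f t)) (at t within L)"
  using assms unfolding trajectory_def by blast+

lemma function_sheaf_over_interval: "function_sheaf_over (top_of_set L) smooth_on_set A"
  by (intro function_sheaf_over.intro function_sheaf_interval cinf_ring_axioms)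

lemma trajectory_continuous:
  assumes "trajectory p L f"
  shows "continuous_map (top_of_set L) (spec_top A) f"
proof -
  interpret I: function_sheaf_over "top_of_set L" smooth_on_set A by (rule function_sheaf_over_interval)
  show ?thesis by (rule I.continuous_map_spec_P) (use trajectoryD[OF assms] in auto)
qed

lemma trajectory_preimage:
  assumes "trajectory p L f" "openin (spec_top A) V"
  obtains S where "open S" "{t \<in> L. f t \<in> V} = L \<inter> S"
proof -
  have "openin (top_of_set L) {t \<in> L. f t \<in> V}"
    using openin_continuous_map_preimage[OF trajectory_continuous[OF assms(1)] assms(2)] by simp
  then show thesis using that by (auto simp: openin_open)
qed

lemma islimpt_interval:
  fixes L :: "real set"
  assumes "connected L" "0 \<in> L" "L \<noteq> {0}" "t \<in> L"
  shows "t islimpt L"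
  by (rule connected_imp_perfect[OF assms(1,4)]) (use assms in auto)

text \<open>From left to right the relation is tested on the global sections of ring elements. From
  right to left an arbitrary section comes from a ring element near each point of the curve, and
  locality of v and of derivatives reduces the relation to that case.\<close>

lemma integral_curve_iff:
  "integral_curve (Spec A) v p L \<sigma> \<longleftrightarrow> trajectory p L (fst \<sigma>) \<and> \<sigma> = pullback_map A L (fst \<sigma>)"
proof -
  interpret I: function_sheaf_over "top_of_set L" smooth_on_set A by (rule function_sheaf_over_interval)
  have X: "interval_space L = I.X" by (rule interval_space_eq)
  have sec: "snd (pullback_map A L f) (points A) (global a) = (\<lambda>t\<in>L. f t a)"
    if f: "f \<in> L \<rightarrow> points A" and a: "a \<in> carrier A" for f a
    unfolding snd_pullback_map[OF openin_points global_closed[OF a]]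
  proof -
    have "{t \<in> L. f t \<in> points A} = L" using f by blast
    moreover have "coset_value (f t) (global a (f t)) = f t a" if "t \<in> L" for t
      using cinf_point.loc_proj_value[OF point a] f that by auto
    ultimately show "(\<lambda>t\<in>{t \<in> L. f t \<in> points A}. coset_value (f t) (global a (f t))) = (\<lambda>t\<in>L. f t a)"
      by (auto simp: fun_eq_iff)
  qed
  show ?thesis
  proof
    assume \<sigma>: "integral_curve (Spec A) v p L \<sigma>"
    let ?f = "fst \<sigma>"
    have map: "space_map I.X (Spec A) \<sigma>" and L: "connected L" "0 \<in> L" "?f 0 = p"
      and rel: "L \<noteq> {0} \<Longrightarrow> related I.X (Spec A) \<sigma> ddt v"
      using \<sigma> unfolding integral_curve_def X by auto
    have eq: "\<sigma> = pullback_map A L ?f" using I.space_map_eq_pullback[OF map] by simp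
    have cont: "continuous_map (top_of_set L) (spec_top A) ?f" "?f \<in> extensional L"
      using map unfolding space_map_def by simp_all
    have f: "?f \<in> L \<rightarrow> points A" using continuous_map_funspace[OF cont(1)] topspace_spec by simp
    have pre: "preim I.X \<sigma> (points A) = L" unfolding I.preim_X using f by auto
    have smooth: "smooth_on_set L (\<lambda>t. ?f t a)" if a: "a \<in> carrier A" for a
    proof -
      have "snd \<sigma> (points A) \<in> cinf_hom (spec_sections A (points A)) (sections I.X (preim I.X \<sigma> (points A)))"
        using map openin_points unfolding space_map_def by simp
      then have "snd \<sigma> (points A) \<in> cinf_hom (spec_sections A (points A)) (sections I.X L)"
        unfolding pre .
      then have "snd \<sigma> (points A) (global a) \<in> I.S L" using global_closed[OF a] by (auto simp: cinf_hom_def)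
      moreover have "snd \<sigma> (points A) (global a) = (\<lambda>t\<in>L. ?f t a)" using sec[OF f a] eq by simp
      ultimately have "smooth_on_set L (\<lambda>t\<in>L. ?f t a)" by simp
      then show ?thesis by (rule smooth_on_set_cong) simp
    qed
    have "((\<lambda>s. ?f s a) has_field_derivative velocity a (?f t)) (at t within L)"
      if t: "t \<in> L" and a: "a \<in> carrier A" for t a
    proof (cases "L = {0}")
      case True
      then have "at t within L = bot" using t by (simp add: trivial_limit_within islimpt_finite)
      then show ?thesis by (simp add: has_field_derivative_iff)
    next
      case False
      have vg: "v (points A) (global a) \<in> carrier (spec_sections A (points A))"
        by (rule v_closed[OF openin_points global_closed[OF a]])
      have "snd \<sigma> (points A) (v (points A) (global a)) = ddt L (snd \<sigma> (points A) (global a))"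
        using rel[OF False] openin_points global_closed[OF a] pre unfolding related_def by simp
      then have "snd (pullback_map A L ?f) (points A) (v (points A) (global a)) t = ddt L (\<lambda>t\<in>L. ?f t a) t"
        using sec[OF f a] eq by simp
      then have vd: "velocity a (?f t) = vector_derivative (\<lambda>t\<in>L. ?f t a) (at t within L)"
        using t funcset_mem[OF f t] unfolding snd_pullback_map[OF openin_points vg]
        by (simp add: velocity_def ddt_def)
      obtain D where D: "((\<lambda>s. ?f s a) has_field_derivative D) (at t within L)"
        using smooth_on_set_has_derivative[OF smooth[OF a] t] .
      then have "((\<lambda>t\<in>L. ?f t a) has_field_derivative D) (at t within L)"
        by (rule has_field_derivative_transfer[of _ _ _ _ UNIV]) (use t in auto)
      then have "vector_derivative (\<lambda>t\<in>L. ?f t a) (at t within L) = D"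
        using islimpt_interval[OF L(1,2) False t] trivial_limit_within[of t L]
        by (intro vector_derivative_within) (auto simp: has_real_derivative_iff_has_vector_derivative)
      with D vd show ?thesis by simp
    qed
    note der = this
    have "?f \<in> L \<rightarrow>\<^sub>E points A" using f cont(2) by (simp add: PiE_iff Pi_iff)
    then have "trajectory p L ?f"
      unfolding trajectory_def using L smooth der by simp
    with eq show "trajectory p L ?f \<and> \<sigma> = pullback_map A L ?f" by (rule conjI[rotated])
  next
    assume \<sigma>: "trajectory p L (fst \<sigma>) \<and> \<sigma> = pullback_map A L (fst \<sigma>)"
    define f where "f = fst \<sigma>"
    have f: "trajectory p L f" and eq: "\<sigma> = pullback_map A L f" using \<sigma> by (simp_all add: f_def)
    note T = trajectoryD[OF f]
    have map: "space_map I.X (Spec A) \<sigma>"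
      unfolding eq using I.pullback_space_map[of f] T(3,6) by simp
    have "related I.X (Spec A) \<sigma> ddt v" if L0: "L \<noteq> {0}"
      unfolding related_def Spec_simps
    proof (intro allI impI ballI)
      fix U s assume U: "openin (spec_top A) U" and s: "s \<in> carrier (spec_sections A U)"
      let ?W = "{t \<in> L. f t \<in> U}"
      let ?h = "\<lambda>t\<in>?W. coset_value (f t) (s (f t))"
      have pre: "preim I.X \<sigma> U = ?W" by (simp add: I.preim_X eq)
      obtain SU where SU: "open SU" "?W = L \<inter> SU" by (rule trajectory_preimage[OF f U])
      have "coset_value (f t) (v U s (f t)) = vector_derivative ?h (at t within ?W)" if t: "t \<in> ?W" for t
      proof -
        have "f t \<in> U" using t by simp
        then obtain V a where V: "openin (spec_top A) V" "f t \<in> V" "V \<subseteq> U" and a: "a \<in> carrier A"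
          and sV: "\<And>z. z \<in> V \<Longrightarrow> s z = loc_proj A z a"
          by (rule section_local[OF s]) blast
        obtain SV where SV: "open SV" "{t \<in> L. f t \<in> V} = L \<inter> SV" by (rule trajectory_preimage[OF f V(1)])
        have "((\<lambda>s. f s a) has_field_derivative velocity a (f t)) (at t within L)"
          by (rule T(7)) (use t a in auto)
        then have "(?h has_field_derivative velocity a (f t)) (at t within ?W)"
        proof (rule has_field_derivative_transfer[OF _ SV(1)])
          have "t \<in> {t \<in> L. f t \<in> V}" using t V(2) by simp
          then show "t \<in> SV" unfolding SV(2) by blast
          fix r assume r: "r \<in> ?W \<inter> SV"
          then have "r \<in> {t \<in> L. f t \<in> V}" unfolding SV(2) by blast
          then have rV: "f r \<in> V" and "f r \<in> points A" using T(5) by auto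
          then show "f r a = ?h r"
            using r sV[OF rV] cinf_point.loc_proj_value[OF point a] by simp
        qed (use t in auto)
        \<comment> \<open>\<open>?W\<close> is relatively open in an interval with more than one
          point, so t is not isolated in it; this makes \<open>vector_derivative\<close> agree with
          the derivative found above.\<close>
        moreover have "at t within ?W \<noteq> bot"
        proof -
          have "t \<in> L \<inter> SU" using t SU(2) by blast
          then have "at t within ?W = at t within L" unfolding SU(2) using at_within_Int_open[OF SU(1)] by blast
          then show ?thesis using islimpt_interval[OF T(1,2) L0] t trivial_limit_within[of t L] by simp
        qed
        ultimately have "vector_derivative ?h (at t within ?W) = velocity a (f t)"
          by (intro vector_derivative_within) (simp_all add: has_real_derivative_iff_has_vector_derivative)
        moreover have "coset_value (f t) (v U s (f t)) = velocity a (f t)"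
          by (rule v_local[OF U s V(1,3,2) a sV])
        ultimately show ?thesis by simp
      qed
      then have "(\<lambda>t\<in>?W. coset_value (f t) (v U s (f t))) = ddt ?W ?h"
        unfolding ddt_def by (rule restrict_ext)
      then show "snd \<sigma> U (v U s) = ddt (preim I.X \<sigma> U) (snd \<sigma> U s)"
        unfolding pre unfolding eq snd_pullback_map[OF U v_closed[OF U s]] snd_pullback_map[OF U s] .
    qed
    with T(1,2,4) map show "integral_curve (Spec A) v p L \<sigma>"
      unfolding integral_curve_def X by (simp add: f_def)
  qed
qed

end


section \<open>Uniqueness of trajectories\<close>

context cinf_ring
begin

text \<open>A smooth function \<beta> on R^n is the operation \<beta> applied to the coordinate
  functions, so its image under the presentation is \<beta> applied to their images.\<close>

lemma finitely_generated_generators: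
  assumes "finitely_generated A"
  obtains n X where "X \<in> tuples n (carrier A)" "\<And>a. a \<in> carrier A \<Longrightarrow> \<exists>\<beta>\<in>Cinf n. a = cop A n \<beta> X"
proof -
  obtain n \<phi> where \<phi>: "\<phi> \<in> cinf_hom (cinf_free n) A" "\<phi> ` carrier (cinf_free n) = carrier A"
    using assms unfolding finitely_generated_def by blast
  have h: "\<phi> \<in> Cinf n \<rightarrow>\<^sub>E carrier A"
    "\<And>m g c. g \<in> Cinf m \<Longrightarrow> c \<in> tuples m (Cinf n) \<Longrightarrow> \<phi> (fcomp n m g c) = cop A m g (\<lambda>i\<in>{..<m}. \<phi> (c i))"
    using \<phi>(1) unfolding cinf_hom_def cinf_free_def by simp_all
  define c where "c = (\<lambda>i\<in>{..<n}. coord n i)"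
  have c: "c \<in> tuples n (Cinf n)" unfolding c_def restrict_PiE_iff by (simp add: Cinf_coord)
  show thesis
  proof (rule that[of "\<lambda>i\<in>{..<n}. \<phi> (c i)" n])
    show "(\<lambda>i\<in>{..<n}. \<phi> (c i)) \<in> tuples n (carrier A)" unfolding restrict_PiE_iff using h(1) c by blast
    fix a assume "a \<in> carrier A"
    then obtain \<beta> where \<beta>: "\<beta> \<in> Cinf n" "a = \<phi> \<beta>" using \<phi>(2) by (auto simp: cinf_free_def)
    have "fcomp n n \<beta> c = \<beta>"
    proof (rule extensionalityI[OF fcomp_extensional Ck_extensional[OF Cinf_D[OF \<beta>(1)]]])
      fix x assume x: "x \<in> RR n"
      have "(\<lambda>i\<in>{..<n}. c i x) = x"
        by (rule extensionalityI[of _ "{..<n}"]) (use x in \<open>auto simp: c_def coord_def PiE_iff\<close>)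
      then show "fcomp n n \<beta> c x = \<beta> x" using x by (simp add: fcomp_def)
    qed
    then show "\<exists>\<beta>\<in>Cinf n. a = cop A n \<beta> (\<lambda>i\<in>{..<n}. \<phi> (c i))" using h(2)[OF \<beta>(1) c] \<beta> by auto
  qed
qed

end

locale fg_spec_vector_field = spec_vector_field A v for A :: "'a cinf_ring" and v +
  fixes n :: nat and X :: "nat \<Rightarrow> 'a"
  assumes X: "X \<in> tuples n (carrier A)"
    and generate: "a \<in> carrier A \<Longrightarrow> \<exists>\<beta>\<in>Cinf n. a = cop A n \<beta> X"
begin

text \<open>The injection of the points into R^n: since X generates, a point is determined by its
  values on X.\<close>

definition coords :: "('a \<Rightarrow> real) \<Rightarrow> nat \<Rightarrow> real"
  where "coords y = (\<lambda>i\<in>{..<n}. y (X i))"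

lemma X_closed: "i < n \<Longrightarrow> X i \<in> carrier A"
  using X by auto

lemma coords_RR: "coords y \<in> RR n"
  unfolding coords_def restrict_PiE_iff by simp

lemma value_coords: "y \<in> points A \<Longrightarrow> \<beta> \<in> Cinf n \<Longrightarrow> y (cop A n \<beta> X) = \<beta> (coords y)"
  unfolding coords_def by (rule cinf_point.point_cop[OF point _ X])

lemma points_eqI:
  assumes y: "y \<in> points A" and z: "z \<in> points A" and eq: "\<And>i. i < n \<Longrightarrow> y (X i) = z (X i)"
  shows "y = z"
proof (rule extensionalityI[of _ "carrier A"])
  show "y \<in> extensional (carrier A)" "z \<in> extensional (carrier A)"
    using y z by (simp_all add: points_def cinf_hom_def PiE_iff)
  fix a assume "a \<in> carrier A"
  then obtain \<beta> where \<beta>: "\<beta> \<in> Cinf n" "a = cop A n \<beta> X" using generate by blast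
  have "coords y = coords z" unfolding coords_def by (rule restrict_ext) (simp add: eq)
  then show "y a = z a" using value_coords[OF y \<beta>(1)] value_coords[OF z \<beta>(1)] \<beta>(2) by simp
qed

text \<open>Near y the velocities of the generators are smooth functions of the coordinates. The
  estimate is made for these functions on a box in R^n, since the set of points may fail to contain
  the segment between two of its members. The least radius and the sum of the constants serve all
  generators at once.\<close>

lemma velocity_lipschitz:
  assumes y: "y \<in> points A"
  obtains V d C where "openin (spec_top A) V" "y \<in> V" "0 < d" "0 \<le> C"
    "\<And>z z' i. z \<in> V \<Longrightarrow> z' \<in> V \<Longrightarrow> (\<And>j. j < n \<Longrightarrow> \<bar>z (X j) - y (X j)\<bar> < d) \<Longrightarrow>
      (\<And>j. j < n \<Longrightarrow> \<bar>z' (X j) - y (X j)\<bar> < d) \<Longrightarrow> i < n \<Longrightarrow>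
      \<bar>velocity (X i) z - velocity (X i) z'\<bar> \<le> C * (\<Sum>j<n. \<bar>z (X j) - z' (X j)\<bar>)"
proof -
  define Q where "Q i V d C \<longleftrightarrow> openin (spec_top A) V \<and> y \<in> V \<and> 0 < d \<and> 0 \<le> C \<and>
    (\<forall>z z'. z \<in> V \<longrightarrow> z' \<in> V \<longrightarrow> (\<forall>j<n. \<bar>z (X j) - y (X j)\<bar> < d) \<longrightarrow> (\<forall>j<n. \<bar>z' (X j) - y (X j)\<bar> < d) \<longrightarrow>
      \<bar>velocity (X i) z - velocity (X i) z'\<bar> \<le> C * (\<Sum>j<n. \<bar>z (X j) - z' (X j)\<bar>))" for i V d C
  have "\<exists>V d C. Q i V d C" if i: "i < n" for i
  proof -
    obtain V b where V: "openin (spec_top A) V" "y \<in> V" and b: "b \<in> carrier A"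
      and vel: "\<And>z. z \<in> V \<Longrightarrow> velocity (X i) z = z b"
      by (rule velocity_local[OF X_closed[OF i] y]) blast
    obtain \<beta> where \<beta>: "\<beta> \<in> Cinf n" "b = cop A n \<beta> X" using generate[OF b] by blast
    obtain d C where d: "0 < d" "0 \<le> C" and lip: "\<And>x x'. x \<in> RR n \<Longrightarrow> x' \<in> RR n \<Longrightarrow>
      (\<And>j. j < n \<Longrightarrow> \<bar>x j - coords y j\<bar> < d) \<Longrightarrow> (\<And>j. j < n \<Longrightarrow> \<bar>x' j - coords y j\<bar> < d) \<Longrightarrow>
      \<bar>\<beta> x - \<beta> x'\<bar> \<le> C * (\<Sum>j<n. \<bar>x j - x' j\<bar>)"
      by (rule Cinf_locally_lipschitz[OF \<beta>(1) coords_RR[of y]]) blast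
    have vel': "velocity (X i) z = \<beta> (coords z)" if z: "z \<in> V" for z
    proof -
      have "z \<in> points A" using z openin_spec_subset[OF V(1)] by blast
      from value_coords[OF this \<beta>(1)] show ?thesis using vel[OF z] \<beta>(2) by simp
    qed
    have "\<bar>velocity (X i) z - velocity (X i) z'\<bar> \<le> C * (\<Sum>j<n. \<bar>z (X j) - z' (X j)\<bar>)"
      if "z \<in> V" "z' \<in> V" "\<forall>j<n. \<bar>z (X j) - y (X j)\<bar> < d" "\<forall>j<n. \<bar>z' (X j) - y (X j)\<bar> < d" for z z'
    proof -
      have "\<bar>\<beta> (coords z) - \<beta> (coords z')\<bar> \<le> C * (\<Sum>j<n. \<bar>coords z j - coords z' j\<bar>)"
        by (rule lip[OF coords_RR coords_RR]) (use that(3,4) in \<open>simp_all add: coords_def\<close>)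
      also have "(\<Sum>j<n. \<bar>coords z j - coords z' j\<bar>) = (\<Sum>j<n. \<bar>z (X j) - z' (X j)\<bar>)"
        by (rule sum.cong) (simp_all add: coords_def)
      finally show ?thesis using vel'[OF that(1)] vel'[OF that(2)] by simp
    qed
    then have "Q i V d C" unfolding Q_def using V d by blast
    then show ?thesis by blast
  qed
  then obtain V d C where Q: "\<And>i. i < n \<Longrightarrow> Q i (V i) (d i) (C i)" by metis
  define W where "W = \<Inter>(insert (points A) (V ` {..<n}))"
  define D where "D = Min (insert 1 (d ` {..<n}))"
  define K where "K = (\<Sum>i<n. C i)"
  have W: "openin (spec_top A) W"
    unfolding W_def by (rule openin_Inter) (use openin_points Q Q_def in auto)
  have yW: "y \<in> W" unfolding W_def using y Q Q_def by auto
  have D: "0 < D" unfolding D_def using Q Q_def by (subst Min_gr_iff) auto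
  have C0: "0 \<le> C i" if "i < n" for i using Q[OF that] by (simp add: Q_def)
  have K: "0 \<le> K" unfolding K_def using C0 by (intro sum_nonneg) auto
  show thesis
  proof (rule that[OF W yW D K])
    fix z z' i
    assume z: "z \<in> W" "z' \<in> W" "\<And>j. j < n \<Longrightarrow> \<bar>z (X j) - y (X j)\<bar> < D" "\<And>j. j < n \<Longrightarrow> \<bar>z' (X j) - y (X j)\<bar> < D"
      and i: "i < n"
    have "D \<le> d i" unfolding D_def using i by (intro Min_le) auto
    then have "\<forall>j<n. \<bar>z (X j) - y (X j)\<bar> < d i" "\<forall>j<n. \<bar>z' (X j) - y (X j)\<bar> < d i"
      using z(3,4) by (auto intro: less_le_trans)
    moreover have "z \<in> V i" "z' \<in> V i" using z(1,2) i by (auto simp: W_def)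
    ultimately have "\<bar>velocity (X i) z - velocity (X i) z'\<bar> \<le> C i * (\<Sum>j<n. \<bar>z (X j) - z' (X j)\<bar>)"
      using Q[OF i] unfolding Q_def by blast
    also have "\<dots> \<le> K * (\<Sum>j<n. \<bar>z (X j) - z' (X j)\<bar>)"
      unfolding K_def using i C0 by (intro mult_right_mono member_le_sum sum_nonneg) auto
    finally show "\<bar>velocity (X i) z - velocity (X i) z'\<bar> \<le> K * (\<Sum>j<n. \<bar>z (X j) - z' (X j)\<bar>)" .
  qed
qed

text \<open>The squared coordinate distance q of the two curves vanishes at t0 and satisfies |q'|
  \<le> 2 C n q nearby, so Gronwall's inequality gives q \<le> 0 on both sides of t0.\<close>

lemma trajectory_locally_unique:
  assumes f: "trajectory p L f" and g: "trajectory p L g" and t0: "t0 \<in> L" "f t0 = g t0"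
  obtains S where "open S" "t0 \<in> S" "\<And>t. t \<in> L \<inter> S \<Longrightarrow> f t = g t"
proof -
  note F = trajectoryD[OF f] and G = trajectoryD[OF g]
  obtain V d C where V: "openin (spec_top A) V" "f t0 \<in> V" and d: "0 < d" "0 \<le> C"
    and lip: "\<And>z z' i. z \<in> V \<Longrightarrow> z' \<in> V \<Longrightarrow> (\<And>j. j < n \<Longrightarrow> \<bar>z (X j) - f t0 (X j)\<bar> < d) \<Longrightarrow>
      (\<And>j. j < n \<Longrightarrow> \<bar>z' (X j) - f t0 (X j)\<bar> < d) \<Longrightarrow> i < n \<Longrightarrow>
      \<bar>velocity (X i) z - velocity (X i) z'\<bar> \<le> C * (\<Sum>j<n. \<bar>z (X j) - z' (X j)\<bar>)"
    by (rule velocity_lipschitz[OF F(5)[OF t0(1)]]) blast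
  define N where "N h = {t \<in> L. h t \<in> V \<and> (\<forall>j<n. \<bar>h t (X j) - f t0 (X j)\<bar> < d)}" for h
  have N: "openin (top_of_set L) (N h)" if h: "trajectory p L h" for h
  proof -
    have "openin (top_of_set L) {t \<in> L. \<bar>h t (X j) - f t0 (X j)\<bar> < d}" if "j < n" for j
    proof -
      have "continuous_on L (\<lambda>t. \<bar>h t (X j) - f t0 (X j)\<bar>)"
        by (intro continuous_intros smooth_on_set_continuous_on trajectoryD(6)[OF h X_closed[OF that]])
      then have "openin (top_of_set L) (L \<inter> (\<lambda>t. \<bar>h t (X j) - f t0 (X j)\<bar>) -` {..<d})"
        by (rule continuous_openin_preimage_gen) simp
      moreover have "L \<inter> (\<lambda>t. \<bar>h t (X j) - f t0 (X j)\<bar>) -` {..<d} = {t \<in> L. \<bar>h t (X j) - f t0 (X j)\<bar> < d}"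
        by auto
      ultimately show ?thesis by simp
    qed
    moreover have "openin (top_of_set L) {t \<in> L. h t \<in> V}"
      using openin_continuous_map_preimage[OF trajectory_continuous[OF h] V(1)] by simp
    ultimately have "openin (top_of_set L)
        (\<Inter>(insert {t \<in> L. h t \<in> V} ((\<lambda>j. {t \<in> L. \<bar>h t (X j) - f t0 (X j)\<bar> < d}) ` {..<n})))"
      by (intro openin_Inter) auto
    moreover have "\<Inter>(insert {t \<in> L. h t \<in> V} ((\<lambda>j. {t \<in> L. \<bar>h t (X j) - f t0 (X j)\<bar> < d}) ` {..<n})) = N h"
      by (auto simp: N_def)
    ultimately show ?thesis by simp
  qed
  have "openin (top_of_set L) (N f \<inter> N g)" using N[OF f] N[OF g] by (rule openin_Int)
  moreover have "t0 \<in> N f \<inter> N g" using t0 V(2) d(1) by (simp add: N_def)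
  ultimately obtain \<delta> where \<delta>: "\<delta> > 0" "\<And>t. t \<in> L \<Longrightarrow> dist t t0 < \<delta> \<Longrightarrow> t \<in> N f \<inter> N g"
    unfolding openin_euclidean_subtopology_iff by blast
  define q where "q t = (\<Sum>i<n. (f t (X i) - g t (X i))\<^sup>2)" for t
  define q' where "q' t = (\<Sum>i<n. 2 * (f t (X i) - g t (X i)) * (velocity (X i) (f t) - velocity (X i) (g t)))" for t
  have q: "(q has_field_derivative q' t) (at t within J)" if "t \<in> L" "J \<subseteq> L" for t J
  proof -
    have "((\<lambda>t. (f t (X i) - g t (X i))\<^sup>2) has_field_derivative
        2 * (f t (X i) - g t (X i)) * (velocity (X i) (f t) - velocity (X i) (g t))) (at t within L)" if "i < n" for i
      using F(7)[OF \<open>t \<in> L\<close> X_closed[OF that]] G(7)[OF \<open>t \<in> L\<close> X_closed[OF that]]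
      by (auto intro!: derivative_eq_intros)
    then have "(q has_field_derivative q' t) (at t within L)"
      unfolding q_def q'_def by (intro DERIV_sum) simp
    then show ?thesis using that(2) by (rule DERIV_subset)
  qed
  have bound: "\<bar>q' t\<bar> \<le> (2 * C * n) * q t" if t: "t \<in> N f \<inter> N g" for t
  proof -
    let ?u = "\<lambda>i. \<bar>f t (X i) - g t (X i)\<bar>"
    have "\<bar>q' t\<bar> \<le> (\<Sum>i<n. \<bar>2 * (f t (X i) - g t (X i)) * (velocity (X i) (f t) - velocity (X i) (g t))\<bar>)"
      unfolding q'_def by (rule sum_abs)
    also have "\<dots> \<le> (\<Sum>i<n. 2 * ?u i * (C * (\<Sum>j<n. ?u j)))"
    proof (rule sum_mono)
      fix i assume i: "i \<in> {..<n}"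
      have "\<bar>velocity (X i) (f t) - velocity (X i) (g t)\<bar> \<le> C * (\<Sum>j<n. ?u j)"
        by (rule lip) (use t i in \<open>auto simp: N_def\<close>)
      then have "2 * ?u i * \<bar>velocity (X i) (f t) - velocity (X i) (g t)\<bar> \<le> 2 * ?u i * (C * (\<Sum>j<n. ?u j))"
        by (intro mult_left_mono) simp_all
      then show "\<bar>2 * (f t (X i) - g t (X i)) * (velocity (X i) (f t) - velocity (X i) (g t))\<bar>
          \<le> 2 * ?u i * (C * (\<Sum>j<n. ?u j))"
        by (simp only: abs_mult abs_numeral)
    qed
    also have "\<dots> = 2 * C * (\<Sum>i<n. ?u i)\<^sup>2"
      by (simp add: power2_eq_square sum_distrib_left sum_distrib_right mult_ac)
    \<comment> \<open>The square of a sum of n terms is at most n times the sum of their squares;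
      this is the origin of the factor n in the constant.\<close>
    also have "\<dots> \<le> 2 * C * ((\<Sum>i<n. (?u i)\<^sup>2) * n)"
      using sum_squared_le_sum_of_squares[of ?u "{..<n}"] d(2) by (intro mult_left_mono) auto
    also have "\<dots> = (2 * C * n) * q t" by (simp add: q_def)
    finally show ?thesis .
  qed
  have q0: "q t0 = 0" using t0 by (simp add: q_def)
  have "f t = g t" if t: "t \<in> L \<inter> ball t0 \<delta>" for t
  proof -
    have "q t \<le> 0"
    proof (cases "t0 \<le> t")
      case True
      have J: "{t0..t} \<subseteq> L" using connected_contains_Icc[OF F(1) t0(1)] t by blast
      have B: "x \<in> N f \<inter> N g" if "x \<in> {t0..t}" for x
        using \<delta>(2)[of x] J that t by (auto simp: dist_real_def)
      show ?thesis
      proof (rule gronwall_nonpos[OF True, of q q' "2 * C * n"])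
        fix x assume x: "x \<in> {t0..t}"
        show "(q has_field_derivative q' x) (at x within {t0..t})" using q J x by blast
        show "q' x \<le> 2 * C * real n * q x" using bound[OF B[OF x]] by linarith
      qed (rule q0)
    next
      case False
      then have le: "- t0 \<le> - t" by simp
      have J: "{t..t0} \<subseteq> L" using connected_contains_Icc[OF F(1) _ t0(1)] t by blast
      have B: "x \<in> N f \<inter> N g" if "x \<in> {t..t0}" for x
        using \<delta>(2)[of x] J that t by (auto simp: dist_real_def)
      \<comment> \<open>Time is reversed: Gronwall's inequality runs forward from -t0 to -t for the
        reflected function. The bound on q' is two-sided, so it survives the change of sign.\<close>
      have "q (- (- t)) \<le> 0"
      proof (rule gronwall_nonpos[OF le, of "\<lambda>x. q (- x)" "\<lambda>x. - q' (- x)" "2 * C * n"])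
        fix x assume x: "x \<in> {- t0..- t}"
        then have mx: "- x \<in> {t..t0}" by auto
        have "(q has_field_derivative q' (- x)) (at (- x) within uminus ` {- t0..- t})"
          using q[of "- x" "{t..t0}"] J mx by auto
        moreover have "(uminus has_field_derivative - 1) (at x within {- t0..- t})"
          by (auto intro!: derivative_eq_intros)
        ultimately have "(q \<circ> uminus has_field_derivative q' (- x) * - 1) (at x within {- t0..- t})"
          by (rule DERIV_image_chain)
        then show "((\<lambda>x. q (- x)) has_field_derivative - q' (- x)) (at x within {- t0..- t})"
          by (simp add: comp_def)
        show "- q' (- x) \<le> 2 * C * real n * q (- x)" using bound[OF B[OF mx]] by linarith
      qed (simp add: q0)
      then show ?thesis by simp
    qed
    moreover have "0 \<le> q t" unfolding q_def by (intro sum_nonneg) simp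
    ultimately have "q t = 0" by simp
    then have "\<forall>i\<in>{..<n}. (f t (X i) - g t (X i))\<^sup>2 = 0"
      unfolding q_def by (subst (asm) sum_nonneg_eq_0_iff) auto
    then show "f t = g t" using t by (intro points_eqI F(5) G(5)) auto
  qed
  then show thesis using that[of "ball t0 \<delta>"] \<delta>(1) by simp
qed

text \<open>The set of agreement is relatively open by local uniqueness, and relatively closed
  because a disagreement shows in some generator, whose values are continuous in time. It contains
  0, and the interval is connected.\<close>

lemma trajectory_unique:
  assumes f: "trajectory p L f" and g: "trajectory p L g"
  shows "f = g"
proof -
  note F = trajectoryD[OF f] and G = trajectoryD[OF g]
  define E where "E = {t \<in> L. f t = g t}"
  have "openin (top_of_set L) E"
  proof (subst openin_subopen, rule ballI)
    fix t assume t: "t \<in> E"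
    obtain S where S: "open S" "t \<in> S" "\<And>s. s \<in> L \<inter> S \<Longrightarrow> f s = g s"
      by (rule trajectory_locally_unique[OF f g, of t]) (use t in \<open>auto simp: E_def\<close>)
    then show "\<exists>T. openin (top_of_set L) T \<and> t \<in> T \<and> T \<subseteq> E"
      using t by (intro exI[of _ "L \<inter> S"]) (auto simp: E_def openin_open)
  qed
  moreover have "openin (top_of_set L) (L - E)"
  proof (subst openin_subopen, rule ballI)
    fix t assume t: "t \<in> L - E"
    then have "f t \<noteq> g t" by (simp add: E_def)
    then obtain i where i: "i < n" "f t (X i) \<noteq> g t (X i)" using points_eqI[OF F(5) G(5)] t by blast
    have "continuous_on L (\<lambda>t. f t (X i) - g t (X i))"
      by (intro continuous_intros smooth_on_set_continuous_on F(6) G(6) X_closed i)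
    then have "openin (top_of_set L) (L \<inter> (\<lambda>t. f t (X i) - g t (X i)) -` (- {0}))"
      by (rule continuous_openin_preimage_gen) auto
    then show "\<exists>T. openin (top_of_set L) T \<and> t \<in> T \<and> T \<subseteq> L - E"
      using t i by (intro exI[of _ "L \<inter> (\<lambda>t. f t (X i) - g t (X i)) -` (- {0})"]) (auto simp: E_def)
  qed
  then have "closedin (top_of_set L) E" by (simp add: closedin_def E_def)
  moreover have "0 \<in> E" using F(2,4) G(4) by (simp add: E_def)
  ultimately have "E = L" using F(1) unfolding connected_clopen by blast
  then have "f t = g t" if "t \<in> L" for t using that by (auto simp: E_def)
  then show ?thesis by (intro PiE_ext[OF F(3) G(3)])
qed

lemma trajectory_subset:
  assumes f: "trajectory p L f" and L': "L' \<subseteq> L" "connected L'" "0 \<in> L'"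
  shows "trajectory p L' (restrict f L')"
proof -
  note F = trajectoryD[OF f]
  have "smooth_on_set L' (\<lambda>t. restrict f L' t a)" if "a \<in> carrier A" for a
    by (rule smooth_on_set_cong[OF smooth_on_set_subset[OF F(6)[OF that] L'(1)]]) simp
  moreover have "((\<lambda>s. restrict f L' s a) has_field_derivative velocity a (restrict f L' t)) (at t within L')"
    if t: "t \<in> L'" and a: "a \<in> carrier A" for t a
    using has_field_derivative_transfer[OF F(7)[OF _ a], of t UNIV L' "\<lambda>s. restrict f L' s a"] t L'(1) by auto
  moreover have "restrict f L' \<in> L' \<rightarrow>\<^sub>E points A" unfolding restrict_PiE_iff using F(5) L'(1) by blast
  ultimately show ?thesis unfolding trajectory_def using L' F(4) by simp
qed

end


section \<open>Maximal trajectories and the flow\<close>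

text \<open>Different slices are not compared, in keeping with the coproduct topology, in which
  every slice is open. If p is outside the index set, the slice of an open U at p is empty and the
  condition is vacuous.\<close>

definition slicewise_smooth :: "('x \<times> real) set \<Rightarrow> ('x \<times> real \<Rightarrow> real) \<Rightarrow> bool"
  where "slicewise_smooth U h \<longleftrightarrow> (\<forall>p. smooth_on_set {t. (p, t) \<in> U} (\<lambda>t. h (p, t)))"

abbreviation "slice_topology K I \<equiv> sum_topology (\<lambda>p. top_of_set (K p)) I"
abbreviation "slice_space K I \<equiv> function_space (slice_topology K I) slicewise_smooth"

lemma openin_slice:
  assumes "openin (slice_topology K I) U" "(p, t) \<in> U"
  shows "openin (top_of_set (K p)) {t. (p, t) \<in> U}"
  using assms unfolding openin_sum_topology by blast

lemma function_sheaf_slices: "function_sheaf (slice_topology K I) slicewise_smooth"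
proof
  fix U and g :: "(nat \<Rightarrow> real) \<Rightarrow> real" and m and c :: "nat \<Rightarrow> _ \<Rightarrow> real"
  assume "g \<in> Cinf m" "\<And>i. i < m \<Longrightarrow> slicewise_smooth U (c i)"
  then show "slicewise_smooth U (\<lambda>w. g (\<lambda>i\<in>{..<m}. c i w))"
    unfolding slicewise_smooth_def by (intro allI smooth_on_set_compose) simp_all
next
  fix U and f h :: "'a \<times> real \<Rightarrow> real"
  assume f: "slicewise_smooth U f" and eq: "\<And>w. w \<in> U \<Longrightarrow> f w = h w"
  show "slicewise_smooth U h"
    unfolding slicewise_smooth_def
  proof
    fix p
    show "smooth_on_set {t. (p, t) \<in> U} (\<lambda>t. h (p, t))"
      by (rule smooth_on_set_cong[OF f[unfolded slicewise_smooth_def, rule_format]]) (use eq in simp)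
  qed
next
  fix U V and f :: "'a \<times> real \<Rightarrow> real"
  assume f: "slicewise_smooth U f" and V: "V \<subseteq> U"
  show "slicewise_smooth V f"
    unfolding slicewise_smooth_def
  proof
    fix p
    show "smooth_on_set {t. (p, t) \<in> V} (\<lambda>t. f (p, t))"
      by (rule smooth_on_set_subset[OF f[unfolded slicewise_smooth_def, rule_format]]) (use V in blast)
  qed
next
  fix U and f :: "'a \<times> real \<Rightarrow> real"
  assume l: "\<And>w. w \<in> U \<Longrightarrow> \<exists>V. openin (slice_topology K I) V \<and> w \<in> V \<and> V \<subseteq> U \<and> slicewise_smooth V f"
  show "slicewise_smooth U f"
    unfolding slicewise_smooth_def
  proof (intro allI smooth_on_set_local)
    fix p t assume "t \<in> {t. (p, t) \<in> U}"
    then have "(p, t) \<in> U" by simp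
    then obtain V where V: "openin (slice_topology K I) V" "(p, t) \<in> V" "slicewise_smooth V f" using l by blast
    obtain S where S: "open S" "{t. (p, t) \<in> V} = K p \<inter> S" using openin_slice[OF V(1,2)] by (auto simp: openin_open)
    have UK: "{t. (p, t) \<in> U} \<subseteq> K p"
    proof
      fix t' assume "t' \<in> {t. (p, t) \<in> U}"
      then obtain V' where V': "openin (slice_topology K I) V'" "(p, t') \<in> V'" using l by blast
      then have "(p, t') \<in> topspace (slice_topology K I)" using openin_subset by blast
      then show "t' \<in> K p" by simp
    qed
    have "smooth_on_set ({t. (p, t) \<in> U} \<inter> S) (\<lambda>t. f (p, t))"
      by (rule smooth_on_set_subset[OF V(3)[unfolded slicewise_smooth_def, rule_format, of p]]) (use UK S in blast)
    moreover have "t \<in> S" using V(2) S(2) by blast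
    ultimately show "\<exists>S. open S \<and> t \<in> S \<and> smooth_on_set ({t. (p, t) \<in> U} \<inter> S) (\<lambda>t. f (p, t))" using S(1) by blast
  qed
next
  fix U and f :: "'a \<times> real \<Rightarrow> real"
  assume U: "openin (slice_topology K I) U" and f: "slicewise_smooth U f"
  have "openin (top_of_set (K p)) {t. (p, t) \<in> {w \<in> U. f w \<noteq> 0}}" if p: "p \<in> I" for p
  proof -
    have "openin (top_of_set (K p)) {t. (p, t) \<in> U}" using U p unfolding openin_sum_topology by blast
    from function_sheaf.P_nonzero[OF function_sheaf_interval this f[unfolded slicewise_smooth_def, rule_format, of p]]
    show ?thesis by simp
  qed
  moreover have "{w \<in> U. f w \<noteq> 0} \<subseteq> Sigma I (topspace \<circ> (\<lambda>p. top_of_set (K p)))"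
    using U unfolding openin_sum_topology by blast
  ultimately show "openin (slice_topology K I) {w \<in> U. f w \<noteq> 0}" unfolding openin_sum_topology by blast
qed

definition slice_incl ::
    "('x \<Rightarrow> real set) \<Rightarrow> 'x set \<Rightarrow> 'x \<Rightarrow> (real, real \<Rightarrow> real, 'x \<times> real, 'x \<times> real \<Rightarrow> real) cinf_space_map"
  where "slice_incl K I p = ((\<lambda>t\<in>K p. (p, t)),
    (\<lambda>U\<in>{U. openin (slice_topology K I) U}. \<lambda>h\<in>{h \<in> extensional U. slicewise_smooth U h}.
      \<lambda>t\<in>{t. (p, t) \<in> U}. h (p, t)))"

text \<open>An open U meets the slice of p in a relatively open subset of \<open>K p\<close>, so its
  preimage is the set of t with (p, t) in U, and pulling back is restriction to the slice.\<close>

lemma slice_incl_space_map: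
  assumes p: "p \<in> I"
  shows "space_map (interval_space (K p)) (slice_space K I) (slice_incl K I p)"
proof -
  interpret J: function_sheaf "top_of_set (K p)" smooth_on_set by (rule function_sheaf_interval)
  interpret W: function_sheaf "slice_topology K I" slicewise_smooth by (rule function_sheaf_slices)
  let ?\<zeta> = "slice_incl K I p"
  have slice: "openin (top_of_set (K p)) {t. (p, t) \<in> U}" if "openin (slice_topology K I) U" for U
    using that p unfolding openin_sum_topology by blast
  have pre: "preim J.X ?\<zeta> U = {t. (p, t) \<in> U}" if "openin (slice_topology K I) U" for U
    using openin_imp_subset[OF slice[OF that]] by (auto simp: preim_def slice_incl_def)
  have smooth: "(\<lambda>t\<in>{t. (p, t) \<in> U}. h (p, t)) \<in> J.S {t. (p, t) \<in> U}" if "h \<in> W.S U" for U h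
  proof -
    have "smooth_on_set {t. (p, t) \<in> U} (\<lambda>t. h (p, t))" using that by (simp add: slicewise_smooth_def)
    then have "smooth_on_set {t. (p, t) \<in> U} (\<lambda>t\<in>{t. (p, t) \<in> U}. h (p, t))"
      by (rule smooth_on_set_cong) (rule restrict_apply'[symmetric])
    then show ?thesis by simp
  qed
  have snd: "snd ?\<zeta> U h = (\<lambda>t\<in>{t. (p, t) \<in> U}. h (p, t))" if "openin (slice_topology K I) U" "h \<in> W.S U" for U h
    using that by (simp add: slice_incl_def)
  have "continuous_map (top_of_set (K p)) (slice_topology K I) (\<lambda>t\<in>K p. (p, t))"
    unfolding continuous_map_def
  proof (intro conjI allI impI)
    fix U assume U: "openin (slice_topology K I) U"
    have "{t \<in> topspace (top_of_set (K p)). (\<lambda>t\<in>K p. (p, t)) t \<in> U} = {t. (p, t) \<in> U}"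
      using openin_imp_subset[OF slice[OF U]] by auto
    then show "openin (top_of_set (K p)) {t \<in> topspace (top_of_set (K p)). (\<lambda>t\<in>K p. (p, t)) t \<in> U}"
      using slice[OF U] by simp
  qed (use p in auto)
  moreover have "snd ?\<zeta> U \<in> cinf_hom (sections W.X U) (sections J.X (preim J.X ?\<zeta> U))"
    if U: "openin (slice_topology K I) U" for U
    unfolding cinf_hom_def pre[OF U]
  proof (intro CollectI conjI allI ballI)
    show "snd ?\<zeta> U \<in> carrier (sections W.X U) \<rightarrow>\<^sub>E carrier (sections J.X {t. (p, t) \<in> U})"
    proof (rule PiE_I)
      fix h assume "h \<in> carrier (sections W.X U)"
      then have h: "h \<in> W.S U" by simp
      show "snd ?\<zeta> U h \<in> carrier (sections J.X {t. (p, t) \<in> U})"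
        unfolding snd[OF U h] J.X_simps by (rule smooth[OF h])
    next
      fix h assume "h \<notin> carrier (sections W.X U)"
      then have "h \<notin> W.S U" by simp
      with U show "snd ?\<zeta> U h = undefined"
        unfolding slice_incl_def by (simp only: snd_conv restrict_apply mem_Collect_eq if_True if_False)
    qed
    fix m g c assume g: "g \<in> Cinf m" and c: "c \<in> tuples m (carrier (sections W.X U))"
    then have c': "c \<in> tuples m (W.S U)" by simp
    then have ci: "c i \<in> W.S U" if "i < m" for i using that by auto
    have "snd ?\<zeta> U (cop (sections W.X U) m g c) =
        (\<lambda>t\<in>{t. (p, t) \<in> U}. (\<lambda>w\<in>U. g (\<lambda>i\<in>{..<m}. c i w)) (p, t))"
      unfolding W.X_simps by (rule snd[OF U W.cop_S[OF U g c']])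
    also have "\<dots> = (\<lambda>t\<in>{t. (p, t) \<in> U}. g (\<lambda>i\<in>{..<m}. (\<lambda>i\<in>{..<m}. snd ?\<zeta> U (c i)) i t))"
    proof (rule restrict_ext)
      fix t assume t: "t \<in> {t. (p, t) \<in> U}"
      have "(\<lambda>i\<in>{..<m}. c i (p, t)) = (\<lambda>i\<in>{..<m}. (\<lambda>i\<in>{..<m}. snd ?\<zeta> U (c i)) i t)"
        by (rule restrict_ext) (use t snd[OF U ci] in simp)
      then show "(\<lambda>w\<in>U. g (\<lambda>i\<in>{..<m}. c i w)) (p, t) = g (\<lambda>i\<in>{..<m}. (\<lambda>i\<in>{..<m}. snd ?\<zeta> U (c i)) i t)"
        using t by simp
    qed
    finally show "snd ?\<zeta> U (cop (sections W.X U) m g c) =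
        cop (sections J.X {t. (p, t) \<in> U}) m g (\<lambda>i\<in>{..<m}. snd ?\<zeta> U (c i))" by simp
  qed
  moreover have "restr J.X (preim J.X ?\<zeta> U) (preim J.X ?\<zeta> V) (snd ?\<zeta> U s) = snd ?\<zeta> V (restr W.X U V s)"
    if U: "openin (slice_topology K I) U" and V: "openin (slice_topology K I) V" "V \<subseteq> U" and s: "s \<in> W.S U"
    for U V s
  proof -
    have "restr J.X (preim J.X ?\<zeta> U) (preim J.X ?\<zeta> V) (snd ?\<zeta> U s) =
        restrict (\<lambda>t\<in>{t. (p, t) \<in> U}. s (p, t)) {t. (p, t) \<in> V}"
      unfolding pre[OF U] pre[OF V(1)] snd[OF U s] by (rule J.restr_X[OF smooth[OF s]])
    also have "\<dots> = (\<lambda>t\<in>{t. (p, t) \<in> V}. restrict s V (p, t))" using V(2) by (auto simp: fun_eq_iff)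
    also have "\<dots> = snd ?\<zeta> V (restrict s V)" by (rule snd[OF V(1) W.restrict_S[OF s V(2)], symmetric])
    finally show ?thesis using s by (simp only: W.restr_X)
  qed
  ultimately show ?thesis
    unfolding space_map_def interval_space_eq J.X_simps(1) W.X_simps(1,2) by (simp add: slice_incl_def)
qed

section \<open>Joining and extending trajectories\<close>

context fg_spec_vector_field
begin

text \<open>Both numbers are derivatives of G within L. They coincide because L, an interval with
  more than one point, has no isolated points.\<close>

lemma trajectory_smooth_deriv:
  assumes f: "trajectory p L f" "L \<noteq> {0}" and a: "a \<in> carrier A" and V: "open V" "smooth_on_open V G"
    and eq: "\<forall>t\<in>L \<inter> V. f t a = G t" and t: "t \<in> L \<inter> V"
  shows "deriv G t = velocity a (f t)"
proof -
  note F = trajectoryD[OF f(1)]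
  have tL: "t \<in> L" and tV: "t \<in> V" using t by auto
  have "(G has_field_derivative velocity a (f t)) (at t within L)"
    by (rule has_field_derivative_transfer[OF F(7)[OF tL a] V(1) tV tL]) (use eq in auto)
  moreover have "(G has_field_derivative deriv G t) (at t within L)"
    using smooth_on_open_has_deriv[OF V(2) tV] by (rule has_field_derivative_at_within)
  ultimately show ?thesis
    using has_field_derivative_within_unique[OF _ _ islimpt_interval[OF F(1,2) f(2) tL]] by blast
qed

text \<open>Near \<open>p\<close> the derivative of \<open>a\<close> along a trajectory is the value of another element of the ring, so all
  one-sided derivatives at \<open>0\<close> depend only on \<open>p\<close>.\<close>

lemma one_sided_derivatives_agree:
  assumes f: "trajectory p L f" "L \<noteq> {0}" and g: "trajectory p M g" "M \<noteq> {0}"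
  shows "\<forall>a V G H. a \<in> carrier A \<longrightarrow> open V \<longrightarrow> 0 \<in> V \<longrightarrow> smooth_on_open V G \<longrightarrow> smooth_on_open V H \<longrightarrow>
    (\<forall>t\<in>L \<inter> V. f t a = G t) \<longrightarrow> (\<forall>t\<in>M \<inter> V. g t a = H t) \<longrightarrow> (deriv ^^ k) G 0 = (deriv ^^ k) H 0"
proof (induction k)
  case 0
  show ?case
  proof (intro allI impI)
    fix a V G H
    assume "0 \<in> V" "\<forall>t\<in>L \<inter> V. f t a = G t" "\<forall>t\<in>M \<inter> V. g t a = H t"
    then have "f 0 a = G 0" "g 0 a = H 0" using trajectoryD(2)[OF f(1)] trajectoryD(2)[OF g(1)] by blast+
    then show "(deriv ^^ 0) G 0 = (deriv ^^ 0) H 0"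
      using trajectoryD(4)[OF f(1)] trajectoryD(4)[OF g(1)] by simp
  qed
next
  case (Suc k)
  show ?case
  proof (intro allI impI)
    fix a V G H
    assume a: "a \<in> carrier A" and V: "open V" "0 \<in> V" and G: "smooth_on_open V G" and H: "smooth_on_open V H"
      and eq: "\<forall>t\<in>L \<inter> V. f t a = G t" "\<forall>t\<in>M \<inter> V. g t a = H t"
    have p: "p \<in> points A" using trajectoryD(2,4,5)[OF f(1)] by blast
    obtain U b where U: "openin (spec_top A) U" "p \<in> U" and b: "b \<in> carrier A"
      and vel: "\<And>z. z \<in> U \<Longrightarrow> velocity a z = z b" by (rule velocity_local[OF a p]) blast
    obtain S where S: "open S" "{t \<in> L. f t \<in> U} = L \<inter> S" by (rule trajectory_preimage[OF f(1) U(1)])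
    obtain S' where S': "open S'" "{t \<in> M. g t \<in> U} = M \<inter> S'" by (rule trajectory_preimage[OF g(1) U(1)])
    have "0 \<in> {t \<in> L. f t \<in> U}" "0 \<in> {t \<in> M. g t \<in> U}"
      using trajectoryD(2,4)[OF f(1)] trajectoryD(2,4)[OF g(1)] U(2) by auto
    then have 0: "0 \<in> S" "0 \<in> S'" unfolding S(2) S'(2) by auto
    \<comment> \<open>At times in \<open>?V\<close> both curves lie where b represents the velocity
      of a, so \<open>deriv G\<close> and \<open>deriv H\<close> extend the values of b along them
      and the induction hypothesis applies to b.\<close>
    let ?V = "V \<inter> S \<inter> S'"
    have "\<forall>t\<in>L \<inter> ?V. f t b = deriv G t"
    proof
      fix t assume t: "t \<in> L \<inter> ?V"
      then have "t \<in> {t \<in> L. f t \<in> U}" unfolding S(2) by blast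
      then show "f t b = deriv G t" using trajectory_smooth_deriv[OF f a V(1) G eq(1), of t] t vel by simp
    qed
    moreover have "\<forall>t\<in>M \<inter> ?V. g t b = deriv H t"
    proof
      fix t assume t: "t \<in> M \<inter> ?V"
      then have "t \<in> {t \<in> M. g t \<in> U}" unfolding S'(2) by blast
      then show "g t b = deriv H t" using trajectory_smooth_deriv[OF g a V(1) H eq(2), of t] t vel by simp
    qed
    moreover have "smooth_on_open ?V (deriv G)" "smooth_on_open ?V (deriv H)"
      by (rule smooth_on_open_subset[OF smooth_on_open_deriv[OF G]], blast)
        (rule smooth_on_open_subset[OF smooth_on_open_deriv[OF H]], blast)
    moreover have "open ?V" "0 \<in> ?V" using V S(1) S'(1) 0 by auto
    ultimately show "(deriv ^^ Suc k) G 0 = (deriv ^^ Suc k) H 0"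
      unfolding deriv_funpow_shift using Suc[rule_format, OF b] by blast
  qed
qed

lemma trajectory_local_extension:
  assumes "trajectory p L f" "a \<in> carrier A" "t \<in> L"
  obtains V G where "open V" "t \<in> V" "smooth_on_open V G" "\<forall>s\<in>L \<inter> V. f s a = G s"
  using trajectoryD(6)[OF assms(1,2)] assms(3) unfolding smooth_on_set_iff by blast

text \<open>Membership, smoothness and the derivative are conditions near each t, where h coincides
  with a known trajectory; \<open>K \<inter> S \<subseteq> L\<close> ensures that this trajectory is
  defined wherever h is. It is applied to the union of all trajectories.\<close>

lemma trajectory_localI:
  assumes K: "connected K" "0 \<in> K" "h \<in> extensional K" "h 0 = p"
    and l: "\<And>t. t \<in> K \<Longrightarrow> \<exists>L f S. trajectory p L f \<and> open S \<and> t \<in> S \<and> K \<inter> S \<subseteq> L \<and> (\<forall>s\<in>K \<inter> S. h s = f s)"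
  shows "trajectory p K h"
  unfolding trajectory_def
proof (intro conjI ballI K(1,2,4))
  have "h t \<in> points A" if t: "t \<in> K" for t
  proof -
    obtain L f S where "trajectory p L f" "t \<in> S" "K \<inter> S \<subseteq> L" "\<forall>s\<in>K \<inter> S. h s = f s" using l[OF t] by blast
    then show ?thesis using trajectoryD(5)[of p L f t] t by auto
  qed
  then show "h \<in> K \<rightarrow>\<^sub>E points A" using K(3) by (simp add: PiE_iff)
  fix a assume a: "a \<in> carrier A"
  show "smooth_on_set K (\<lambda>t. h t a)"
  proof (rule smooth_on_set_local)
    fix t assume "t \<in> K"
    then obtain L f S where f: "trajectory p L f" and S: "open S" "t \<in> S" "K \<inter> S \<subseteq> L" "\<forall>s\<in>K \<inter> S. h s = f s"
      using l by blast
    have "smooth_on_set (K \<inter> S) (\<lambda>t. f t a)" by (rule smooth_on_set_subset[OF trajectoryD(6)[OF f a] S(3)])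
    then have "smooth_on_set (K \<inter> S) (\<lambda>t. h t a)" by (rule smooth_on_set_cong) (use S(4) in simp)
    then show "\<exists>S. open S \<and> t \<in> S \<and> smooth_on_set (K \<inter> S) (\<lambda>t. h t a)" using S by blast
  qed
next
  fix t a assume t: "t \<in> K" and a: "a \<in> carrier A"
  obtain L f S where f: "trajectory p L f" and S: "open S" "t \<in> S" "K \<inter> S \<subseteq> L" "\<forall>s\<in>K \<inter> S. h s = f s"
    using l[OF t] by blast
  have "t \<in> L" "h t = f t" using S t by auto
  then show "((\<lambda>s. h s a) has_field_derivative velocity a (h t)) (at t within K)"
    using has_field_derivative_transfer[OF trajectoryD(7)[OF f _ a] S(1,2) t S(3), of "\<lambda>s. h s a"] S(4) by simp
qed

text \<open>The two halves may fail to extend past 0 as curves of points, but the values of each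
  ring element along them extend smoothly as real functions. These extensions have equal derivatives
  of all orders at 0, and gluing them gives a smooth extension for the joined curve.\<close>

lemma trajectory_join:
  assumes f: "trajectory p {0..b} f" "0 < b" and g: "trajectory p {c..0} g" "c < 0"
  shows "\<exists>h. trajectory p {c..b} h"
proof -
  define h where "h = (\<lambda>t\<in>{c..b}. if 0 \<le> t then f t else g t)"
  have ne: "{0..b} \<noteq> {0}" "{c..0} \<noteq> {0}" using f(2) g(2) by (auto simp: set_eq_iff intro: exI[of _ b] exI[of _ c])
  have fp: "f 0 = p" and gp: "g 0 = p" using trajectoryD(4)[OF f(1)] trajectoryD(4)[OF g(1)] .
  have z: "0 \<in> {0..b}" "0 \<in> {c..0}" using f(2) g(2) by auto
  have hf: "h t = f t" if "t \<in> {0..b}" for t using that g(2) by (simp add: h_def)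
  \<comment> \<open>At t = 0 the definition of h takes the value of f; both halves start at p, so
    this is also the value of g.\<close>
  have hg: "h t = g t" if "t \<in> {c..0}" for t using that f(2) fp gp by (auto simp: h_def)
  have glue: "\<exists>V G. open V \<and> 0 \<in> V \<and> smooth_on_open V G \<and> (\<forall>s\<in>{c..b} \<inter> V. h s a = G s)" if a: "a \<in> carrier A" for a
  proof -
    obtain V G where V: "open V" "0 \<in> V" "smooth_on_open V G" "\<forall>s\<in>{0..b} \<inter> V. f s a = G s"
      by (rule trajectory_local_extension[OF f(1) a z(1)]) blast
    obtain W H where W: "open W" "0 \<in> W" "smooth_on_open W H" "\<forall>s\<in>{c..0} \<inter> W. g s a = H s"
      by (rule trajectory_local_extension[OF g(1) a z(2)]) blast
    let ?U = "V \<inter> W" and ?G = "\<lambda>t. if 0 \<le> t then G t else H t"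
    have U: "open ?U" "0 \<in> ?U" using V W by auto
    have G: "smooth_on_open ?U G" and H: "smooth_on_open ?U H"
      by (rule smooth_on_open_subset[OF V(3)], blast) (rule smooth_on_open_subset[OF W(3)], blast)
    have eqG: "\<forall>t\<in>{0..b} \<inter> ?U. f t a = G t" and eqH: "\<forall>t\<in>{c..0} \<inter> ?U. g t a = H t" using V(4) W(4) by auto
    have "(deriv ^^ k) G 0 = (deriv ^^ k) H 0" for k
      using one_sided_derivatives_agree[OF f(1) ne(1) g(1) ne(2), rule_format, OF a U G H] eqG eqH by blast
    then have "smooth_on_open ?U ?G" by (rule smooth_on_open_glue[OF U(1) G H])
    moreover have "\<forall>s\<in>{c..b} \<inter> ?U. h s a = ?G s" using eqG eqH hf hg by auto
    ultimately show ?thesis using U by blast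
  qed
  have "trajectory p {c..b} h"
    unfolding trajectory_def
  proof (intro conjI ballI)
    show "connected {c..b}" "0 \<in> {c..b}" "h 0 = p" using f(2) g(2) fp by (auto simp: h_def)
    show "h \<in> {c..b} \<rightarrow>\<^sub>E points A"
      unfolding h_def restrict_PiE_iff using trajectoryD(5)[OF f(1)] trajectoryD(5)[OF g(1)] by auto
    fix a assume a: "a \<in> carrier A"
    show "smooth_on_set {c..b} (\<lambda>t. h t a)"
    proof (rule smooth_on_set_local)
      fix t assume t: "t \<in> {c..b}"
      consider "t = 0" | "0 < t" | "t < 0" by linarith
      then show "\<exists>S. open S \<and> t \<in> S \<and> smooth_on_set ({c..b} \<inter> S) (\<lambda>t. h t a)"
      proof cases
        case 1
        obtain V G where V: "open V" "0 \<in> V" "smooth_on_open V G" "\<forall>s\<in>{c..b} \<inter> V. h s a = G s"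
          using glue[OF a] by blast
        have "smooth_on_set ({c..b} \<inter> V) (\<lambda>t. h t a)"
          unfolding smooth_on_set_iff using V by (intro ballI exI[of _ V] exI[of _ G]) auto
        then show ?thesis using V 1 by blast
      next
        case 2
        have "smooth_on_set ({c..b} \<inter> {0<..}) (\<lambda>t. f t a)"
          by (rule smooth_on_set_subset[OF trajectoryD(6)[OF f(1) a]]) auto
        then have "smooth_on_set ({c..b} \<inter> {0<..}) (\<lambda>t. h t a)" by (rule smooth_on_set_cong) (simp add: hf)
        then show ?thesis using 2 by (intro exI[of _ "{0<..}"]) simp
      next
        case 3
        have "smooth_on_set ({c..b} \<inter> {..<0}) (\<lambda>t. g t a)"
          by (rule smooth_on_set_subset[OF trajectoryD(6)[OF g(1) a]]) auto
        then have "smooth_on_set ({c..b} \<inter> {..<0}) (\<lambda>t. h t a)" by (rule smooth_on_set_cong) (simp add: hg)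
        then show ?thesis using 3 by (intro exI[of _ "{..<0}"]) simp
      qed
    qed
  next
    fix t a assume t: "t \<in> {c..b}" and a: "a \<in> carrier A"
    consider "t = 0" | "0 < t" | "t < 0" by linarith
    then show "((\<lambda>s. h s a) has_field_derivative velocity a (h t)) (at t within {c..b})"
    proof cases
      case 1
      obtain V G where V: "open V" "0 \<in> V" "smooth_on_open V G" "\<forall>s\<in>{c..b} \<inter> V. h s a = G s"
        using glue[OF a] by blast
      \<comment> \<open>The extension G for h also extends the values along the right half f, so its
        derivative at 0 is the velocity at p.\<close>
      have "\<forall>s\<in>{0..b} \<inter> V. f s a = G s"
      proof
        fix s assume s: "s \<in> {0..b} \<inter> V"
        then have "h s a = G s" using V(4) g(2) by simp
        then show "f s a = G s" using hf[of s] s by simp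
      qed
      from trajectory_smooth_deriv[OF f(1) ne(1) a V(1,3) this, of 0]
      have "deriv G 0 = velocity a p" using V(2) f(2) fp by simp
      then have "(G has_field_derivative velocity a p) (at 0 within {c..b})"
        using smooth_on_open_has_deriv[OF V(3,2)] has_field_derivative_at_within by metis
      then have "((\<lambda>s. h s a) has_field_derivative velocity a p) (at 0 within {c..b})"
        by (rule has_field_derivative_transfer[OF _ V(1,2)]) (use V(4) f(2) g(2) in auto)
      moreover have "h 0 = p" using f(2) hf fp by simp
      ultimately show ?thesis using 1 by simp
    next
      case 2
      then have t': "t \<in> {0..b}" using t by simp
      show ?thesis unfolding hf[OF t']
        by (rule has_field_derivative_transfer[OF trajectoryD(7)[OF f(1) t' a], of "{0<..}"]) (use t 2 hf in auto)
    next
      case 3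
      then have t': "t \<in> {c..0}" using t by simp
      show ?thesis unfolding hg[OF t']
        by (rule has_field_derivative_transfer[OF trajectoryD(7)[OF g(1) t' a], of "{..<0}"]) (use t 3 hg in auto)
    qed
  qed
  then show ?thesis by blast
qed

lemma trajectory_trivial:
  assumes "p \<in> points A"
  shows "trajectory p {0} (\<lambda>t\<in>{0}. p)"
  unfolding trajectory_def
proof (intro conjI ballI)
  fix a assume "a \<in> carrier A"
  have "smooth_on_open UNIV (\<lambda>_. p a)"
    unfolding smooth_on_open_iff by (intro allI differentiable_upto_const)
  then show "smooth_on_set {0} (\<lambda>t. (\<lambda>t\<in>{0}. p) t a)"
    unfolding smooth_on_set_iff by (intro ballI exI[of _ UNIV] exI[of _ "\<lambda>_. p a"]) auto
next
  fix t a assume t: "t \<in> {0::real}" and a: "a \<in> carrier A"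
  then have "at t within {0} = bot" by (simp add: trivial_limit_within islimpt_finite)
  then show "((\<lambda>s. (\<lambda>t\<in>{0}. p) s a) has_field_derivative velocity a ((\<lambda>t\<in>{0}. p) t)) (at t within {0})"
    by (simp add: has_field_derivative_iff)
qed (use assms in auto)

text \<open>Two trajectories agree on the intersection of their domains, which is again an interval,
  so their union F is well defined. The work lies in showing that F is a trajectory near each time
  of K, its ends and 0 included.\<close>

lemma maximal_trajectory:
  assumes p: "p \<in> points A"
  obtains K F where "trajectory p K F" "\<And>L f. trajectory p L f \<Longrightarrow> L \<subseteq> K \<and> f = restrict F L"
proof -
  define \<L> where "\<L> = {L. \<exists>f. trajectory p L f}"
  define K where "K = \<Union>\<L>"
  define F where "F = (\<lambda>t\<in>K. SOME y. \<exists>L f. trajectory p L f \<and> t \<in> L \<and> y = f t)"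
  have sub: "L \<subseteq> K" if "trajectory p L f" for L f using that by (auto simp: K_def \<L>_def)
  have eq: "F t = f t" if f: "trajectory p L f" and t: "t \<in> L" for L f t
  proof -
    have "\<exists>L g. trajectory p L g \<and> t \<in> L \<and> F t = g t"
      using sub[OF f] t f someI[of "\<lambda>y. \<exists>L f. trajectory p L f \<and> t \<in> L \<and> y = f t" "f t"] by (auto simp: F_def)
    then obtain M g where g: "trajectory p M g" "t \<in> M" "F t = g t" by blast
    have LM: "connected (L \<inter> M)" "0 \<in> L \<inter> M"
      using trajectoryD(1,2)[OF f] trajectoryD(1,2)[OF g(1)]
      by (simp_all add: is_interval_connected_1[symmetric] is_interval_Int)
    have "restrict f (L \<inter> M) = restrict g (L \<inter> M)"
      by (rule trajectory_unique[OF trajectory_subset[OF f _ LM] trajectory_subset[OF g(1) _ LM]]) auto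
    from fun_cong[OF this, of t] show ?thesis using t g by simp
  qed
  have triv: "trajectory p {0} (\<lambda>t\<in>{0}. p)" by (rule trajectory_trivial[OF p])
  have K0: "0 \<in> K" using sub[OF triv] by simp
  have F0: "F 0 = p" using eq[OF triv, of 0] by simp
  have conn: "connected K"
    unfolding K_def
  proof (rule connected_Union)
    have "0 \<in> \<Inter>\<L>" using trajectoryD(2) by (auto simp: \<L>_def)
    then show "\<Inter>\<L> \<noteq> {}" by blast
  qed (use trajectoryD(1) in \<open>auto simp: \<L>_def\<close>)
  \<comment> \<open>Every compact interval in K around 0 carries a single trajectory: its forward
    and backward pieces may come from different curves and are joined at 0.\<close>
  have closed: "\<exists>h. trajectory p {s..r} h" if s: "s \<in> K" "s \<le> 0" and r: "r \<in> K" "0 \<le> r" for s r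
  proof -
    obtain L f where f: "trajectory p L f" "r \<in> L" using r(1) by (auto simp: K_def \<L>_def)
    obtain M g where g: "trajectory p M g" "s \<in> M" using s(1) by (auto simp: K_def \<L>_def)
    have "{0..r} \<subseteq> L" using connected_contains_Icc[OF trajectoryD(1,2)[OF f(1)] f(2)] .
    then have f': "trajectory p {0..r} (restrict f {0..r})" by (rule trajectory_subset[OF f(1)]) (use r in auto)
    have "{s..0} \<subseteq> M" using connected_contains_Icc[OF trajectoryD(1)[OF g(1)] g(2) trajectoryD(2)[OF g(1)]] .
    then have g': "trajectory p {s..0} (restrict g {s..0})" by (rule trajectory_subset[OF g(1)]) (use s in auto)
    show ?thesis
    proof (cases "s = 0 \<or> r = 0")
      case True
      then show ?thesis using f' g' by blast
    next
      case False
      then show ?thesis using trajectory_join[OF f' _ g'] s r by auto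
    qed
  qed
  have "trajectory p K F"
  proof (rule trajectory_localI[where K = K and h = F and p = p])
    show "connected K" "0 \<in> K" "F 0 = p" by (rule conn K0 F0)+
    show "F \<in> extensional K" by (simp add: F_def)
    fix t assume t: "t \<in> K"
    \<comment> \<open>If K contains a later time r, the times before r are a neighbourhood of t; if
      t is the last time of K, then t itself can be the right end. The maximum with 0 keeps 0 in the
      interval.\<close>
    have "\<exists>r S. r \<in> K \<and> 0 \<le> r \<and> open S \<and> t \<in> S \<and> K \<inter> S \<subseteq> {..r}"
    proof (cases "\<exists>r\<in>K. t < r")
      case True
      then obtain r where r: "r \<in> K" "t < r" by blast
      have "max r 0 \<in> K" using r K0 by (simp add: max_def)
      then show ?thesis using r by (intro exI[of _ "max r 0"] exI[of _ "{..<r}"]) auto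
    next
      case False
      have "max t 0 \<in> K" using t K0 by (simp add: max_def)
      then show ?thesis using False by (intro exI[of _ "max t 0"] exI[of _ UNIV]) (auto simp: not_less intro: max.coboundedI1)
    qed
    then obtain r S where r: "r \<in> K" "0 \<le> r" "open S" "t \<in> S" "K \<inter> S \<subseteq> {..r}" by blast
    have "\<exists>s S. s \<in> K \<and> s \<le> 0 \<and> open S \<and> t \<in> S \<and> K \<inter> S \<subseteq> {s..}"
    proof (cases "\<exists>s\<in>K. s < t")
      case True
      then obtain s where s: "s \<in> K" "s < t" by blast
      have "min s 0 \<in> K" using s K0 by (simp add: min_def)
      then show ?thesis using s by (intro exI[of _ "min s 0"] exI[of _ "{s<..}"]) auto
    next
      case False
      have "min t 0 \<in> K" using t K0 by (simp add: min_def)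
      then show ?thesis using False by (intro exI[of _ "min t 0"] exI[of _ UNIV]) (auto simp: not_less intro: min.coboundedI1)
    qed
    then obtain s S' where s: "s \<in> K" "s \<le> 0" "open S'" "t \<in> S'" "K \<inter> S' \<subseteq> {s..}" by blast
    obtain h where h: "trajectory p {s..r} h" using closed[OF s(1,2) r(1,2)] by blast
    have "K \<inter> (S \<inter> S') \<subseteq> {s..r}" using r(5) s(5) by (auto simp: subset_iff)
    then show "\<exists>L f S. trajectory p L f \<and> open S \<and> t \<in> S \<and> K \<inter> S \<subseteq> L \<and> (\<forall>s\<in>K \<inter> S. F s = f s)"
      using h eq[OF h] r(3,4) s(3,4)
      by (intro exI[of _ "{s..r}"] exI[of _ h] exI[of _ "S \<inter> S'"]) auto
  qed
  moreover have "L \<subseteq> K \<and> f = restrict F L" if f: "trajectory p L f" for L f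
  proof -
    have "restrict F L = f"
      by (rule extensionalityI[of _ L]) (use trajectoryD(3)[OF f] eq[OF f] in \<open>auto simp: PiE_iff\<close>)
    then show ?thesis using sub[OF f] by simp
  qed
  ultimately show thesis by (rule that)
qed

section \<open>From maximal trajectories to the flow\<close>

lemma pullback_map_incl:
  assumes F: "trajectory p K F" and L: "L \<subseteq> K"
  shows "space_map_comp (interval_space L) (interval_space K) (Spec A) (pullback_map A K F) (interval_incl L K) =
    pullback_map A L (restrict F L)"
proof -
  interpret I: function_sheaf_over "top_of_set K" smooth_on_set A by (rule function_sheaf_over_interval)
  note T = trajectoryD[OF F]
  have "snd (interval_incl L K) (preim I.X (pullback_map A K F) U) (snd (pullback_map A K F) U s) =
      (\<lambda>t\<in>{t \<in> L. restrict F L t \<in> U}. coset_value (restrict F L t) (s (restrict F L t)))"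
    if U: "openin (spec_top A) U" and s: "s \<in> carrier (spec_sections A U)" for U s
  proof -
    let ?W = "{t \<in> K. F t \<in> U}"
    have W: "openin (top_of_set K) ?W"
      using openin_continuous_map_preimage[OF trajectory_continuous[OF F] U] by simp
    have "F \<in> topspace (top_of_set K) \<rightarrow> points A" using T(3) by auto
    from I.pullback_section[OF this _ s] T(6)
    have "(\<lambda>t\<in>?W. coset_value (F t) (s (F t))) \<in> carrier (interval_sections ?W)"
      by (simp add: interval_sections_def)
    then have "snd (interval_incl L K) ?W (\<lambda>t\<in>?W. coset_value (F t) (s (F t))) =
        restrict (\<lambda>t\<in>?W. coset_value (F t) (s (F t))) (L \<inter> ?W)"
      using W by (simp add: interval_incl_def)
    also have "\<dots> = (\<lambda>t\<in>{t \<in> L. restrict F L t \<in> U}. coset_value (restrict F L t) (s (restrict F L t)))"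
      using L by (auto simp: fun_eq_iff)
    finally show ?thesis unfolding snd_pullback_map[OF U s] I.preim_X fst_pullback_map by simp
  qed
  then show ?thesis
    unfolding space_map_comp_def pullback_map_def[of A L] interval_space_eq Spec_simps I.X_simps
    by (intro prod_eqI) (auto simp: interval_incl_def function_space_def intro!: restrict_ext)
qed

lemma maximal_integral_curve_trajectory:
  assumes F: "trajectory p K F" and max: "\<And>L f. trajectory p L f \<Longrightarrow> L \<subseteq> K \<and> f = restrict F L"
  shows "maximal_integral_curve (Spec A) v p K (pullback_map A K F)"
  unfolding maximal_integral_curve_def
proof (intro conjI allI impI)
  show "integral_curve (Spec A) v p K (pullback_map A K F)"
    unfolding integral_curve_iff using F by simp
  fix L \<nu> assume "integral_curve (Spec A) v p L \<nu>"
  then have \<nu>: "trajectory p L (fst \<nu>)" "\<nu> = pullback_map A L (fst \<nu>)" unfolding integral_curve_iff by blast+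
  from max[OF \<nu>(1)] have LK: "L \<subseteq> K" and eq: "restrict F L = fst \<nu>" by simp_all
  show "L \<subseteq> K" by (rule LK)
  show "\<nu> = space_map_comp (interval_space L) (interval_space K) (Spec A) (pullback_map A K F) (interval_incl L K)"
    unfolding pullback_map_incl[OF F LK] eq by (rule \<nu>(2))
qed

text \<open>Uniqueness concerns the domain together with the map: the domains of two maximal curves
  contain each other, and on a common domain the trajectory, hence the map, is unique.\<close>

lemma maximal_integral_curve_ex1:
  assumes p: "p \<in> points A"
  shows "\<exists>!K\<mu>. maximal_integral_curve (Spec A) v p (fst K\<mu>) (snd K\<mu>)"
proof -
  obtain K F where F: "trajectory p K F" "\<And>L f. trajectory p L f \<Longrightarrow> L \<subseteq> K \<and> f = restrict F L"
    by (rule maximal_trajectory[OF p]) blast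
  have max: "maximal_integral_curve (Spec A) v p K (pullback_map A K F)"
    by (rule maximal_integral_curve_trajectory[OF F])
  show ?thesis
  proof (rule ex1I[of _ "(K, pullback_map A K F)"])
    show "maximal_integral_curve (Spec A) v p (fst (K, pullback_map A K F)) (snd (K, pullback_map A K F))"
      using max by simp
    fix M assume M: "maximal_integral_curve (Spec A) v p (fst M) (snd M)"
    have i: "integral_curve (Spec A) v p (fst M) (snd M)" "integral_curve (Spec A) v p K (pullback_map A K F)"
      using M max unfolding maximal_integral_curve_def by simp_all
    have "K \<subseteq> fst M" using M i(2) unfolding maximal_integral_curve_def by blast
    moreover have "fst M \<subseteq> K" using max i(1) unfolding maximal_integral_curve_def by blast
    ultimately have KM: "fst M = K" by (rule subset_antisym[rotated])
    have t: "trajectory p K (fst (snd M))" "snd M = pullback_map A K (fst (snd M))"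
      using i(1) unfolding integral_curve_iff KM by blast+
    have "fst (snd M) = F" by (rule trajectory_unique[OF t(1) F(1)])
    with t(2) KM show "M = (K, pullback_map A K F)" by (intro prod_eqI) simp_all
  qed
qed

text \<open>The map of points sends (p, t) to the value at t of the maximal trajectory through p.
  Along every slice it is a trajectory, so ring elements pull back to slicewise smooth functions and
  it underlies a map of spaces; composed with the inclusion of a slice it gives back the maximal
  curve.\<close>

lemma flow_exists:
  "\<exists>(W :: (('a \<Rightarrow> real) \<times> real, (('a \<Rightarrow> real) \<times> real) \<Rightarrow> real) cinf_space) \<Phi>. is_flow (Spec A) v W \<Phi>"
proof -
  have "\<exists>KF. trajectory p (fst KF) (snd KF) \<and> (\<forall>L f. trajectory p L f \<longrightarrow> L \<subseteq> fst KF \<and> f = restrict (snd KF) L)"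
    if p: "p \<in> points A" for p
  proof -
    obtain K F where "trajectory p K F" "\<And>L f. trajectory p L f \<Longrightarrow> L \<subseteq> K \<and> f = restrict F L"
      by (rule maximal_trajectory[OF p]) blast
    then show ?thesis by (intro exI[of _ "(K, F)"]) simp
  qed
  then obtain KF where KF: "\<And>p. p \<in> points A \<Longrightarrow> trajectory p (fst (KF p)) (snd (KF p)) \<and>
      (\<forall>L f. trajectory p L f \<longrightarrow> L \<subseteq> fst (KF p) \<and> f = restrict (snd (KF p)) L)" by metis
  define K F where "K p = fst (KF p)" and "F p = snd (KF p)" for p
  have F: "trajectory p (K p) (F p)" if "p \<in> points A" for p using KF[OF that] by (simp add: K_def F_def)
  have max: "L \<subseteq> K p \<and> f = restrict (F p) L" if "p \<in> points A" "trajectory p L f" for p L f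
    using KF[OF that(1)] that(2) by (simp add: K_def F_def)
  let ?T = "slice_topology K (points A)"
  interpret W: function_sheaf_over ?T slicewise_smooth A
    by (intro function_sheaf_over.intro function_sheaf_slices cinf_ring_axioms)
  have top: "topspace ?T = (\<Union>p\<in>points A. {p} \<times> K p)" by auto
  define \<phi> where "\<phi> = (\<lambda>w\<in>topspace ?T. F (fst w) (snd w))"
  let ?\<Phi> = "pullback_map A (topspace ?T) \<phi>"
  have \<phi>: "\<phi> (p, t) = F p t" if "p \<in> points A" "t \<in> K p" for p t using that by (simp add: \<phi>_def)
  have \<phi>E: "\<phi> \<in> topspace ?T \<rightarrow>\<^sub>E points A"
    unfolding \<phi>_def restrict_PiE_iff using trajectoryD(5)[OF F] by auto
  have \<phi>S: "slicewise_smooth (topspace ?T) (\<lambda>w. \<phi> w a)" if a: "a \<in> carrier A" for a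
    unfolding slicewise_smooth_def
  proof
    fix p
    show "smooth_on_set {t. (p, t) \<in> topspace ?T} (\<lambda>t. \<phi> (p, t) a)"
    proof (cases "p \<in> points A")
      case True
      then have "{t. (p, t) \<in> topspace ?T} = K p" by auto
      moreover have "smooth_on_set (K p) (\<lambda>t. \<phi> (p, t) a)"
        by (rule smooth_on_set_cong[OF trajectoryD(6)[OF F[OF True] a]]) (simp add: \<phi>[OF True])
      ultimately show ?thesis by simp
    qed (simp add: smooth_on_set_def)
  qed
  have map: "space_map W.X (Spec A) ?\<Phi>" by (rule W.pullback_space_map[OF \<phi>E \<phi>S])
  have comp: "space_map_comp (interval_space (K p)) W.X (Spec A) ?\<Phi> (slice_incl K (points A) p) =
      pullback_map A (K p) (F p)" if p: "p \<in> points A" for p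
  proof -
    note T = trajectoryD[OF F[OF p]]
    have "(\<lambda>t\<in>K p. \<phi> ((\<lambda>t\<in>K p. (p, t)) t)) = F p"
      by (rule extensionalityI[of _ "K p"]) (use T(3) \<phi>[OF p] in \<open>auto simp: PiE_iff\<close>)
    moreover have "snd (slice_incl K (points A) p) (preim W.X ?\<Phi> U) (snd ?\<Phi> U s) =
        (\<lambda>t\<in>{t \<in> K p. F p t \<in> U}. coset_value (F p t) (s (F p t)))"
      if U: "openin (spec_top A) U" and s: "s \<in> carrier (spec_sections A U)" for U s
    proof -
      let ?W = "{w \<in> topspace ?T. \<phi> w \<in> U}"
      have \<phi>F: "\<phi> \<in> topspace ?T \<rightarrow> points A" using \<phi>E by blast
      have W: "openin ?T ?W"
        by (rule openin_continuous_map_preimage[OF W.continuous_map_spec_P[OF \<phi>F \<phi>S] U])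
      have sec: "(\<lambda>w\<in>?W. coset_value (\<phi> w) (s (\<phi> w))) \<in> W.S ?W"
        by (rule W.pullback_section[OF \<phi>F \<phi>S s])
      have "snd (slice_incl K (points A) p) ?W (\<lambda>w\<in>?W. coset_value (\<phi> w) (s (\<phi> w))) =
          (\<lambda>t\<in>{t. (p, t) \<in> ?W}. (\<lambda>w\<in>?W. coset_value (\<phi> w) (s (\<phi> w))) (p, t))"
        using W sec unfolding slice_incl_def by (simp only: snd_conv restrict_apply' mem_Collect_eq)
      also have "\<dots> = (\<lambda>t\<in>{t \<in> K p. F p t \<in> U}. coset_value (F p t) (s (F p t)))"
      proof -
        have slice: "{t. (p, t) \<in> ?W} = {t \<in> K p. F p t \<in> U}" using p \<phi>[OF p] by auto
        have "(\<lambda>w\<in>?W. coset_value (\<phi> w) (s (\<phi> w))) (p, t) = coset_value (F p t) (s (F p t))"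
          if "t \<in> {t \<in> K p. F p t \<in> U}" for t
          using that p \<phi>[OF p] by simp
        then show ?thesis unfolding slice by (rule restrict_ext)
      qed
      finally show ?thesis unfolding snd_pullback_map[OF U s] W.preim_X fst_pullback_map .
    qed
    ultimately show ?thesis
      unfolding space_map_comp_def pullback_map_def[of A "K p"] interval_space_eq Spec_simps
      by (intro prod_eqI) (auto simp: slice_incl_def function_space_def intro!: restrict_ext)
  qed
  have "is_flow (Spec A) v W.X ?\<Phi>"
    unfolding is_flow_def Spec_simps W.X_simps topspace_spec
  proof (intro conjI exI[of _ K] ballI W.local_cinf_ringed_space map top)
    fix p assume p: "p \<in> points A"
    have "maximal_integral_curve (Spec A) v p (K p) (pullback_map A (K p) (F p))"
      by (rule maximal_integral_curve_trajectory[OF F[OF p] max[OF p]])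
    then show "\<exists>\<zeta>. space_map (interval_space (K p)) W.X \<zeta> \<and> (\<forall>t\<in>K p. fst \<zeta> t = (p, t)) \<and>
        maximal_integral_curve (Spec A) v p (K p) (space_map_comp (interval_space (K p)) W.X (Spec A) ?\<Phi> \<zeta>)"
      using slice_incl_space_map[OF p, of K] comp[OF p]
      by (intro exI[of _ "slice_incl K (points A) p"]) (simp add: slice_incl_def)
  qed
  then show ?thesis by blast
qed

end

theorem theorem1p11:
  fixes A :: "'a cinf_ring"
    and v :: "('a \<Rightarrow> real) set \<Rightarrow> (('a \<Rightarrow> real) \<Rightarrow> 'a set) \<Rightarrow> ('a \<Rightarrow> real) \<Rightarrow> 'a set"
  assumes "cinf_ring A"
    and "finitely_generated A"
    and "germ_determined TYPE('i \<times> 'b) A"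
    and "vector_field (Spec A) v"
  shows "(\<exists>(W :: (('a \<Rightarrow> real) \<times> real, (('a \<Rightarrow> real) \<times> real) \<Rightarrow> real) cinf_space) \<Phi>.
            is_flow (Spec A) v W \<Phi>) \<and>
         (\<forall>p\<in>topspace (base (Spec A)).
            \<exists>!K\<mu>. maximal_integral_curve (Spec A) v p (fst K\<mu>) (snd K\<mu>))"
proof -
  obtain n X where X: "X \<in> tuples n (carrier A)" "\<And>a. a \<in> carrier A \<Longrightarrow> \<exists>\<beta>\<in>Cinf n. a = cop A n \<beta> X"
    by (rule cinf_ring.finitely_generated_generators[OF assms(1,2)]) blast
  interpret fg_spec_vector_field A v n X
    by (intro fg_spec_vector_field.intro spec_vector_field.intro spec_vector_field_axioms.intro
        fg_spec_vector_field_axioms.intro assms(1,4) X)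
  show ?thesis
    using flow_exists maximal_integral_curve_ex1 by (simp add: topspace_spec)
qed

end
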